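(* Let $n\ge2$, let $\mathbf c\in\mathbb Z_{>0}^n$ be primitive, let $r^2\in\mathbb Z_{>0}$, and let $L=\langle\mathbf c,r^2\rangle$. Let $h$ be an index with $c_h=\min_i c_i$, let $D_h=\frac12\sqrt{\lVert\mathbf c\rVert^2+(n-2)c_h^2}$, and let $W=\lceil D_h\rceil+1$. Then the problem $$\max\{\mathbf c^\top\mathbf x:\ \mathbf x\in\mathbb Z^n,\ \lVert\mathbf x\rVert\le r\}$$ can be solved exactly (by the objective-level dynamic program described in the context) in $$O\left(nW^2\lVert\mathbf c\rVert_1^2\right)\operatorname{poly}(L)=O\left(n^4c_{\max}^4\right)\operatorname{poly}(L)$$ bit time. More explicitly, the state and transition count is bounded, up to an absolute constant, by $$O\left(n\lVert\mathbf c\rVert_1^2\bigl(1+\lVert\mathbf c\rVert^2+(n-2)c_h^2\bigr)\right).$$ In particular, the dependence of the running time on the radius is polynomial in the binary encoding length of $r^2$.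
   Context: $\lVert\cdot\rVert$ is the Euclidean norm, $\lVert\cdot\rVert_1$ the $\ell_1$ norm, $c_{\max}=\max_i|c_i|$, $r=\sqrt{r^2}$, and $\lfloor z\rceil=\lfloor z+\frac12\rfloor$. A vector $\mathbf c\in\mathbb Z^n$ is primitive if $\gcd(c_1,\dots,c_n)=1$. $\langle\mathbf c,r^2\rangle$ is the total binary encoding length of the input; $\operatorname{poly}(L)$ denotes an unspecified polynomial factor. Objective-level dynamic program: scan the integers $V$ in the interval $\bigl[\max\{0,\lceil r\lVert\mathbf c\rVert-\lVert\mathbf c\rVert_1\rceil\},\lfloor r\lVert\mathbf c\rVert\rfloor\bigr]$ from largest to smallest. For each $V$ set $s_i=\lfloor Vc_i/\lVert\mathbf c\rVert^2\rceil$ and $\rho=V-\sum_ic_is_i$. For $i=0,\dots,n$ and integers $p$ with $|p|\le W\lVert\mathbf c\rVert_1$, let $f_i(p)$ be the minimum of $\sum_{j=1}^i(s_j+y_j)^2$ over integers $y_1,\dots,y_i$ with $-W\le y_j\le W$ and $\sum_{j=1}^ic_jy_j=p$ ($+\infty$ if there are none). It is computed by $f_0(0)=0$, $f_0(p)=+\infty$ for $p\neq0$, and $$f_i(p)=\min_{-W\le y_i\le W}\bigl[f_{i-1}(p-c_iy_i)+(s_i+y_i)^2\bigr].$$ Stop at the first $V$ with $f_n(\rho)\le r^2$, and return $V$ as the optimal value, with the corresponding point $x_i=s_i+y_i$ recovered by backtracking. The state and transition count is the total number of pairs (state, considered value of $y_i$) over all scanned $V$. *)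

theory Defs
  imports
    "HOL-Analysis.L2_Norm"
    "HOL-Library.Log_Nat"
    "HOL-Library.Extended_Nat"
begin

section \<open>Bit lengths and a machine model with bit costs\<close>

text \<open>Number of binary digits of the absolute value, plus one sign bit.\<close>

definition bit_len :: "int \<Rightarrow> nat" where
  "bit_len z = nat (bitlen \<bar>z\<bar>) + 1"

text \<open>
  Bit time is measured on a random access machine with unbounded integers and logarithmic cost,
  programmed in a while language. A store maps a name and an integer index to an integer; a
  scalar variable is the cell with index 0. Every read, write and arithmetic operation is charged
  by the bit lengths of the integers involved (including the index of an accessed cell);
  multiplication and floor division are charged the product of the operand lengths, as for the
  schoolbook methods.
\<close>

type_synonym 'v store = "'v \<Rightarrow> int \<Rightarrow> int"

datatype 'v aexp =
    N int
  | Cell 'v "'v aexp"  ("_\<lblot>_\<rblot>" [1000, 0] 999)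
  | Plus "'v aexp" "'v aexp"  (infixl "\<oplus>" 65)
  | Minus "'v aexp" "'v aexp"  (infixl "\<ominus>" 65)
  | Times "'v aexp" "'v aexp"  (infixl "\<otimes>" 70)
  | Div "'v aexp" "'v aexp"  (infixl "\<oslash>" 70)

abbreviation Scalar :: "'v \<Rightarrow> 'v aexp"  ("\<acute>_" [1000] 1000) where
  "\<acute>x \<equiv> x\<lblot>N 0\<rblot>"

datatype 'v bexp =
    Leq "'v aexp" "'v aexp"  (infix "\<preceq>" 50)
  | Less "'v aexp" "'v aexp"  (infix "\<prec>" 50)
  | And "'v bexp" "'v bexp"
  | Or "'v bexp" "'v bexp"

datatype 'v com =
    Assign 'v "'v aexp" "'v aexp"  ("(_\<lblot>_\<rblot> ::=/ _)" [1000, 0, 61] 61)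
  | Seq "'v com" "'v com"  ("_;;/ _" [60, 61] 60)
  | If "'v bexp" "'v com" "'v com"  ("(IF _/ THEN _/ ELSE _)" [0, 0, 61] 61)
  | While "'v bexp" "'v com"  ("(WHILE _/ DO _)" [0, 61] 61)
  | Skip  ("SKIP")

abbreviation Assign_scalar :: "'v \<Rightarrow> 'v aexp \<Rightarrow> 'v com"  ("(_ ::=/ _)" [1000, 61] 61) where
  "x ::= e \<equiv> x\<lblot>N 0\<rblot> ::= e"

primrec aval :: "'v aexp \<Rightarrow> 'v store \<Rightarrow> int" where
  "aval (N k) \<sigma> = k"
| "aval (x\<lblot>e\<rblot>) \<sigma> = \<sigma> x (aval e \<sigma>)"
| "aval (a \<oplus> b) \<sigma> = aval a \<sigma> + aval b \<sigma>"
| "aval (a \<ominus> b) \<sigma> = aval a \<sigma> - aval b \<sigma>"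
| "aval (a \<otimes> b) \<sigma> = aval a \<sigma> * aval b \<sigma>"
| "aval (a \<oslash> b) \<sigma> = aval a \<sigma> div aval b \<sigma>"

primrec acost :: "'v aexp \<Rightarrow> 'v store \<Rightarrow> nat" where
  "acost (N k) \<sigma> = bit_len k"
| "acost (x\<lblot>e\<rblot>) \<sigma> = acost e \<sigma> + bit_len (aval e \<sigma>) + bit_len (\<sigma> x (aval e \<sigma>))"
| "acost (a \<oplus> b) \<sigma> = acost a \<sigma> + acost b \<sigma> + bit_len (aval a \<sigma>) + bit_len (aval b \<sigma>)"
| "acost (a \<ominus> b) \<sigma> = acost a \<sigma> + acost b \<sigma> + bit_len (aval a \<sigma>) + bit_len (aval b \<sigma>)"
| "acost (a \<otimes> b) \<sigma> = acost a \<sigma> + acost b \<sigma> + bit_len (aval a \<sigma>) * bit_len (aval b \<sigma>)"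
| "acost (a \<oslash> b) \<sigma> = acost a \<sigma> + acost b \<sigma> + bit_len (aval a \<sigma>) * bit_len (aval b \<sigma>)"

primrec bval :: "'v bexp \<Rightarrow> 'v store \<Rightarrow> bool" where
  "bval (a \<preceq> b) \<sigma> \<longleftrightarrow> aval a \<sigma> \<le> aval b \<sigma>"
| "bval (a \<prec> b) \<sigma> \<longleftrightarrow> aval a \<sigma> < aval b \<sigma>"
| "bval (And p q) \<sigma> \<longleftrightarrow> bval p \<sigma> \<and> bval q \<sigma>"
| "bval (Or p q) \<sigma> \<longleftrightarrow> bval p \<sigma> \<or> bval q \<sigma>"

primrec bcost :: "'v bexp \<Rightarrow> 'v store \<Rightarrow> nat" where
  "bcost (a \<preceq> b) \<sigma> = acost a \<sigma> + acost b \<sigma> + bit_len (aval a \<sigma>) + bit_len (aval b \<sigma>)"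
| "bcost (a \<prec> b) \<sigma> = acost a \<sigma> + acost b \<sigma> + bit_len (aval a \<sigma>) + bit_len (aval b \<sigma>)"
| "bcost (And p q) \<sigma> = bcost p \<sigma> + bcost q \<sigma> + 1"
| "bcost (Or p q) \<sigma> = bcost p \<sigma> + bcost q \<sigma> + 1"

text \<open>\<open>(P, \<sigma>) \<Rightarrow> t \<Down> \<tau>\<close>: started in \<open>\<sigma>\<close>, program \<open>P\<close> halts in \<open>\<tau>\<close> after bit time \<open>t\<close>.\<close>

inductive big_step :: "'v com \<times> 'v store \<Rightarrow> nat \<Rightarrow> 'v store \<Rightarrow> bool"
    ("_ \<Rightarrow> _ \<Down> _" [50, 50, 50] 50) where
  Skip: "(SKIP, \<sigma>) \<Rightarrow> 1 \<Down> \<sigma>"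
| Assign: "(x\<lblot>i\<rblot> ::= e, \<sigma>) \<Rightarrow>
      acost i \<sigma> + acost e \<sigma> + bit_len (aval i \<sigma>) + bit_len (aval e \<sigma>) \<Down>
      \<sigma>(x := (\<sigma> x)(aval i \<sigma> := aval e \<sigma>))"
| Seq: "\<lbrakk>(P, \<sigma>) \<Rightarrow> t1 \<Down> \<tau>; (Q, \<tau>) \<Rightarrow> t2 \<Down> \<upsilon>\<rbrakk> \<Longrightarrow> (P;; Q, \<sigma>) \<Rightarrow> t1 + t2 \<Down> \<upsilon>"
| IfTrue: "\<lbrakk>bval b \<sigma>; (P, \<sigma>) \<Rightarrow> t \<Down> \<tau>\<rbrakk> \<Longrightarrow> (IF b THEN P ELSE Q, \<sigma>) \<Rightarrow> bcost b \<sigma> + t + 1 \<Down> \<tau>"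
| IfFalse: "\<lbrakk>\<not> bval b \<sigma>; (Q, \<sigma>) \<Rightarrow> t \<Down> \<tau>\<rbrakk> \<Longrightarrow> (IF b THEN P ELSE Q, \<sigma>) \<Rightarrow> bcost b \<sigma> + t + 1 \<Down> \<tau>"
| WhileFalse: "\<not> bval b \<sigma> \<Longrightarrow> (WHILE b DO P, \<sigma>) \<Rightarrow> bcost b \<sigma> + 1 \<Down> \<sigma>"
| WhileTrue: "\<lbrakk>bval b \<sigma>; (P, \<sigma>) \<Rightarrow> t1 \<Down> \<tau>; (WHILE b DO P, \<tau>) \<Rightarrow> t2 \<Down> \<upsilon>\<rbrakk> \<Longrightarrow>
      (WHILE b DO P, \<sigma>) \<Rightarrow> bcost b \<sigma> + t1 + t2 + 1 \<Down> \<upsilon>"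

inductive_cases SkipE: "(SKIP, \<sigma>) \<Rightarrow> t \<Down> \<tau>"
inductive_cases AssignE: "(x\<lblot>i\<rblot> ::= e, \<sigma>) \<Rightarrow> t \<Down> \<tau>"
inductive_cases SeqE: "(P;; Q, \<sigma>) \<Rightarrow> t \<Down> \<tau>"
inductive_cases IfE: "(IF b THEN P ELSE Q, \<sigma>) \<Rightarrow> t \<Down> \<tau>"
inductive_cases WhileE: "(WHILE b DO P, \<sigma>) \<Rightarrow> t \<Down> \<tau>"

text \<open>Running time and final store are determined by program and initial store.\<close>

lemma big_step_deterministic:
  assumes "(P, \<sigma>) \<Rightarrow> t \<Down> \<tau>" and "(P, \<sigma>) \<Rightarrow> t' \<Down> \<tau>'"
  shows "t = t' \<and> \<tau> = \<tau>'"
proof -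
  have "cfg \<Rightarrow> t \<Down> \<tau> \<Longrightarrow> cfg \<Rightarrow> t' \<Down> \<tau>' \<Longrightarrow> t = t' \<and> \<tau> = \<tau>'"
    for cfg :: "'a com \<times> 'a store"
  proof (induction cfg t \<tau> arbitrary: t' \<tau>' rule: big_step.induct)
    case (Skip \<sigma>)
    then show ?case by (auto elim: SkipE)
  next
    case (Assign x i e \<sigma>)
    then show ?case by (auto elim: AssignE)
  next
    case (Seq P \<sigma> t1 \<tau> Q t2 \<upsilon>)
    from Seq.prems obtain u1 u2 \<tau>2 where "t' = u1 + u2"
      and 1: "(P, \<sigma>) \<Rightarrow> u1 \<Down> \<tau>2" and 2: "(Q, \<tau>2) \<Rightarrow> u2 \<Down> \<tau>'"
      by (auto elim: SeqE)
    moreover from Seq.IH(1)[OF 1] have "t1 = u1" "\<tau> = \<tau>2" by auto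
    moreover from this Seq.IH(2) 2 have "t2 = u2" "\<upsilon> = \<tau>'" by auto
    ultimately show ?case by simp
  next
    case (IfTrue b \<sigma> P t \<tau> Q)
    from IfTrue.prems IfTrue.hyps obtain u where "t' = Suc (bcost b \<sigma> + u)"
      and "(P, \<sigma>) \<Rightarrow> u \<Down> \<tau>'"
      by (auto elim: IfE)
    with IfTrue.IH show ?case by auto
  next
    case (IfFalse b \<sigma> Q t \<tau> P)
    from IfFalse.prems IfFalse.hyps obtain u where "t' = Suc (bcost b \<sigma> + u)"
      and "(Q, \<sigma>) \<Rightarrow> u \<Down> \<tau>'"
      by (auto elim: IfE)
    with IfFalse.IH show ?case by auto
  next
    case (WhileFalse b \<sigma> P)
    then show ?case by (auto elim: WhileE)
  next
    case (WhileTrue b \<sigma> P t1 \<tau> t2 \<upsilon>)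
    from WhileTrue.prems WhileTrue.hyps obtain u1 u2 \<tau>2
      where "t' = Suc (bcost b \<sigma> + u1 + u2)"
      and 1: "(P, \<sigma>) \<Rightarrow> u1 \<Down> \<tau>2" and 2: "(WHILE b DO P, \<tau>2) \<Rightarrow> u2 \<Down> \<tau>'"
      by (auto elim: WhileE)
    moreover from WhileTrue.IH(1)[OF 1] have "t1 = u1" "\<tau> = \<tau>2" by auto
    moreover from this WhileTrue.IH(2) 2 have "t2 = u2" "\<upsilon> = \<tau>'" by auto
    ultimately show ?case by simp
  qed
  with assms show ?thesis by blast
qed

definition For :: "'v \<Rightarrow> 'v aexp \<Rightarrow> 'v aexp \<Rightarrow> 'v com \<Rightarrow> 'v com"
    ("(FOR _ FROM _ TO _/ DO _)" [1000, 0, 0, 61] 61) where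
  "FOR x FROM a TO b DO P = (x ::= a;; WHILE \<acute>x \<preceq> b DO (P;; x ::= \<acute>x \<oplus> N 1))"


section \<open>The optimization problem\<close>

text \<open>
  Vectors of length \<open>n\<close> are functions of which only the values at \<open>1, \<dots>, n\<close> matter. The integer
  \<open>R\<close> stands for the squared radius, so that the radius is \<open>sqrt R\<close>.
\<close>

definition norm2 :: "nat \<Rightarrow> (nat \<Rightarrow> int) \<Rightarrow> real" where
  "norm2 n x = L2_set (\<lambda>i. real_of_int (x i)) {1..n}"

definition norm1 :: "nat \<Rightarrow> (nat \<Rightarrow> int) \<Rightarrow> int" where
  "norm1 n x = (\<Sum>i=1..n. \<bar>x i\<bar>)"

definition cmax :: "nat \<Rightarrow> (nat \<Rightarrow> int) \<Rightarrow> int" where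
  "cmax n c = Max ((\<lambda>i. \<bar>c i\<bar>) ` {1..n})"

definition primitive :: "nat \<Rightarrow> (nat \<Rightarrow> int) \<Rightarrow> bool" where
  "primitive n c \<longleftrightarrow> Gcd (c ` {1..n}) = 1"

definition input_len :: "nat \<Rightarrow> (nat \<Rightarrow> int) \<Rightarrow> int \<Rightarrow> nat" where
  "input_len n c R = (\<Sum>i=1..n. bit_len (c i)) + bit_len R"

definition objective :: "nat \<Rightarrow> (nat \<Rightarrow> int) \<Rightarrow> (nat \<Rightarrow> int) \<Rightarrow> int" where
  "objective n c x = (\<Sum>i=1..n. c i * x i)"

definition feasible :: "nat \<Rightarrow> int \<Rightarrow> (nat \<Rightarrow> int) \<Rightarrow> bool" where
  "feasible n R x \<longleftrightarrow> norm2 n x \<le> sqrt (real_of_int R)"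

definition covering_bound :: "nat \<Rightarrow> (nat \<Rightarrow> int) \<Rightarrow> nat \<Rightarrow> real" where
  "covering_bound n c h = 1 / 2 * sqrt ((norm2 n c)\<^sup>2 + (real n - 2) * (real_of_int (c h))\<^sup>2)"


section \<open>The objective-level dynamic program\<close>

definition levels :: "nat \<Rightarrow> (nat \<Rightarrow> int) \<Rightarrow> int \<Rightarrow> int set" where
  "levels n c R =
    {max 0 \<lceil>sqrt (real_of_int R) * norm2 n c - real_of_int (norm1 n c)\<rceil> ..
     \<lfloor>sqrt (real_of_int R) * norm2 n c\<rfloor>}"

definition centre :: "nat \<Rightarrow> (nat \<Rightarrow> int) \<Rightarrow> int \<Rightarrow> nat \<Rightarrow> int" where
  "centre n c V i = round (real_of_int V * real_of_int (c i) / (norm2 n c)\<^sup>2)"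

definition residual :: "nat \<Rightarrow> (nat \<Rightarrow> int) \<Rightarrow> int \<Rightarrow> int" where
  "residual n c V = V - (\<Sum>i=1..n. c i * centre n c V i)"

text \<open>
  \<open>dp_f c s W i p\<close> is \<open>f\<^sub>i(p)\<close>. The infimum in \<open>enat\<close> is a minimum, and infinity if there are
  no admissible \<open>y\<close>; in particular it is infinite for \<open>\<bar>p\<bar> > W * norm1 i c\<close>, so that tabulating
  only \<open>\<bar>p\<bar> \<le> W * norm1 n c\<close> loses nothing.
\<close>

definition dp_f :: "(nat \<Rightarrow> int) \<Rightarrow> (nat \<Rightarrow> int) \<Rightarrow> int \<Rightarrow> nat \<Rightarrow> int \<Rightarrow> enat" where
  "dp_f c s W i p =
    (INF y \<in> {y. (\<forall>j\<in>{1..i}. - W \<le> y j \<and> y j \<le> W) \<and> (\<Sum>j=1..i. c j * y j) = p}.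
       enat (nat (\<Sum>j=1..i. (s j + y j)\<^sup>2)))"

lemma dp_f_0: "dp_f c s W 0 p = (if p = 0 then 0 else \<infinity>)"
  by (auto simp: dp_f_def zero_enat_def top_enat_def inf_min)

lemma dp_f_Suc:
  "dp_f c s W (Suc i) p =
    (INF y \<in> {- W..W}. dp_f c s W i (p - c (Suc i) * y) + enat (nat ((s (Suc i) + y)\<^sup>2)))"
  (is "?l = ?r")
proof (rule antisym)
  show "?l \<le> ?r"
  proof (rule INF_greatest)
    fix y assume y: "y \<in> {- W..W}"
    let ?q = "p - c (Suc i) * y"
    let ?A = "{z. (\<forall>j\<in>{1..i}. - W \<le> z j \<and> z j \<le> W) \<and> (\<Sum>j=1..i. c j * z j) = ?q}"
    let ?v = "\<lambda>z. enat (nat (\<Sum>j=1..i. (s j + z j)\<^sup>2))"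
    show "?l \<le> dp_f c s W i ?q + enat (nat ((s (Suc i) + y)\<^sup>2))"
    proof (cases "?A = {}")
      case True
      then have "dp_f c s W i ?q = \<infinity>" by (simp only: dp_f_def image_empty Inf_empty top_enat_def inf_min)
      then show ?thesis by simp
    next
      case False
      then have "Inf (?v ` ?A) \<in> ?v ` ?A"
        by (metis (no_types, lifting) Inf_enat_def LeastI image_is_empty ex_in_conv)
      then obtain z where z: "z \<in> ?A" and fz: "dp_f c s W i ?q = ?v z"
        unfolding dp_f_def by auto
      define z' where "z' = z(Suc i := y)"
      have z': "(\<Sum>j=1..Suc i. g j (z' j)) = (\<Sum>j=1..i. g j (z j)) + g (Suc i) y"
        for g :: "nat \<Rightarrow> int \<Rightarrow> int"
      proof -
        have "(\<Sum>j=1..i. g j (z' j)) = (\<Sum>j=1..i. g j (z j))"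
          by (rule sum.cong) (auto simp: z'_def)
        then show ?thesis by (simp add: z'_def)
      qed
      have "?l \<le> enat (nat (\<Sum>j=1..Suc i. (s j + z' j)\<^sup>2))"
        unfolding dp_f_def
      proof (rule INF_lower)
        show "z' \<in> {z. (\<forall>j\<in>{1..Suc i}. - W \<le> z j \<and> z j \<le> W) \<and> (\<Sum>j=1..Suc i. c j * z j) = p}"
          using z y z'[of "\<lambda>j v. c j * v"] by (auto simp: z'_def)
      qed
      also have "\<dots> = ?v z + enat (nat ((s (Suc i) + y)\<^sup>2))"
        unfolding z'[of "\<lambda>j v. (s j + v)\<^sup>2"] by (simp add: nat_add_distrib sum_nonneg)
      finally show ?thesis by (simp only: fz)
    qed
  qed
next
  show "?r \<le> ?l"
    unfolding dp_f_def[of c s W "Suc i"]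
  proof (rule INF_greatest)
    fix z assume z: "z \<in> {z. (\<forall>j\<in>{1..Suc i}. - W \<le> z j \<and> z j \<le> W) \<and> (\<Sum>j=1..Suc i. c j * z j) = p}"
    have "?r \<le> dp_f c s W i (p - c (Suc i) * z (Suc i)) + enat (nat ((s (Suc i) + z (Suc i))\<^sup>2))"
      by (rule INF_lower) (use z in auto)
    also have "\<dots> \<le> enat (nat (\<Sum>j=1..i. (s j + z j)\<^sup>2)) + enat (nat ((s (Suc i) + z (Suc i))\<^sup>2))"
      unfolding dp_f_def by (intro add_right_mono INF_lower) (use z in auto)
    also have "\<dots> = enat (nat (\<Sum>j=1..Suc i. (s j + z j)\<^sup>2))"
      by (simp add: nat_add_distrib sum_nonneg)
    finally show "?r \<le> enat (nat (\<Sum>j=1..Suc i. (s j + z j)\<^sup>2))" .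
  qed
qed

definition accepts :: "nat \<Rightarrow> (nat \<Rightarrow> int) \<Rightarrow> int \<Rightarrow> int \<Rightarrow> int \<Rightarrow> bool" where
  "accepts n c R W V \<longleftrightarrow> dp_f c (centre n c V) W n (residual n c V) \<le> enat (nat R)"

text \<open>The accepted level, if there is one, belongs to the scanned levels.\<close>

definition scanned :: "nat \<Rightarrow> (nat \<Rightarrow> int) \<Rightarrow> int \<Rightarrow> int \<Rightarrow> int set" where
  "scanned n c R W = {V \<in> levels n c R. \<forall>V'\<in>levels n c R. V < V' \<longrightarrow> \<not> accepts n c R W V'}"

text \<open>
  \<open>x\<close> is recovered from the table of level \<open>V\<close> by backtracking: \<open>p n, \<dots>, p 0\<close> are the visited
  second components of the states and \<open>y n, \<dots>, y 1\<close> the minimizers chosen there.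
\<close>

definition backtracked ::
    "nat \<Rightarrow> (nat \<Rightarrow> int) \<Rightarrow> int \<Rightarrow> int \<Rightarrow> (nat \<Rightarrow> int) \<Rightarrow> bool" where
  "backtracked n c W V x \<longleftrightarrow>
    (let s = centre n c V; f = dp_f c s W in
     \<exists>p y. p n = residual n c V \<and>
       (\<forall>i\<in>{1..n}. - W \<le> y i \<and> y i \<le> W \<and> p (i - 1) = p i - c i * y i \<and>
          f i (p i) = f (i - 1) (p (i - 1)) + enat (nat ((s i + y i)\<^sup>2)) \<and>
          x i = s i + y i))"

definition dp_returns ::
    "nat \<Rightarrow> (nat \<Rightarrow> int) \<Rightarrow> int \<Rightarrow> int \<Rightarrow> int \<Rightarrow> (nat \<Rightarrow> int) \<Rightarrow> bool" where
  "dp_returns n c R W V x \<longleftrightarrow>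
    V \<in> scanned n c R W \<and> accepts n c R W V \<and> backtracked n c W V x"

text \<open>Quadruples \<open>(V, i, p, y)\<close>: level \<open>V\<close>, state \<open>(i, p)\<close>, considered value \<open>y\<close> of \<open>y\<^sub>i\<close>.\<close>

definition transitions :: "nat \<Rightarrow> (nat \<Rightarrow> int) \<Rightarrow> int \<Rightarrow> int \<Rightarrow> (int \<times> nat \<times> int \<times> int) set" where
  "transitions n c R W =
    scanned n c R W \<times> {1..n} \<times> {- (W * norm1 n c)..W * norm1 n c} \<times> {- W..W}"


section \<open>The dynamic program on the machine\<close>

datatype dp_var =
    vn | vc | vR  \<comment> \<open>input\<close>
  | vV | vx  \<comment> \<open>output\<close>
  | vcount  \<comment> \<open>number of transitions performed\<close>
  | vnorm | vl1 | vmin | vW | vM | vsq | va | vb | vmid | vlo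
  | vstop | vs | vrho | vf | vchoice | vbest | vbesty | vg | vq
  | vi | vp | vy

definition dp_input :: "nat \<Rightarrow> (nat \<Rightarrow> int) \<Rightarrow> int \<Rightarrow> dp_var store" where
  "dp_input n c R = (\<lambda>v k.
     if v = vn \<and> k = 0 then int n
     else if v = vc \<and> 1 \<le> k \<and> k \<le> int n then c (nat k)
     else if v = vR \<and> k = 0 then R
     else 0)"

text \<open>\<open>vnorm\<close>, \<open>vl1\<close>, \<open>vmin\<close>: squared Euclidean norm, \<open>\<ell>\<^sub>1\<close> norm and least entry of \<open>c\<close>.\<close>

definition prog_norms :: "dp_var com" where
  "prog_norms =
    (vnorm ::= N 0;; vl1 ::= N 0;; vmin ::= vc\<lblot>N 1\<rblot>;;
     FOR vi FROM N 1 TO \<acute>vn DO (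
       vnorm ::= \<acute>vnorm \<oplus> vc\<lblot>\<acute>vi\<rblot> \<otimes> vc\<lblot>\<acute>vi\<rblot>;;
       vl1 ::= \<acute>vl1 \<oplus> vc\<lblot>\<acute>vi\<rblot>;;
       IF vc\<lblot>\<acute>vi\<rblot> \<prec> \<acute>vmin THEN vmin ::= vc\<lblot>\<acute>vi\<rblot> ELSE SKIP))"

text \<open>
  \<open>vW\<close> is one more than the least \<open>w\<close> with \<open>4 w\<^sup>2 \<ge> vsq\<close>, where \<open>vsq\<close> is four times the
  squared covering bound; \<open>vM\<close> bounds the second components of the states.
\<close>

definition prog_window :: "dp_var com" where
  "prog_window =
    (vsq ::= \<acute>vnorm \<oplus> (\<acute>vn \<ominus> N 2) \<otimes> (\<acute>vmin \<otimes> \<acute>vmin);;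
     vW ::= N 0;;
     WHILE N 4 \<otimes> (\<acute>vW \<otimes> \<acute>vW) \<prec> \<acute>vsq DO vW ::= \<acute>vW \<oplus> N 1;;
     vW ::= \<acute>vW \<oplus> N 1;;
     vM ::= \<acute>vW \<otimes> \<acute>vl1)"

text \<open>
  Bisection for \<open>va = \<lfloor>sqrt vsq\<rfloor>\<close>, where \<open>vsq\<close> is now the square of radius times norm; \<open>vV\<close> and
  \<open>vlo\<close> become the largest and the smallest level.
\<close>

definition prog_levels :: "dp_var com" where
  "prog_levels =
    (vsq ::= \<acute>vR \<otimes> \<acute>vnorm;;
     va ::= N 0;; vb ::= \<acute>vsq \<oplus> N 1;;
     WHILE \<acute>va \<oplus> N 1 \<prec> \<acute>vb DO (
       vmid ::= (\<acute>va \<oplus> \<acute>vb) \<oslash> N 2;;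
       IF \<acute>vmid \<otimes> \<acute>vmid \<preceq> \<acute>vsq THEN va ::= \<acute>vmid ELSE vb ::= \<acute>vmid);;
     vV ::= \<acute>va;;
     vlo ::= \<acute>va \<ominus> \<acute>vl1;;
     (IF \<acute>va \<otimes> \<acute>va \<prec> \<acute>vsq THEN vlo ::= \<acute>vlo \<oplus> N 1 ELSE SKIP);;
     (IF \<acute>vlo \<prec> N 0 THEN vlo ::= N 0 ELSE SKIP))"

text \<open>Rounding to the nearest integer is done as \<open>\<lfloor>(2 V c\<^sub>i + vnorm) / (2 vnorm)\<rfloor>\<close>.\<close>

definition prog_centre :: "dp_var com" where
  "prog_centre =
    (vrho ::= \<acute>vV;;
     FOR vi FROM N 1 TO \<acute>vn DO (
       vs\<lblot>\<acute>vi\<rblot> ::= (N 2 \<otimes> (\<acute>vV \<otimes> vc\<lblot>\<acute>vi\<rblot>) \<oplus> \<acute>vnorm) \<oslash> (N 2 \<otimes> \<acute>vnorm);;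
       vrho ::= \<acute>vrho \<ominus> vc\<lblot>\<acute>vi\<rblot> \<otimes> vs\<lblot>\<acute>vi\<rblot>))"

text \<open>
  The entries for state \<open>(i, p)\<close> are stored at index \<open>i (2 vM + 1) + p + vM\<close>; the value \<open>-1\<close> in
  \<open>vf\<close> and \<open>vbest\<close> represents infinity.
\<close>

definition addr :: "dp_var aexp \<Rightarrow> dp_var aexp \<Rightarrow> dp_var aexp" where
  "addr i p = i \<otimes> (N 2 \<otimes> \<acute>vM \<oplus> N 1) \<oplus> (p \<oplus> \<acute>vM)"

definition prog_transition :: "dp_var com" where
  "prog_transition =
    (vcount ::= \<acute>vcount \<oplus> N 1;;
     vq ::= \<acute>vp \<ominus> vc\<lblot>\<acute>vi\<rblot> \<otimes> \<acute>vy;;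
     IF And (N 0 \<ominus> \<acute>vM \<preceq> \<acute>vq) (\<acute>vq \<preceq> \<acute>vM) THEN (
       vg ::= vf\<lblot>addr (\<acute>vi \<ominus> N 1) \<acute>vq\<rblot>;;
       IF N 0 \<preceq> \<acute>vg THEN (
         vg ::= \<acute>vg \<oplus> (vs\<lblot>\<acute>vi\<rblot> \<oplus> \<acute>vy) \<otimes> (vs\<lblot>\<acute>vi\<rblot> \<oplus> \<acute>vy);;
         IF Or (\<acute>vbest \<prec> N 0) (\<acute>vg \<prec> \<acute>vbest) THEN (vbest ::= \<acute>vg;; vbesty ::= \<acute>vy) ELSE SKIP)
       ELSE SKIP)
     ELSE SKIP)"

definition prog_table :: "dp_var com" where
  "prog_table =
    ((FOR vp FROM N 0 \<ominus> \<acute>vM TO \<acute>vM DO vf\<lblot>addr (N 0) \<acute>vp\<rblot> ::= N (-1));;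
     vf\<lblot>addr (N 0) (N 0)\<rblot> ::= N 0;;
     FOR vi FROM N 1 TO \<acute>vn DO
       FOR vp FROM N 0 \<ominus> \<acute>vM TO \<acute>vM DO (
         vbest ::= N (-1);;
         (FOR vy FROM N 0 \<ominus> \<acute>vW TO \<acute>vW DO prog_transition);;
         vf\<lblot>addr \<acute>vi \<acute>vp\<rblot> ::= \<acute>vbest;;
         vchoice\<lblot>addr \<acute>vi \<acute>vp\<rblot> ::= \<acute>vbesty))"

definition prog_backtrack :: "dp_var com" where
  "prog_backtrack =
    (vp ::= \<acute>vrho;; vi ::= \<acute>vn;;
     WHILE N 1 \<preceq> \<acute>vi DO (
       vy ::= vchoice\<lblot>addr \<acute>vi \<acute>vp\<rblot>;;
       vx\<lblot>\<acute>vi\<rblot> ::= vs\<lblot>\<acute>vi\<rblot> \<oplus> \<acute>vy;;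
       vp ::= \<acute>vp \<ominus> vc\<lblot>\<acute>vi\<rblot> \<otimes> \<acute>vy;;
       vi ::= \<acute>vi \<ominus> N 1))"

definition dp_prog :: "dp_var com" where
  "dp_prog =
    (prog_norms;; prog_window;; prog_levels;;
     vcount ::= N 0;; vstop ::= N 0;;
     WHILE And (\<acute>vstop \<preceq> N 0) (\<acute>vlo \<preceq> \<acute>vV) DO (
       prog_centre;; prog_table;;
       vg ::= vf\<lblot>addr \<acute>vn \<acute>vrho\<rblot>;;
       IF And (N 0 \<preceq> \<acute>vg) (\<acute>vg \<preceq> \<acute>vR) THEN (vstop ::= N 1;; prog_backtrack)
       ELSE vV ::= \<acute>vV \<ominus> N 1))"

end

theory Submission
  imports Defs
begin

text \<open>
  Correctness. The real point of level \<open>V\<close> closest to the origin is \<open>V c / \<parallel>c\<parallel>\<^sup>2\<close>, and shifts by the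
  vectors \<open>c\<^sub>h e\<^sub>i - c\<^sub>i e\<^sub>h\<close>, \<open>i \<noteq> h\<close>, move an integer point inside its level. Rounding the coefficients with
  respect to these vectors randomly and independently has expected squared error at most
  \<open>\<Sum>\<^bsub>i \<noteq> h\<^esub> (c\<^sub>h\<^sup>2 + c\<^sub>i\<^sup>2) / 4 = D\<^sub>h\<^sup>2\<close>, so a level containing a feasible point contains one whose
  coordinates are within \<open>W\<close> of the rounded centre, and the dynamic program accepts it. Cauchy-Schwarz
  and the rounded-down maximizer of the relaxation show that the optimum is one of at most
  \<open>\<parallel>c\<parallel>\<^sub>1 + 1\<close> levels.

  Running time. With \<open>G = n + \<parallel>c\<parallel>\<^sub>1 + \<parallel>c\<parallel>\<^sup>2 + R\<close>, whose length is linear in the input length, all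
  stored numbers are at most \<open>Z = G\<^sup>1\<^sup>0\<close>. Every elementary step therefore costs a constant times the
  square of the length of \<open>Z\<close>, and it remains to count steps; the bisection contributes one more factor
  of that length.
\<close>

section \<open>Bounding bit time by step counts\<close>

text \<open>A feasible point of a level need not lie in the window, and a point obtained by rounding
  need not be feasible. Pythagoras reconciles the two: all points of level \<open>V\<close> share
  the term \<open>V^2 / nrm\<close> of their squared norm, so feasibility depends only on the
  distance from the projection. A feasible point beyond the covering radius may therefore be
  exchanged for the covering point, which is shorter, and no level with a feasible point is
  rejected.

  Both ends of the level range come from the same real number, radius times norm, so the number of
  levels does not grow with the radius. The radius influences the time only through the lengths of
  the numbers handled.

  On the machine, the obstacle is that values, magnitudes and time have to be known together: a step
  has a price only if the operands are known to be small. \<open>run\<close> combines the three. It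
  prices a step by the weight of the program text, which for \<open>dp_prog\<close> is a fixed
  number and disappears in the absolute constant.\<close>

lemma bit_len_le_Suc_iff: "bit_len z \<le> Suc k \<longleftrightarrow> \<bar>z\<bar> < 2 ^ k"
  using bitlen_le_iff_power[of "\<bar>z\<bar>" "int k"] bitlen_nonneg[of "\<bar>z\<bar>"]
  by (simp add: bit_len_def nat_le_iff)

lemma bit_len_pos: "0 < bit_len z"
  by (simp add: bit_len_def)

lemma abs_less_bit_len: "\<bar>z\<bar> < 2 ^ (bit_len z - 1)"
  using bit_len_le_Suc_iff[of z "bit_len z - 1"] bit_len_pos[of z] by simp

lemma bit_len_mono: "\<bar>a\<bar> \<le> \<bar>b\<bar> \<Longrightarrow> bit_len a \<le> bit_len b"
  using bit_len_le_Suc_iff[of a "bit_len b - 1"] abs_less_bit_len[of b] bit_len_pos[of b] by simp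

lemma bit_len_uminus: "bit_len (- a) = bit_len a"
  by (simp add: bit_len_def)

lemma bit_len_mult: "bit_len (a * b) \<le> bit_len a + bit_len b - 1"
proof -
  have "\<bar>a * b\<bar> < 2 ^ (bit_len a - 1) * 2 ^ (bit_len b - 1)"
    unfolding abs_mult by (rule mult_strict_mono) (use abs_less_bit_len[of a] abs_less_bit_len[of b] in auto)
  also have "\<dots> = 2 ^ (bit_len a + bit_len b - 2)"
    using bit_len_pos[of a] bit_len_pos[of b] by (simp flip: power_add)
  finally show ?thesis
    using bit_len_le_Suc_iff[of "a * b" "bit_len a + bit_len b - 2"] bit_len_pos[of a] bit_len_pos[of b]
    by simp
qed

text \<open>A sum of lengths in place of a maximum plus one: valid because every length is at least
  1, even that of 0, and in the form that the additive \<open>size_weight\<close> needs.\<close>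

lemma bit_len_add: "bit_len (a + b) \<le> bit_len a + bit_len b"
proof -
  define k where "k = bit_len a + bit_len b - 2"
  have "\<bar>a + b\<bar> \<le> \<bar>a\<bar> + \<bar>b\<bar>" by simp
  also have "\<dots> < 2 ^ (bit_len a - 1) + 2 ^ (bit_len b - 1)"
    using abs_less_bit_len[of a] abs_less_bit_len[of b] by linarith
  also have "\<dots> \<le> 2 ^ k + 2 ^ k"
    unfolding k_def using bit_len_pos[of a] bit_len_pos[of b]
    by (intro add_mono power_increasing) auto
  finally have "\<bar>a + b\<bar> < 2 ^ Suc k" by simp
  then have "bit_len (a + b) \<le> Suc (Suc k)" by (simp only: bit_len_le_Suc_iff)
  then show ?thesis using bit_len_pos[of a] bit_len_pos[of b] by (simp add: k_def)
qed

lemma bit_len_diff: "bit_len (a - b) \<le> bit_len a + bit_len b"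
  using bit_len_add[of a "- b"] by (simp add: bit_len_uminus)

text \<open>Flooring moves a negative quotient away from 0, but for a positive divisor not beyond
  the dividend itself. Division by 0 yields 0.\<close>

lemma bit_len_div: "bit_len (a div b) \<le> bit_len a"
proof (rule bit_len_mono)
  have pos: "\<bar>x div y\<bar> \<le> \<bar>x\<bar>" if "0 < y" for x y :: int
  proof (cases "0 \<le> x")
    case True
    then show ?thesis using that zdiv_mono2[of x 1 y] by (simp add: pos_imp_zdiv_nonneg_iff)
  next
    case False
    have "x div y < 0" using False that by (simp add: div_neg_pos_less0)
    moreover have "x div y \<ge> x"
    proof -
      have "x * y \<le> x * 1" using that False by (intro mult_left_mono_neg) auto
      then have "x * y div y \<le> x div y" using that by (intro zdiv_mono1) auto
      then show ?thesis using that by simp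
    qed
    ultimately show ?thesis by linarith
  qed
  show "\<bar>a div b\<bar> \<le> \<bar>a\<bar>"
  proof (cases b "0::int" rule: linorder_cases)
    case less
    then show ?thesis using pos[of "- b" "- a"] by simp
  qed (use pos[of b a] in simp_all)
qed

text \<open>The 2 is the length of \<open>a ^ 0 = 1\<close>: one digit and the sign.\<close>

lemma bit_len_power: "bit_len (a ^ k) \<le> k * bit_len a + 2"
proof (induction k)
  case 0
  then show ?case using bit_len_le_Suc_iff[of 1 1] by simp
next
  case (Suc k)
  have "bit_len (a ^ Suc k) \<le> bit_len a + bit_len (a ^ k)"
    using bit_len_mult[of a "a ^ k"] by simp
  also have "\<dots> \<le> bit_len a + (k * bit_len a + 2)"
    using Suc.IH by simp
  finally show ?case by simp
qed

lemma bit_len_sum: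
  "finite A \<Longrightarrow> bit_len (\<Sum>i\<in>A. f i) \<le> (\<Sum>i\<in>A. bit_len (f i)) + 1"
proof (induction A rule: finite_induct)
  case empty
  then show ?case by (simp add: bit_len_def)
next
  case (insert a A)
  then show ?case using bit_len_add[of "f a" "sum f A"] by simp
qed

section \<open>Prices of expressions and programs relative to the length of \<open>Z\<close>\<close>

primrec size_weight :: "'v aexp \<Rightarrow> nat" where
  "size_weight (N k) = bit_len k"
| "size_weight (x\<lblot>e\<rblot>) = 1"
| "size_weight (a \<oplus> b) = size_weight a + size_weight b"
| "size_weight (a \<ominus> b) = size_weight a + size_weight b"
| "size_weight (a \<otimes> b) = size_weight a + size_weight b"
| "size_weight (a \<oslash> b) = size_weight a"

primrec aweight :: "'v aexp \<Rightarrow> nat" where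
  "aweight (N k) = bit_len k"
| "aweight (x\<lblot>e\<rblot>) = aweight e + size_weight e + 1"
| "aweight (a \<oplus> b) = aweight a + aweight b + size_weight a + size_weight b"
| "aweight (a \<ominus> b) = aweight a + aweight b + size_weight a + size_weight b"
| "aweight (a \<otimes> b) = aweight a + aweight b + size_weight a * size_weight b"
| "aweight (a \<oslash> b) = aweight a + aweight b + size_weight a * size_weight b"

primrec bweight :: "'v bexp \<Rightarrow> nat" where
  "bweight (a \<preceq> b) = aweight a + aweight b + size_weight a + size_weight b"
| "bweight (a \<prec> b) = aweight a + aweight b + size_weight a + size_weight b"
| "bweight (And p q) = bweight p + bweight q + 1"
| "bweight (Or p q) = bweight p + bweight q + 1"

primrec cweight :: "'v com \<Rightarrow> nat" where
  "cweight (x\<lblot>i\<rblot> ::= e) = aweight i + aweight e + size_weight i + size_weight e"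
| "cweight (P;; Q) = cweight P + cweight Q"
| "cweight (IF b THEN P ELSE Q) = bweight b + cweight P + cweight Q + 1"
| "cweight (WHILE b DO P) = bweight b + cweight P + 1"
| "cweight SKIP = 1"

primrec written :: "'v com \<Rightarrow> 'v set" where
  "written (x\<lblot>i\<rblot> ::= e) = {x}"
| "written (P;; Q) = written P \<union> written Q"
| "written (IF b THEN P ELSE Q) = written P \<union> written Q"
| "written (WHILE b DO P) = written P"
| "written SKIP = {}"

definition bounded_store :: "int \<Rightarrow> 'v store \<Rightarrow> bool" where
  "bounded_store Z \<sigma> \<longleftrightarrow> (\<forall>v k. \<bar>\<sigma> v k\<bar> \<le> Z)"

lemma bounded_store_upd:
  "bounded_store Z \<sigma> \<Longrightarrow> \<bar>a\<bar> \<le> Z \<Longrightarrow> bounded_store Z (\<sigma>(x := (\<sigma> x)(i := a)))"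
  by (simp add: bounded_store_def)

lemma bounded_storeD: "bounded_store Z \<sigma> \<Longrightarrow> \<bar>\<sigma> v k\<bar> \<le> Z"
  by (simp add: bounded_store_def)

text \<open>A cell weighs 1 whatever its index, because the bound holds for the whole store. Sums
  and products both add weights, so one linear bound covers every expression.\<close>

lemma bit_len_aval:
  assumes "bounded_store Z \<sigma>"
  shows "bit_len (aval e \<sigma>) \<le> size_weight e * bit_len Z"
proof (induction e)
  case (N k)
  then show ?case using bit_len_pos[of Z] by simp
next
  case (Cell x e)
  have "\<bar>\<sigma> x (aval e \<sigma>)\<bar> \<le> Z" using assms by (simp add: bounded_store_def)
  then show ?case by (simp add: bit_len_mono)
next
  case (Plus a b)
  then show ?case using bit_len_add[of "aval a \<sigma>" "aval b \<sigma>"] by (simp add: algebra_simps)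
next
  case (Minus a b)
  then show ?case using bit_len_diff[of "aval a \<sigma>" "aval b \<sigma>"] by (simp add: algebra_simps)
next
  case (Times a b)
  then show ?case using bit_len_mult[of "aval a \<sigma>" "aval b \<sigma>"] by (simp add: algebra_simps)
next
  case (Div a b)
  then show ?case using bit_len_div[of "aval a \<sigma>" "aval b \<sigma>"] by simp
qed

text \<open>Multiplication and division force the square of the length as unit of price. Linear
  charges are inflated to it, so that one unit serves all operations.\<close>

lemma le_mult_square_if_le_mult: "a \<le> k * (b::nat) \<Longrightarrow> a \<le> k * b\<^sup>2"
proof -
  assume "a \<le> k * b"
  also have "k * b \<le> k * b\<^sup>2"
    unfolding power2_eq_square by (rule mult_le_mono2) (cases b, auto)
  finally show ?thesis .
qed

lemma bit_len_aval_square: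
  "bounded_store Z \<sigma> \<Longrightarrow> bit_len (aval e \<sigma>) \<le> size_weight e * (bit_len Z)\<^sup>2"
  by (intro le_mult_square_if_le_mult bit_len_aval)

lemma acost_le:
  assumes "bounded_store Z \<sigma>"
  shows "acost e \<sigma> \<le> aweight e * (bit_len Z)\<^sup>2"
proof -
  note size = bit_len_aval_square[OF assms]
  have prod: "bit_len (aval a \<sigma>) * bit_len (aval b \<sigma>) \<le> size_weight a * size_weight b * (bit_len Z)\<^sup>2"
    for a b
  proof -
    have "bit_len (aval a \<sigma>) * bit_len (aval b \<sigma>) \<le> (size_weight a * bit_len Z) * (size_weight b * bit_len Z)"
      by (intro mult_le_mono bit_len_aval assms)
    then show ?thesis by (simp add: power2_eq_square algebra_simps)
  qed
  show ?thesis
  proof (induction e)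
    case (N k)
    then show ?case using bit_len_pos[of Z] by simp
  next
    case (Cell x e)
    then show ?case using size[of e] size[of "x\<lblot>e\<rblot>"] by (simp add: algebra_simps)
  next
    case (Plus a b)
    then show ?case using size[of a] size[of b] by (simp add: algebra_simps)
  next
    case (Minus a b)
    then show ?case using size[of a] size[of b] by (simp add: algebra_simps)
  next
    case (Times a b)
    then show ?case using prod[of a b] by (simp add: algebra_simps)
  next
    case (Div a b)
    then show ?case using prod[of a b] by (simp add: algebra_simps)
  qed
qed

lemma one_le_bit_len_square: "1 \<le> (bit_len Z)\<^sup>2"
  using bit_len_pos[of Z] by (simp add: Suc_le_eq)

lemma bcost_le:
  assumes "bounded_store Z \<sigma>"
  shows "bcost b \<sigma> \<le> bweight b * (bit_len Z)\<^sup>2"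
proof (induction b)
  case (Leq x y)
  then show ?case
    using acost_le[OF assms, of x] acost_le[OF assms, of y]
      bit_len_aval_square[OF assms, of x] bit_len_aval_square[OF assms, of y]
    by (simp add: algebra_simps)
next
  case (Less x y)
  then show ?case
    using acost_le[OF assms, of x] acost_le[OF assms, of y]
      bit_len_aval_square[OF assms, of x] bit_len_aval_square[OF assms, of y]
    by (simp add: algebra_simps)
next
  case (And p q)
  then show ?case using one_le_bit_len_square[of Z] by (simp add: algebra_simps)
next
  case (Or p q)
  then show ?case using one_le_bit_len_square[of Z] by (simp add: algebra_simps)
qed

text \<open>
  Total correctness with a bound on the store and a frame condition. The time is \<open>T\<close> steps, where
  the price of a step grows with the program text, so that the rules below need no side conditions
  on the constants involved.
\<close>

definition run :: "int \<Rightarrow> 'v com \<Rightarrow> 'v store \<Rightarrow> nat \<Rightarrow> ('v store \<Rightarrow> bool) \<Rightarrow> bool" where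
  "run Z P \<sigma> T Q \<longleftrightarrow> (bounded_store Z \<sigma> \<longrightarrow>
    (\<exists>t \<tau>. (P, \<sigma>) \<Rightarrow> t \<Down> \<tau> \<and> t \<le> T * (cweight P * (bit_len Z)\<^sup>2) \<and> bounded_store Z \<tau> \<and>
      (\<forall>v. v \<notin> written P \<longrightarrow> \<tau> v = \<sigma> v) \<and> Q \<tau>))"

lemma run_mono:
  assumes "run Z P \<sigma> T Q" and "T \<le> T'"
    and "\<And>\<tau>. \<lbrakk>Q \<tau>; \<forall>v. v \<notin> written P \<longrightarrow> \<tau> v = \<sigma> v; bounded_store Z \<tau>\<rbrakk> \<Longrightarrow> Q' \<tau>"
  shows "run Z P \<sigma> T' Q'"
  unfolding run_def
proof
  assume "bounded_store Z \<sigma>"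
  with assms(1) obtain t \<tau> where *: "(P, \<sigma>) \<Rightarrow> t \<Down> \<tau>" "t \<le> T * (cweight P * (bit_len Z)\<^sup>2)"
    "bounded_store Z \<tau>" "\<forall>v. v \<notin> written P \<longrightarrow> \<tau> v = \<sigma> v" "Q \<tau>"
    unfolding run_def by blast
  moreover have "t \<le> T' * (cweight P * (bit_len Z)\<^sup>2)"
    by (rule le_trans[OF *(2)]) (intro mult_le_mono1 assms(2))
  ultimately show "\<exists>t \<tau>. (P, \<sigma>) \<Rightarrow> t \<Down> \<tau> \<and> t \<le> T' * (cweight P * (bit_len Z)\<^sup>2) \<and>
      bounded_store Z \<tau> \<and> (\<forall>v. v \<notin> written P \<longrightarrow> \<tau> v = \<sigma> v) \<and> Q' \<tau>"
    using assms(3) by blast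
qed

text \<open>\<open>run\<close> promises nothing for an unbounded initial store, so boundedness may
  be assumed in its proof.\<close>

lemma run_bounded: "(bounded_store Z \<sigma> \<Longrightarrow> run Z P \<sigma> T Q) \<Longrightarrow> run Z P \<sigma> T Q"
  by (simp add: run_def)

text \<open>Only the assigned value must stay below \<open>Z\<close>. The index is never stored: its
  length is covered by its weight, and table addresses need no bound.\<close>

lemma run_Assign:
  assumes "bounded_store Z \<sigma> \<Longrightarrow> \<bar>aval e \<sigma>\<bar> \<le> Z" and "Q (\<sigma>(x := (\<sigma> x)(aval i \<sigma> := aval e \<sigma>)))"
  shows "run Z (x\<lblot>i\<rblot> ::= e) \<sigma> 1 Q"
  unfolding run_def
proof
  assume b: "bounded_store Z \<sigma>"
  have "acost i \<sigma> + acost e \<sigma> + bit_len (aval i \<sigma>) + bit_len (aval e \<sigma>) \<le>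
      1 * (cweight (x\<lblot>i\<rblot> ::= e) * (bit_len Z)\<^sup>2)"
    using acost_le[OF b, of i] acost_le[OF b, of e]
      bit_len_aval_square[OF b, of i] bit_len_aval_square[OF b, of e]
    by (simp add: algebra_simps)
  moreover have "bounded_store Z (\<sigma>(x := (\<sigma> x)(aval i \<sigma> := aval e \<sigma>)))"
    using b assms(1) by (simp add: bounded_store_upd)
  ultimately show "\<exists>t \<tau>. (x\<lblot>i\<rblot> ::= e, \<sigma>) \<Rightarrow> t \<Down> \<tau> \<and> t \<le> 1 * (cweight (x\<lblot>i\<rblot> ::= e) * (bit_len Z)\<^sup>2) \<and>
      bounded_store Z \<tau> \<and> (\<forall>v. v \<notin> written (x\<lblot>i\<rblot> ::= e) \<longrightarrow> \<tau> v = \<sigma> v) \<and> Q \<tau>"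
    using assms(2) big_step.Assign[of x i e \<sigma>] by fastforce
qed

lemma run_Skip: "Q \<sigma> \<Longrightarrow> run Z SKIP \<sigma> 1 Q"
  unfolding run_def using one_le_bit_len_square[of Z] big_step.Skip[of \<sigma>] by auto

text \<open>The product \<open>(T + T') * (cweight P + cweight P')\<close> gives away its two mixed
  terms. In return, steps and weights add up separately and need not be compared.\<close>

lemma run_Seq:
  assumes "run Z P \<sigma> T R"
    and "\<And>\<tau>. \<lbrakk>R \<tau>; \<forall>v. v \<notin> written P \<longrightarrow> \<tau> v = \<sigma> v; bounded_store Z \<tau>\<rbrakk> \<Longrightarrow> run Z P' \<tau> T' Q"
  shows "run Z (P;; P') \<sigma> (T + T') Q"
  unfolding run_def
proof
  let ?B = "(bit_len Z)\<^sup>2"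
  assume "bounded_store Z \<sigma>"
  with assms(1) obtain t \<tau> where 1: "(P, \<sigma>) \<Rightarrow> t \<Down> \<tau>" "t \<le> T * (cweight P * ?B)"
    "bounded_store Z \<tau>" "\<forall>v. v \<notin> written P \<longrightarrow> \<tau> v = \<sigma> v" "R \<tau>"
    unfolding run_def by blast
  with assms(2) obtain t' \<upsilon> where 2: "(P', \<tau>) \<Rightarrow> t' \<Down> \<upsilon>" "t' \<le> T' * (cweight P' * ?B)"
    "bounded_store Z \<upsilon>" "\<forall>v. v \<notin> written P' \<longrightarrow> \<upsilon> v = \<tau> v" "Q \<upsilon>"
    unfolding run_def by blast
  have "t + t' \<le> T * (cweight P * ?B) + T' * (cweight P' * ?B)"
    using 1 2 by simp
  also have "\<dots> \<le> (T + T') * (cweight (P;; P') * ?B)"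
    by (simp add: algebra_simps)
  finally show "\<exists>t \<upsilon>. (P;; P', \<sigma>) \<Rightarrow> t \<Down> \<upsilon> \<and> t \<le> (T + T') * (cweight (P;; P') * ?B) \<and>
      bounded_store Z \<upsilon> \<and> (\<forall>v. v \<notin> written (P;; P') \<longrightarrow> \<upsilon> v = \<sigma> v) \<and> Q \<upsilon>"
    using 1 2 by (intro exI[of _ "t + t'"] exI[of _ \<upsilon>]) (auto intro: big_step.Seq)
qed

lemma run_If:
  assumes "bval b \<sigma> \<Longrightarrow> run Z P \<sigma> T Q" and "\<not> bval b \<sigma> \<Longrightarrow> run Z P' \<sigma> T Q"
  shows "run Z (IF b THEN P ELSE P') \<sigma> (T + 1) Q"
  unfolding run_def
proof
  let ?B = "(bit_len Z)\<^sup>2"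
  let ?If = "IF b THEN P ELSE P'"
  assume bs: "bounded_store Z \<sigma>"
  define P'' where "P'' = (if bval b \<sigma> then P else P')"
  have "run Z P'' \<sigma> T Q" using assms by (simp add: P''_def)
  with bs obtain t \<tau> where t: "(P'', \<sigma>) \<Rightarrow> t \<Down> \<tau>" "t \<le> T * (cweight P'' * ?B)"
    "bounded_store Z \<tau>" "\<forall>v. v \<notin> written P'' \<longrightarrow> \<tau> v = \<sigma> v" "Q \<tau>"
    unfolding run_def by blast
  have step: "(?If, \<sigma>) \<Rightarrow> bcost b \<sigma> + t + 1 \<Down> \<tau>"
    using t(1) unfolding P''_def
    by (cases "bval b \<sigma>") (auto intro: big_step.IfTrue[simplified] big_step.IfFalse[simplified])
  have "t \<le> T * (cweight ?If * ?B)"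
    by (rule le_trans[OF t(2)]) (intro mult_le_mono2 mult_le_mono1, simp add: P''_def)
  then have "bcost b \<sigma> + t + 1 \<le> (bweight b + 1) * ?B + T * (cweight ?If * ?B)"
    using bcost_le[OF bs, of b] one_le_bit_len_square[of Z] by simp
  also have "\<dots> \<le> cweight ?If * ?B + T * (cweight ?If * ?B)"
    by (intro add_mono mult_le_mono1) auto
  also have "\<dots> = (T + 1) * (cweight ?If * ?B)"
    by simp
  finally show "\<exists>t \<tau>. (?If, \<sigma>) \<Rightarrow> t \<Down> \<tau> \<and> t \<le> (T + 1) * (cweight ?If * ?B) \<and>
      bounded_store Z \<tau> \<and> (\<forall>v. v \<notin> written ?If \<longrightarrow> \<tau> v = \<sigma> v) \<and> Q \<tau>"
    using step t by (intro exI[of _ "bcost b \<sigma> + t + 1"] exI[of _ \<tau>]) (auto simp: P''_def split: if_splits)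
qed

text \<open>\<open>k\<close> is an allowance of iterations rather than their exact number: the guard
  must fail once the allowance is used up and may fail earlier. This suits the bisection, where
  \<open>2 ^ k\<close> bounds a width, and the scan, which is ended by a flag.\<close>

lemma run_While:
  assumes "I k \<sigma>"
    and stop: "\<And>\<tau>. \<lbrakk>I 0 \<tau>; \<forall>v. v \<notin> written P \<longrightarrow> \<tau> v = \<sigma> v\<rbrakk> \<Longrightarrow> \<not> bval b \<tau>"
    and step: "\<And>k \<tau>. \<lbrakk>I (Suc k) \<tau>; bval b \<tau>; \<forall>v. v \<notin> written P \<longrightarrow> \<tau> v = \<sigma> v; bounded_store Z \<tau>\<rbrakk> \<Longrightarrow>
      run Z P \<tau> T (I k)"
    and exit: "\<And>k \<tau>. \<lbrakk>I k \<tau>; \<not> bval b \<tau>; \<forall>v. v \<notin> written P \<longrightarrow> \<tau> v = \<sigma> v; bounded_store Z \<tau>\<rbrakk> \<Longrightarrow> Q \<tau>"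
  shows "run Z (WHILE b DO P) \<sigma> (1 + k * (T + 1)) Q"
proof -
  let ?B = "(bit_len Z)\<^sup>2"
  let ?W = "WHILE b DO P"
  have main: "\<exists>t \<upsilon>. (?W, \<tau>) \<Rightarrow> t \<Down> \<upsilon> \<and> t \<le> (1 + k * (T + 1)) * (cweight ?W * ?B) \<and>
      bounded_store Z \<upsilon> \<and> (\<forall>v. v \<notin> written P \<longrightarrow> \<upsilon> v = \<sigma> v) \<and> Q \<upsilon>"
    if "I k \<tau>" "bounded_store Z \<tau>" "\<forall>v. v \<notin> written P \<longrightarrow> \<tau> v = \<sigma> v" for k \<tau>
    using that
  proof (induction k arbitrary: \<tau>)
    case (0 \<tau>)
    then have nb: "\<not> bval b \<tau>" using stop by blast
    have "bcost b \<tau> + 1 \<le> bweight b * ?B + ?B"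
      using bcost_le[OF 0(2), of b] one_le_bit_len_square[of Z] by linarith
    then show ?case using nb 0 exit[OF 0(1) nb]
      by (intro exI[of _ "bcost b \<tau> + 1"] exI[of _ \<tau>])
        (auto intro: big_step.WhileFalse[simplified] simp: algebra_simps)
  next
    case (Suc k \<tau>)
    have bc: "bcost b \<tau> + 1 \<le> (bweight b + 1) * ?B"
      using bcost_le[OF Suc.prems(2), of b] one_le_bit_len_square[of Z] by simp
    show ?case
    proof (cases "bval b \<tau>")
      case False
      have "bcost b \<tau> + 1 \<le> (1 + Suc k * (T + 1)) * (cweight ?W * ?B)"
        using bc by (auto simp: algebra_simps intro: le_trans)
      then show ?thesis using False Suc.prems exit[OF Suc.prems(1) False]
        by (intro exI[of _ "bcost b \<tau> + 1"] exI[of _ \<tau>])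
          (auto intro: big_step.WhileFalse[simplified])
    next
      case True
      with step[OF Suc.prems(1) True] Suc.prems
      obtain t1 \<tau>1 where 1: "(P, \<tau>) \<Rightarrow> t1 \<Down> \<tau>1" "t1 \<le> T * (cweight P * ?B)"
        "bounded_store Z \<tau>1" "\<forall>v. v \<notin> written P \<longrightarrow> \<tau>1 v = \<tau> v" "I k \<tau>1"
        unfolding run_def by blast
      with Suc.IH[of \<tau>1] Suc.prems
      obtain t2 \<upsilon> where 2: "(?W, \<tau>1) \<Rightarrow> t2 \<Down> \<upsilon>" "t2 \<le> (1 + k * (T + 1)) * (cweight ?W * ?B)"
        "bounded_store Z \<upsilon>" "\<forall>v. v \<notin> written P \<longrightarrow> \<upsilon> v = \<sigma> v" "Q \<upsilon>"
        by auto
      have "bcost b \<tau> + t1 + t2 + 1 \<le> cweight ?W * ?B + T * (cweight ?W * ?B) +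
          (1 + k * (T + 1)) * (cweight ?W * ?B)"
      proof -
        have "(bweight b + 1) * ?B \<le> cweight ?W * ?B" by simp
        moreover have "T * (cweight P * ?B) \<le> T * (cweight ?W * ?B)"
          by (intro mult_le_mono) auto
        ultimately show ?thesis using bc 1(2) 2(2) by linarith
      qed
      also have "\<dots> = (1 + Suc k * (T + 1)) * (cweight ?W * ?B)"
        by (simp only: distrib_right distrib_left mult_Suc mult_1 add.assoc)
      finally show ?thesis using big_step.WhileTrue[OF True 1(1) 2(1)] 2
        by (intro exI[of _ "bcost b \<tau> + t1 + t2 + 1"] exI[of _ \<upsilon>]) auto
    qed
  qed
  show ?thesis
    unfolding run_def using main[OF assms(1)] by simp
qed

text \<open>The counter overshoots to \<open>hi + 1\<close>, which therefore has to fit below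
  \<open>Z\<close>; \<open>lo = hi + 1\<close> admits an empty loop. The body establishes
  \<open>I (j + 1)\<close> while the counter still holds \<open>j\<close>, hence the demand that
  \<open>I\<close> ignore the counter. The two extra steps are the initial assignment and the final
  test.\<close>

lemma run_For:
  assumes lo: "aval a \<sigma> = lo" and le: "lo \<le> hi + 1" and bnd: "\<bar>lo\<bar> \<le> Z" "\<bar>hi + 1\<bar> \<le> Z"
    and x: "x \<notin> written P"
    and hi: "\<And>\<tau>. \<forall>v. v \<notin> insert x (written P) \<longrightarrow> \<tau> v = \<sigma> v \<Longrightarrow> aval b \<tau> = hi"
    and indep: "\<And>j \<tau> g. I j \<tau> \<Longrightarrow> I j (\<tau>(x := g))"
    and init: "I lo \<sigma>"
    and step: "\<And>j \<tau>. \<lbrakk>lo \<le> j; j \<le> hi; \<tau> x 0 = j; I j \<tau>;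
      \<forall>v. v \<notin> insert x (written P) \<longrightarrow> \<tau> v = \<sigma> v; bounded_store Z \<tau>\<rbrakk> \<Longrightarrow> run Z P \<tau> T (I (j + 1))"
    and exit: "\<And>\<tau>. \<lbrakk>\<tau> x 0 = hi + 1; I (hi + 1) \<tau>;
      \<forall>v. v \<notin> insert x (written P) \<longrightarrow> \<tau> v = \<sigma> v; bounded_store Z \<tau>\<rbrakk> \<Longrightarrow> Q \<tau>"
  shows "run Z (FOR x FROM a TO b DO P) \<sigma> (2 + nat (hi + 1 - lo) * (T + 2)) Q"
proof -
  define J where "J k \<tau> \<longleftrightarrow> \<tau> x 0 = hi + 1 - int k \<and> lo \<le> \<tau> x 0 \<and> I (\<tau> x 0) \<tau> \<and>
    (\<forall>v. v \<notin> insert x (written P) \<longrightarrow> \<tau> v = \<sigma> v)" for k \<tau>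
  have "run Z (FOR x FROM a TO b DO P) \<sigma> (1 + (1 + nat (hi + 1 - lo) * ((T + 1) + 1))) Q"
    unfolding For_def
  proof (rule run_Seq)
    show "run Z (x ::= a) \<sigma> 1 (\<lambda>\<tau>. J (nat (hi + 1 - lo)) \<tau>)"
      by (rule run_Assign) (use lo le bnd init indep in \<open>auto simp: J_def\<close>)
  next
    fix \<tau> assume J: "J (nat (hi + 1 - lo)) \<tau>"
    let ?body = "P;; x ::= \<acute>x \<oplus> N 1"
    show "run Z (WHILE \<acute>x \<preceq> b DO ?body) \<tau> (1 + nat (hi + 1 - lo) * ((T + 1) + 1)) Q"
    proof (rule run_While[where I = J, OF J])
      show "\<not> bval (\<acute>x \<preceq> b) \<tau>'" if "J 0 \<tau>'" for \<tau>'
        using that hi by (auto simp: J_def)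
    next
      fix k \<tau>1
      assume J1: "J (Suc k) \<tau>1" and b1: "bounded_store Z \<tau>1"
      show "run Z ?body \<tau>1 (T + 1) (J k)"
      proof (rule run_Seq)
        show "run Z P \<tau>1 T (I (\<tau>1 x 0 + 1))"
          by (rule step) (use J1 b1 in \<open>auto simp: J_def\<close>)
      next
        fix \<tau>2 assume I2: "I (\<tau>1 x 0 + 1) \<tau>2" and fr: "\<forall>v. v \<notin> written P \<longrightarrow> \<tau>2 v = \<tau>1 v"
        have x2: "\<tau>2 x 0 = \<tau>1 x 0" using fr x by simp
        show "run Z (x ::= \<acute>x \<oplus> N 1) \<tau>2 1 (J k)"
          by (rule run_Assign) (use I2 x2 J1 fr bnd indep in \<open>auto simp: J_def\<close>)
      qed
    next
      fix k \<tau>1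
      assume J1: "J k \<tau>1" and nb: "\<not> bval (\<acute>x \<preceq> b) \<tau>1" and b1: "bounded_store Z \<tau>1"
      have "aval b \<tau>1 = hi" using J1 hi by (auto simp: J_def)
      with J1 nb have "\<tau>1 x 0 = hi + 1" by (auto simp: J_def)
      with J1 b1 show "Q \<tau>1" by (intro exit) (auto simp: J_def)
    qed
  qed
  then show ?thesis by simp
qed

section \<open>Symbolic execution of loop-free code\<close>

primrec wp :: "int \<Rightarrow> 'v com \<Rightarrow> ('v store \<Rightarrow> bool) \<Rightarrow> 'v store \<Rightarrow> bool" where
  "wp Z (x\<lblot>i\<rblot> ::= e) Q = (\<lambda>\<sigma>. \<bar>aval e \<sigma>\<bar> \<le> Z \<and> Q (\<sigma>(x := (\<sigma> x)(aval i \<sigma> := aval e \<sigma>))))"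
| "wp Z (P;; P') Q = wp Z P (wp Z P' Q)"
| "wp Z (IF b THEN P ELSE P') Q = (\<lambda>\<sigma>. if bval b \<sigma> then wp Z P Q \<sigma> else wp Z P' Q \<sigma>)"
| "wp Z (WHILE b DO P) Q = (\<lambda>\<sigma>. False)"
| "wp Z SKIP Q = Q"

primrec straight_steps :: "'v com \<Rightarrow> nat" where
  "straight_steps (x\<lblot>i\<rblot> ::= e) = 1"
| "straight_steps (P;; P') = straight_steps P + straight_steps P'"
| "straight_steps (IF b THEN P ELSE P') = straight_steps P + straight_steps P' + 1"
| "straight_steps (WHILE b DO P) = 1"
| "straight_steps SKIP = 1"

text \<open>Turns a loop-free block into a single goal for the simplifier, including the magnitudes
  of all assigned values. Loops have precondition \<open>False\<close> and are left to
  \<open>run_While\<close> and \<open>run_For\<close>.\<close>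

lemma run_wp: "wp Z P Q \<sigma> \<Longrightarrow> straight_steps P \<le> T \<Longrightarrow> run Z P \<sigma> T Q"
proof (induction P arbitrary: Q \<sigma> T)
  case (Assign x i e)
  then have "run Z (x\<lblot>i\<rblot> ::= e) \<sigma> 1 Q" by (intro run_Assign) auto
  then show ?case by (rule run_mono) (use Assign in auto)
next
  case (Seq P P')
  have "run Z (P;; P') \<sigma> (straight_steps P + straight_steps P') Q"
    using Seq.prems(1) by (auto intro!: run_Seq[OF Seq.IH(1)] Seq.IH(2))
  then show ?case by (rule run_mono) (use Seq.prems in auto)
next
  case (If b P P')
  have "run Z (IF b THEN P ELSE P') \<sigma> (straight_steps P + straight_steps P' + 1) Q"
  proof (rule run_If)
    show "run Z P \<sigma> (straight_steps P + straight_steps P') Q" if "bval b \<sigma>"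
      using If.prems(1) that by (intro If.IH(1)) auto
    show "run Z P' \<sigma> (straight_steps P + straight_steps P') Q" if "\<not> bval b \<sigma>"
      using If.prems(1) that by (intro If.IH(2)) auto
  qed
  then show ?case by (rule run_mono) (use If.prems in auto)
next
  case Skip
  then have "run Z SKIP \<sigma> 1 Q" by (intro run_Skip) auto
  then show ?case by (rule run_mono) (use Skip in auto)
qed simp_all

section \<open>Correctness of the window and of the level range\<close>

text \<open>Derandomized independent rounding: each coordinate is rounded up with probability its
  fractional part \<open>f\<close>, so that the cross terms vanish on average and \<open>f (1 - f) \<le> 1 / 4\<close>.\<close>

lemma exists_rounding:
  fixes t b :: "'i \<Rightarrow> real" and a :: real
  assumes "finite S"
  shows "\<exists>k::'i \<Rightarrow> int. (\<Sum>i\<in>S. a\<^sup>2 * (t i - k i)\<^sup>2) + (\<Sum>i\<in>S. b i * (t i - k i))\<^sup>2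
    \<le> (\<Sum>i\<in>S. a\<^sup>2 + (b i)\<^sup>2) / 4"
  using assms
proof (induction S rule: finite_induct)
  case empty
  then show ?case by simp
next
  case (insert j S)
  then obtain k :: "'i \<Rightarrow> int" where k: "(\<Sum>i\<in>S. a\<^sup>2 * (t i - k i)\<^sup>2) + (\<Sum>i\<in>S. b i * (t i - k i))\<^sup>2
    \<le> (\<Sum>i\<in>S. a\<^sup>2 + (b i)\<^sup>2) / 4" by blast
  define q where "q = (\<Sum>i\<in>S. b i * (t i - k i))"
  define A where "A = a\<^sup>2 + (b j)\<^sup>2"
  define f where "f = frac (t j)"
  have f: "0 \<le> f" "f < 1" by (auto simp: f_def frac_lt_1)
  \<comment> \<open>Conditional expectations: with the earlier coordinates fixed, a new error
    \<open>d\<close> contributes \<open>A * d^2 + 2 * q * b j * d\<close>, and one of the two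
    integers around \<open>t j\<close> keeps this within the average \<open>A / 4\<close>.\<close>
  have "\<exists>e::int. A * (t j - e)\<^sup>2 + 2 * q * b j * (t j - e) \<le> A / 4"
  proof (rule ccontr)
    assume neg: "\<nexists>e::int. A * (t j - e)\<^sup>2 + 2 * q * b j * (t j - e) \<le> A / 4"
    have 1: "A / 4 < A * f\<^sup>2 + 2 * q * b j * f"
      using neg[unfolded not_ex, rule_format, of "\<lfloor>t j\<rfloor>"] by (simp add: f_def frac_def)
    have 2: "A / 4 < A * (f - 1)\<^sup>2 + 2 * q * b j * (f - 1)"
      using neg[unfolded not_ex, rule_format, of "\<lfloor>t j\<rfloor> + 1"]
      by (simp add: f_def frac_def diff_diff_eq)
    \<comment> \<open>Error \<open>f\<close> gets weight \<open>1 - f\<close> and error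
      \<open>f - 1\<close> gets weight \<open>f\<close>; the terms with \<open>q\<close> cancel and
      \<open>A * f * (1 - f)\<close> remains.\<close>
    have "A / 4 = (1 - f) * (A / 4) + f * (A / 4)" by (simp add: field_simps)
    also have "\<dots> < (1 - f) * (A * f\<^sup>2 + 2 * q * b j * f) + f * (A * (f - 1)\<^sup>2 + 2 * q * b j * (f - 1))"
      using 1 2 f by (intro add_less_le_mono mult_strict_left_mono mult_left_mono) auto
    also have "\<dots> = A * (f * (1 - f))" by (simp add: power2_eq_square algebra_simps)
    also have "\<dots> \<le> A * (1 / 4)"
    proof (rule mult_left_mono)
      have "0 \<le> (f - 1 / 2)\<^sup>2" by simp
      then show "f * (1 - f) \<le> 1 / 4" by (simp add: power2_eq_square algebra_simps)
    qed (simp add: A_def)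
    finally show False by simp
  qed
  then obtain e :: int where e: "A * (t j - e)\<^sup>2 + 2 * q * b j * (t j - e) \<le> A / 4" by blast
  define k' where "k' = k(j := e)"
  have same: "(\<Sum>i\<in>S. g i (k' i)) = (\<Sum>i\<in>S. g i (k i))" for g :: "'i \<Rightarrow> int \<Rightarrow> real"
    by (rule sum.cong) (use insert.hyps in \<open>auto simp: k'_def\<close>)
  have "(\<Sum>i\<in>insert j S. a\<^sup>2 * (t i - k' i)\<^sup>2) + (\<Sum>i\<in>insert j S. b i * (t i - k' i))\<^sup>2
    = a\<^sup>2 * (t j - e)\<^sup>2 + (\<Sum>i\<in>S. a\<^sup>2 * (t i - k i)\<^sup>2) + (b j * (t j - e) + q)\<^sup>2"
    unfolding sum.insert[OF insert.hyps] same[of "\<lambda>i v. a\<^sup>2 * (t i - v)\<^sup>2"]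
      same[of "\<lambda>i v. b i * (t i - v)"] by (simp add: k'_def q_def)
  also have "\<dots> = ((\<Sum>i\<in>S. a\<^sup>2 * (t i - k i)\<^sup>2) + q\<^sup>2) + (A * (t j - e)\<^sup>2 + 2 * q * b j * (t j - e))"
    unfolding A_def by (simp add: power2_eq_square algebra_simps)
  also have "\<dots> \<le> (\<Sum>i\<in>insert j S. a\<^sup>2 + (b i)\<^sup>2) / 4"
    using k e unfolding sum.insert[OF insert.hyps] by (simp add: q_def A_def add_divide_distrib)
  finally show ?case by blast
qed

section \<open>Squared norms and the value function of the dynamic program\<close>

lemma norm2_square: "(norm2 n x)\<^sup>2 = real_of_int (\<Sum>i=1..n. (x i)\<^sup>2)"
  by (simp add: norm2_def L2_set_def sum_nonneg)

lemma norm2_nonneg: "0 \<le> norm2 n x"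
  by (simp add: norm2_def)

lemma feasible_iff: "feasible n R x \<longleftrightarrow> (\<Sum>i=1..n. (x i)\<^sup>2) \<le> R"
proof -
  have "feasible n R x \<longleftrightarrow> sqrt (real_of_int (\<Sum>i=1..n. (x i)\<^sup>2)) \<le> sqrt (real_of_int R)"
    unfolding feasible_def norm2_def L2_set_def by simp
  then show ?thesis by (simp only: real_sqrt_le_iff of_int_le_iff)
qed

lemma dp_f_le:
  "(\<And>j. j \<in> {1..i} \<Longrightarrow> - W \<le> y j \<and> y j \<le> W) \<Longrightarrow> (\<Sum>j=1..i. c j * y j) = p \<Longrightarrow>
    dp_f c s W i p \<le> enat (nat (\<Sum>j=1..i. (s j + y j)\<^sup>2))"
  unfolding dp_f_def by (rule INF_lower) auto

text \<open>Infima of nonempty sets in \<open>enat\<close> are attained, and finiteness rules out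
  the empty set.\<close>

lemma dp_f_attained:
  assumes "dp_f c s W i p \<noteq> \<infinity>"
  obtains y where "\<And>j. j \<in> {1..i} \<Longrightarrow> - W \<le> y j \<and> y j \<le> W" "(\<Sum>j=1..i. c j * y j) = p"
    "dp_f c s W i p = enat (nat (\<Sum>j=1..i. (s j + y j)\<^sup>2))"
proof -
  let ?A = "{y. (\<forall>j\<in>{1..i}. - W \<le> y j \<and> y j \<le> W) \<and> (\<Sum>j=1..i. c j * y j) = p}"
  let ?v = "\<lambda>y. enat (nat (\<Sum>j=1..i. (s j + y j)\<^sup>2))"
  have "?A \<noteq> {}"
  proof
    assume "?A = {}"
    then have "dp_f c s W i p = \<infinity>"
      by (simp only: dp_f_def image_empty Inf_empty top_enat_def inf_min)
    then show False using assms by simp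
  qed
  then have "Inf (?v ` ?A) \<in> ?v ` ?A"
    by (metis (no_types, lifting) Inf_enat_def LeastI image_is_empty ex_in_conv)
  then obtain y where "y \<in> ?A" "dp_f c s W i p = ?v y" unfolding dp_f_def by blast
  then show ?thesis by (intro that[of y]) auto
qed

text \<open>Both recurrences telescope down to row 0. The endpoint \<open>p 0 = 0\<close> is not
  demanded of the trace: finiteness passes from row to row, and row 0 is finite only at 0.\<close>

lemma backtracked_value:
  assumes "\<And>i. i \<in> {1..n} \<Longrightarrow> p (i - 1) = p i - c i * y i \<and>
      dp_f c s W i (p i) = dp_f c s W (i - 1) (p (i - 1)) + enat (nat ((s i + y i)\<^sup>2))"
    and "dp_f c s W n (p n) \<noteq> \<infinity>"
  shows "p n = (\<Sum>i=1..n. c i * y i) \<and> dp_f c s W n (p n) = enat (nat (\<Sum>i=1..n. (s i + y i)\<^sup>2))"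
  using assms
proof (induction n)
  case 0
  then show ?case by (auto simp: dp_f_0 zero_enat_def split: if_splits)
next
  case (Suc n)
  have step: "p n = p (Suc n) - c (Suc n) * y (Suc n)"
    "dp_f c s W (Suc n) (p (Suc n)) = dp_f c s W n (p n) + enat (nat ((s (Suc n) + y (Suc n))\<^sup>2))"
    using Suc.prems(1)[of "Suc n"] by auto
  have "dp_f c s W n (p n) \<noteq> \<infinity>"
    using Suc.prems(2) step(2) by (metis plus_enat_simps(2))
  then have IH: "p n = (\<Sum>i=1..n. c i * y i) \<and> dp_f c s W n (p n) = enat (nat (\<Sum>i=1..n. (s i + y i)\<^sup>2))"
    by (intro Suc.IH Suc.prems(1)) auto
  have "dp_f c s W (Suc n) (p (Suc n)) =
      enat (nat (\<Sum>i=1..n. (s i + y i)\<^sup>2)) + enat (nat ((s (Suc n) + y (Suc n))\<^sup>2))"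
    unfolding step(2) conjunct2[OF IH] by (rule refl)
  then show ?case using IH step(1) by (simp add: nat_add_distrib sum_nonneg)
qed

section \<open>Quantities derived from an instance\<close>

locale dp_instance =
  fixes n :: nat and c :: "nat \<Rightarrow> int" and R :: int
  assumes n_ge: "2 \<le> n" and c_pos: "\<And>i. i \<in> {1..n} \<Longrightarrow> 0 < c i" and R_pos: "0 < R"
begin

definition nrm :: int where "nrm = (\<Sum>i=1..n. (c i)\<^sup>2)"
definition l1 :: int where "l1 = (\<Sum>i=1..n. c i)"
definition cmin :: int where "cmin = Min (c ` {1..n})"
text \<open>Four times the squared covering bound, an integer, so that the program can work with it
  exactly.\<close>

definition sq4 :: int where "sq4 = nrm + (int n - 2) * cmin\<^sup>2"
definition W :: int where "W = \<lceil>sqrt (real_of_int sq4) / 2\<rceil> + 1"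
definition hiV :: int where "hiV = \<lfloor>sqrt (real_of_int (R * nrm))\<rfloor>"
text \<open>The integer \<open>l1\<close> is taken out of the ceiling; the program likewise rounds
  the root up first and then subtracts.\<close>

definition loV :: int where "loV = max 0 (\<lceil>sqrt (real_of_int (R * nrm))\<rceil> - l1)"

lemma norm1_eq: "norm1 n c = l1"
  unfolding norm1_def l1_def by (rule sum.cong) (use c_pos in force)+

lemma norm2_sq: "(norm2 n c)\<^sup>2 = real_of_int nrm"
  by (simp add: norm2_square nrm_def)

lemma norm2_eq: "norm2 n c = sqrt (real_of_int nrm)"
  by (simp add: norm2_nonneg flip: norm2_sq)

lemma levels_eq: "levels n c R = {loV..hiV}"
  unfolding levels_def loV_def hiV_def norm1_eq norm2_eq
  by (simp add: real_sqrt_mult)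

lemma centre_eq: "centre n c V i = round (real_of_int V * c i / nrm)"
  by (simp add: centre_def norm2_sq)

lemma cmin_le: "i \<in> {1..n} \<Longrightarrow> cmin \<le> c i"
  unfolding cmin_def by (intro Min_le) auto

lemma cmin_attained: obtains h where "h \<in> {1..n}" "c h = cmin"
proof -
  have "cmin \<in> c ` {1..n}" unfolding cmin_def using n_ge by (intro Min_in) auto
  then show ?thesis using that by auto
qed

lemma cmin_pos: "0 < cmin"
  using cmin_attained c_pos by metis

lemma c_le_l1: "i \<in> {1..n} \<Longrightarrow> c i \<le> l1"
  unfolding l1_def by (rule member_le_sum) (use c_pos in \<open>auto intro: less_imp_le\<close>)

lemma c_sq_le_nrm: "i \<in> {1..n} \<Longrightarrow> (c i)\<^sup>2 \<le> nrm"
  unfolding nrm_def by (rule member_le_sum[of i _ "\<lambda>i. (c i)\<^sup>2"]) auto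

lemma n_le_l1: "int n \<le> l1"
proof -
  have "(\<Sum>i=1..n. 1) \<le> l1" unfolding l1_def by (rule sum_mono) (use c_pos in force)
  then show ?thesis by simp
qed

lemma n_cmin_sq_le: "int n * cmin\<^sup>2 \<le> nrm"
proof -
  have "(\<Sum>i=1..n. cmin\<^sup>2) \<le> nrm"
    unfolding nrm_def by (rule sum_mono) (use cmin_pos cmin_le in \<open>auto intro: power_mono\<close>)
  then show ?thesis by simp
qed

lemma nrm_ge: "int n \<le> nrm"
proof -
  have "int n * 1 \<le> int n * cmin\<^sup>2" using cmin_pos by (intro mult_left_mono) auto
  then show ?thesis using n_cmin_sq_le by simp
qed

lemma nrm_pos: "0 < nrm"
  using nrm_ge n_ge by simp

lemma sq4_bounds: "nrm \<le> sq4" "sq4 \<le> 2 * nrm"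
proof -
  have "0 \<le> (int n - 2) * cmin\<^sup>2" using n_ge by simp
  then show "nrm \<le> sq4" by (simp add: sq4_def)
  have "(int n - 2) * cmin\<^sup>2 \<le> int n * cmin\<^sup>2" by (intro mult_right_mono) auto
  then show "sq4 \<le> 2 * nrm" using n_cmin_sq_le by (simp add: sq4_def)
qed

lemma W_ge: "2 \<le> W"
proof -
  have "0 < sqrt (real_of_int sq4) / 2" using sq4_bounds nrm_pos by simp
  then show ?thesis by (simp add: W_def)
qed

lemma covering_bound_eq: "c h = cmin \<Longrightarrow> covering_bound n c h = sqrt (real_of_int sq4) / 2"
  by (simp add: covering_bound_def norm2_sq sq4_def)

section \<open>Geometry of a single level\<close>

abbreviation proj :: "int \<Rightarrow> nat \<Rightarrow> real" where
  "proj V i \<equiv> real_of_int V * c i / nrm"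

text \<open>Pythagoras: \<open>proj V\<close> is the foot of the perpendicular from the origin to
  the hyperplane of level \<open>V\<close>. Within a level, shorter means closer to
  \<open>proj V\<close>.\<close>

lemma sum_sq_split:
  assumes "objective n c x = V"
  shows "real_of_int (\<Sum>i=1..n. (x i)\<^sup>2) = (real_of_int V)\<^sup>2 / nrm + (\<Sum>i=1..n. (x i - proj V i)\<^sup>2)"
proof -
  have "(\<Sum>i=1..n. (x i - proj V i)\<^sup>2) =
      (\<Sum>i=1..n. real_of_int ((x i)\<^sup>2) - 2 * V / nrm * (c i * x i) + (V / nrm)\<^sup>2 * (c i)\<^sup>2)"
    by (rule sum.cong) (use nrm_pos in \<open>simp_all add: power2_eq_square field_simps\<close>)
  also have "\<dots> = real_of_int (\<Sum>i=1..n. (x i)\<^sup>2) - 2 * V / nrm * real_of_int (objective n c x)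
      + (V / nrm)\<^sup>2 * real_of_int nrm"
    by (simp add: sum.distrib sum_subtractf sum_distrib_left objective_def nrm_def)
  also have "\<dots> = real_of_int (\<Sum>i=1..n. (x i)\<^sup>2) - (real_of_int V)\<^sup>2 / nrm"
    using nrm_pos assms by (simp add: power2_eq_square field_simps)
  finally show ?thesis by simp
qed

text \<open>Cauchy-Schwarz; the distance term of \<open>sum_sq_split\<close> is the defect that is
  dropped.\<close>

lemma objective_sq_le:
  assumes "objective n c x = V"
  shows "V\<^sup>2 \<le> nrm * (\<Sum>i=1..n. (x i)\<^sup>2)"
proof -
  have "(real_of_int V)\<^sup>2 / nrm \<le> real_of_int (\<Sum>i=1..n. (x i)\<^sup>2)"
    unfolding sum_sq_split[OF assms] by (simp add: sum_nonneg)
  then have "(real_of_int V)\<^sup>2 \<le> real_of_int (nrm * (\<Sum>i=1..n. (x i)\<^sup>2))"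
    using nrm_pos by (simp add: field_simps)
  then show ?thesis by (simp only: of_int_power[symmetric] of_int_le_iff)
qed

text \<open>
  The vectors \<open>cmin * e\<^sub>i - c i * e\<^sub>h\<close> lie in the hyperplane orthogonal to \<open>c\<close>; the coordinates of
  the displacement with respect to them are rounded.
\<close>

lemma covering:
  assumes "objective n c x0 = V"
  obtains x :: "nat \<Rightarrow> int" where "objective n c x = V" "(\<Sum>i=1..n. (x i - proj V i)\<^sup>2) \<le> real_of_int sq4 / 4"
proof -
  obtain h where h: "h \<in> {1..n}" "c h = cmin" by (rule cmin_attained)
  define S where "S = {1..n} - {h}"
  have S: "finite S" "h \<notin> S" "insert h S = {1..n}" using h by (auto simp: S_def)
  have split: "(\<Sum>i=1..n. g i) = g h + (\<Sum>i\<in>S. g i)" for g :: "nat \<Rightarrow> 'a::comm_monoid_add"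
    using sum.insert[OF S(1,2), of g] by (simp add: S(3))
  define u where "u i = x0 i - proj V i" for i
  have "(\<Sum>i=1..n. c i * u i) = (\<Sum>i=1..n. real_of_int (c i * x0 i) - V / nrm * real_of_int ((c i)\<^sup>2))"
    by (rule sum.cong) (simp_all add: u_def power2_eq_square algebra_simps)
  also have "\<dots> = real_of_int (objective n c x0) - V / nrm * real_of_int nrm"
    unfolding sum_subtractf sum_distrib_left[symmetric] of_int_sum[symmetric] objective_def nrm_def ..
  also have "\<dots> = 0" using assms nrm_pos by simp
  finally have u0: "cmin * u h + (\<Sum>i\<in>S. c i * u i) = 0" by (simp only: split h)
  \<comment> \<open>Coordinates of the displacement \<open>u\<close>: entry \<open>i\<close> in
    \<open>S\<close> of the combination of the vectors is \<open>cmin * t i\<close>, and entry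
    \<open>h\<close> is then forced by orthogonality to \<open>c\<close>.\<close>
  define t where "t i = u i / cmin" for i
  have ut: "u i = cmin * t i" for i using cmin_pos by (simp add: t_def)
  obtain k :: "nat \<Rightarrow> int" where k: "(\<Sum>i\<in>S. (real_of_int cmin)\<^sup>2 * (t i - k i)\<^sup>2) +
      (\<Sum>i\<in>S. real_of_int (c i) * (t i - k i))\<^sup>2 \<le> (\<Sum>i\<in>S. (real_of_int cmin)\<^sup>2 + (real_of_int (c i))\<^sup>2) / 4"
    using exists_rounding[OF S(1), of "real_of_int cmin" t "\<lambda>i. real_of_int (c i)"] by blast
  \<comment> \<open>Subtracts \<open>k i\<close> times the vector of each \<open>i\<close> in
    \<open>S\<close>; entry \<open>h\<close> collects the opposite contributions, which keeps the
    objective value.\<close>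
  define x where "x i = (if i = h then x0 h + (\<Sum>j\<in>S. c j * k j) else x0 i - k i * cmin)" for i
  have xS: "(\<Sum>i\<in>S. g i (x i)) = (\<Sum>i\<in>S. g i (x0 i - k i * cmin))" for g :: "nat \<Rightarrow> int \<Rightarrow> 'a::comm_monoid_add"
    by (rule sum.cong) (use S in \<open>auto simp: x_def\<close>)
  have "objective n c x = cmin * (x0 h + (\<Sum>j\<in>S. c j * k j)) + (\<Sum>i\<in>S. c i * (x0 i - k i * cmin))"
    unfolding objective_def split xS[of "\<lambda>i v. c i * v"] h by (simp add: x_def)
  also have "\<dots> = cmin * x0 h + (\<Sum>i\<in>S. c i * x0 i)"
    by (simp add: algebra_simps sum_subtractf sum_distrib_left)
  also have "\<dots> = V" using assms unfolding objective_def split h .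
  finally have obj: "objective n c x = V" .
  have "real_of_int cmin * (u h + (\<Sum>j\<in>S. real_of_int (c j * k j))) =
      - (\<Sum>i\<in>S. c i * u i) + cmin * (\<Sum>j\<in>S. real_of_int (c j * k j))"
    using u0 by (simp add: distrib_left)
  also have "\<dots> = real_of_int cmin * - (\<Sum>i\<in>S. real_of_int (c i) * (t i - k i))"
    by (simp add: ut sum_distrib_left sum_subtractf algebra_simps)
  finally have hcoord: "u h + (\<Sum>j\<in>S. real_of_int (c j * k j)) = - (\<Sum>i\<in>S. real_of_int (c i) * (t i - k i))"
    using cmin_pos by (subst (asm) mult_left_cancel) auto
  have "(\<Sum>i=1..n. (x i - proj V i)\<^sup>2) =
      (u h + (\<Sum>j\<in>S. real_of_int (c j * k j)))\<^sup>2 + (\<Sum>i\<in>S. (x0 i - k i * cmin - proj V i)\<^sup>2)"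
    unfolding split xS[of "\<lambda>i v. (v - proj V i)\<^sup>2"] by (simp add: x_def u_def algebra_simps)
  also have "(\<Sum>i\<in>S. (x0 i - k i * cmin - proj V i)\<^sup>2) = (\<Sum>i\<in>S. (real_of_int cmin)\<^sup>2 * (t i - k i)\<^sup>2)"
  proof (rule sum.cong)
    fix i
    have "x0 i - k i * cmin - proj V i = cmin * (t i - k i)"
      using ut[of i] by (simp add: u_def algebra_simps)
    then show "(x0 i - k i * cmin - proj V i)\<^sup>2 = (real_of_int cmin)\<^sup>2 * (t i - k i)\<^sup>2"
      by (simp only: power_mult_distrib)
  qed simp
  also have "(u h + (\<Sum>j\<in>S. real_of_int (c j * k j)))\<^sup>2 + \<dots> \<le> (\<Sum>i\<in>S. (real_of_int cmin)\<^sup>2 + (real_of_int (c i))\<^sup>2) / 4"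
    using k unfolding hcoord by simp
  also have "(\<Sum>i\<in>S. (real_of_int cmin)\<^sup>2 + (real_of_int (c i))\<^sup>2) = real_of_int sq4"
  proof -
    \<comment> \<open>The \<open>n - 1\<close> summands \<open>cmin^2\<close> lose one to complete
      \<open>nrm\<close>, which has an entry for \<open>h\<close> too: this is the origin of
      \<open>n - 2\<close> in the covering bound.\<close>
    have "card S = n - 1" using h by (simp add: S_def)
    moreover have "nrm = cmin\<^sup>2 + (\<Sum>i\<in>S. (c i)\<^sup>2)" unfolding nrm_def split h ..
    ultimately show ?thesis
      using n_ge by (simp add: sq4_def sum.distrib of_nat_diff algebra_simps)
  qed
  finally show ?thesis using that[OF obj] by blast
qed

text \<open>\<open>W - 1\<close> covers the distance from the projection to \<open>x\<close>; the
  additional 1 pays for rounding the projection to the centre, at most 1/2 per coordinate.\<close>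

lemma window:
  fixes x :: "nat \<Rightarrow> int"
  assumes "(\<Sum>i=1..n. (x i - proj V i)\<^sup>2) \<le> real_of_int sq4 / 4" and i: "i \<in> {1..n}"
  shows "\<bar>x i - centre n c V i\<bar> \<le> W"
proof -
  have "(x i - proj V i)\<^sup>2 \<le> (\<Sum>i=1..n. (x i - proj V i)\<^sup>2)"
    by (rule member_le_sum[OF i, of "\<lambda>i. (x i - proj V i)\<^sup>2"]) auto
  also have "\<dots> \<le> (sqrt (real_of_int sq4) / 2)\<^sup>2"
    using assms(1) sq4_bounds nrm_pos by (simp add: power_divide)
  finally have "\<bar>x i - proj V i\<bar> \<le> sqrt (real_of_int sq4) / 2"
    by (rule power2_le_imp_le[of "\<bar>x i - proj V i\<bar>", simplified power2_abs])
      (use sq4_bounds nrm_pos in simp)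
  moreover have "\<bar>real_of_int (centre n c V i) - proj V i\<bar> \<le> 1 / 2"
    unfolding centre_eq by (rule of_int_round_abs_le)
  moreover have "sqrt (real_of_int sq4) / 2 \<le> real_of_int (W - 1)"
    unfolding W_def by simp
  ultimately have "\<bar>real_of_int (x i - centre n c V i)\<bar> \<le> real_of_int W"
    unfolding abs_le_iff of_int_diff by (intro conjI; linarith)
  then show ?thesis by linarith
qed

text \<open>If the given point is within the covering radius, it already lies in the window.
  Otherwise the covering point of the same level is closer to the projection, hence shorter and
  still feasible.\<close>

lemma accepts_if_feasible:
  assumes x0: "objective n c x0 = V" and feas: "feasible n R x0"
  shows "accepts n c R W V"
proof -
  let ?d = "\<lambda>x. \<Sum>i=1..n. (real_of_int (x i) - proj V i)\<^sup>2"
  obtain x where x: "objective n c x = V" "?d x \<le> real_of_int sq4 / 4" "feasible n R x"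
  proof (cases "?d x0 \<le> real_of_int sq4 / 4")
    case True
    then show ?thesis using that x0 feas by blast
  next
    case False
    obtain x where x: "objective n c x = V" "?d x \<le> real_of_int sq4 / 4" by (rule covering[OF x0])
    have "real_of_int (\<Sum>i=1..n. (x i)\<^sup>2) \<le> real_of_int (\<Sum>i=1..n. (x0 i)\<^sup>2)"
      unfolding sum_sq_split[OF x(1)] sum_sq_split[OF x0] using x(2) False by simp
    then have "feasible n R x" using feas unfolding feasible_iff of_int_le_iff by linarith
    then show ?thesis using that x by blast
  qed
  define s where "s = centre n c V"
  define y where "y i = x i - s i" for i
  have "dp_f c s W n (residual n c V) \<le> enat (nat (\<Sum>i=1..n. (s i + y i)\<^sup>2))"
  proof (rule dp_f_le)
    show "- W \<le> y j \<and> y j \<le> W" if "j \<in> {1..n}" for j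
      using window[OF x(2) that] by (auto simp: y_def s_def)
    show "(\<Sum>i=1..n. c i * y i) = residual n c V"
      using x(1) by (simp add: y_def residual_def objective_def s_def right_diff_distrib sum_subtractf)
  qed
  also have "\<dots> \<le> enat (nat R)"
    using x(3) by (simp add: y_def feasible_iff)
  finally show ?thesis by (simp add: accepts_def s_def)
qed

section \<open>The range of levels and the optimal level\<close>

lemma feasible_objective_le: "feasible n R x \<Longrightarrow> objective n c x \<le> hiV"
proof -
  assume "feasible n R x"
  then have "(\<Sum>i=1..n. (x i)\<^sup>2) \<le> R" by (simp add: feasible_iff)
  then have "nrm * (\<Sum>i=1..n. (x i)\<^sup>2) \<le> nrm * R" using nrm_pos by (intro mult_left_mono) auto
  then have "(objective n c x)\<^sup>2 \<le> R * nrm" using objective_sq_le[of x] by (simp add: mult.commute)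
  then have "(real_of_int (objective n c x))\<^sup>2 \<le> real_of_int (R * nrm)"
    by (simp only: of_int_power[symmetric] of_int_le_iff)
  then have "real_of_int (objective n c x) \<le> sqrt (real_of_int (R * nrm))" by (rule real_le_rsqrt)
  then show ?thesis by (simp add: hiV_def le_floor_iff)
qed

lemma exists_feasible_level: obtains x where "feasible n R x" "loV \<le> objective n c x"
proof -
  define a where "a i = sqrt (real_of_int R) * c i / sqrt (real_of_int nrm)" for i
  define x where "x i = \<lfloor>a i\<rfloor>" for i
  have a_nonneg: "0 \<le> a i" if "i \<in> {1..n}" for i
    using R_pos nrm_pos c_pos[OF that] by (simp add: a_def)
  \<comment> \<open>Rounding down shrinks squares only for nonnegative entries; the positivity of
    \<open>c\<close> provides these.\<close>
  have "real_of_int (\<Sum>i=1..n. (x i)\<^sup>2) \<le> (\<Sum>i=1..n. (a i)\<^sup>2)"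
    unfolding of_int_sum of_int_power
    by (intro sum_mono power_mono) (use a_nonneg in \<open>auto simp: x_def\<close>)
  also have "\<dots> = R / nrm * real_of_int nrm"
  proof -
    have "(\<Sum>i=1..n. (a i)\<^sup>2) = (\<Sum>i=1..n. R / nrm * real_of_int ((c i)\<^sup>2))"
      by (rule sum.cong) (use R_pos nrm_pos in \<open>simp_all add: a_def power_mult_distrib power_divide\<close>)
    then show ?thesis
      unfolding sum_distrib_left[symmetric] of_int_sum[symmetric] nrm_def .
  qed
  also have "\<dots> = R" using nrm_pos by simp
  finally have feas: "feasible n R x" by (simp only: feasible_iff of_int_le_iff)
  have "sqrt (real_of_int (R * nrm)) - l1 = (\<Sum>i=1..n. c i * (a i - 1))"
  proof -
    have "(\<Sum>i=1..n. c i * a i) = (\<Sum>i=1..n. sqrt (real_of_int R) / sqrt (real_of_int nrm) * real_of_int ((c i)\<^sup>2))"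
      by (rule sum.cong) (simp_all add: a_def power2_eq_square)
    also have "\<dots> = sqrt (real_of_int R) / sqrt (real_of_int nrm) * real_of_int nrm"
      unfolding sum_distrib_left[symmetric] of_int_sum[symmetric] nrm_def ..
    also have "\<dots> = sqrt (real_of_int R) * sqrt (real_of_int nrm)"
      using nrm_pos by (simp add: field_simps)
    finally show ?thesis
      by (simp add: right_diff_distrib sum_subtractf l1_def real_sqrt_mult)
  qed
  also have "\<dots> \<le> (\<Sum>i=1..n. real_of_int (c i * x i))"
  proof (rule sum_mono)
    fix i assume i: "i \<in> {1..n}"
    have "a i - 1 \<le> real_of_int (x i)" unfolding x_def by linarith
    then show "c i * (a i - 1) \<le> real_of_int (c i * x i)"
      using c_pos[OF i] by (simp add: mult_left_mono)
  qed
  also have "\<dots> = real_of_int (objective n c x)" by (simp add: objective_def)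
  finally have "\<lceil>sqrt (real_of_int (R * nrm))\<rceil> - l1 \<le> objective n c x"
    by (simp add: ceiling_le_iff algebra_simps flip: ceiling_diff_of_int)
  \<comment> \<open>For the part \<open>max 0\<close> of \<open>loV\<close>.\<close>
  moreover have "0 \<le> objective n c x"
    unfolding objective_def using c_pos a_nonneg
    by (intro sum_nonneg mult_nonneg_nonneg) (auto simp: x_def intro: less_imp_le)
  ultimately show ?thesis using that feas by (simp add: loV_def)
qed

text \<open>Defined by acceptance, which is what the program can test. That no feasible point does
  better follows from \<open>accepts_if_feasible\<close>; that the value is reached, from
  \<open>backtracked_optimal\<close>.\<close>

definition optV :: int where "optV = Max {V \<in> {loV..hiV}. accepts n c R W V}"

lemma optV: "optV \<in> {loV..hiV}" "accepts n c R W optV"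
  "\<And>V. \<lbrakk>V \<le> hiV; accepts n c R W V; loV \<le> V\<rbrakk> \<Longrightarrow> V \<le> optV"
proof -
  let ?A = "{V \<in> {loV..hiV}. accepts n c R W V}"
  have fin: "finite ?A" by (rule finite_subset[of _ "{loV..hiV}"]) auto
  obtain x where x: "feasible n R x" "loV \<le> objective n c x" by (rule exists_feasible_level)
  then have "objective n c x \<in> ?A"
    using accepts_if_feasible[of x] feasible_objective_le[of x] by auto
  then have "optV \<in> ?A" unfolding optV_def by (intro Max_in fin) auto
  then show "optV \<in> {loV..hiV}" "accepts n c R W optV" by auto
  show "V \<le> optV" if "V \<le> hiV" "accepts n c R W V" "loV \<le> V" for V
    unfolding optV_def by (rule Max_ge[OF fin]) (use that in auto)
qed

lemma loV_nonneg: "0 \<le> loV"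
  by (simp add: loV_def)

lemma scanned_eq: "scanned n c R W = {optV..hiV}"
  unfolding scanned_def levels_eq using optV loV_nonneg by force

lemma feasible_objective_le_optV: "feasible n R x \<Longrightarrow> objective n c x \<le> optV"
  using optV(3)[of "objective n c x"] optV(1) accepts_if_feasible[of x] feasible_objective_le[of x]
  by (cases "loV \<le> objective n c x") auto

text \<open>Holds for every trace, whichever minimizers it follows: acceptance makes the last value
  finite and at most \<open>R\<close>, and \<open>backtracked_value\<close> identifies it with the
  squared norm of the traced point.\<close>

lemma backtracked_optimal:
  assumes "backtracked n c W optV x"
  shows "dp_returns n c R W optV x \<and> is_arg_max (objective n c) (feasible n R) x \<and> optV = objective n c x"
proof -
  define s where "s = centre n c optV"
  from assms obtain p y where py: "p n = residual n c optV"
    "\<And>i. i \<in> {1..n} \<Longrightarrow> p (i - 1) = p i - c i * y i \<and>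
       dp_f c s W i (p i) = dp_f c s W (i - 1) (p (i - 1)) + enat (nat ((s i + y i)\<^sup>2)) \<and>
       x i = s i + y i"
    unfolding backtracked_def Let_def s_def by blast
  have acc: "dp_f c s W n (p n) \<le> enat (nat R)"
    using optV(2) by (simp add: accepts_def s_def py(1))
  then have "dp_f c s W n (p n) \<noteq> \<infinity>" by (cases "dp_f c s W n (p n)") auto
  then have *: "p n = (\<Sum>i=1..n. c i * y i)"
    "dp_f c s W n (p n) = enat (nat (\<Sum>i=1..n. (s i + y i)\<^sup>2))"
    using backtracked_value[of n p c y s W] py(2) by auto
  have sq: "(\<Sum>i=1..n. (s i + y i)\<^sup>2) = (\<Sum>i=1..n. (x i)\<^sup>2)"
    by (rule sum.cong) (use py(2) in auto)
  have feas: "feasible n R x"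
    using acc R_pos unfolding *(2) sq feasible_iff by simp
  have "objective n c x = (\<Sum>i=1..n. c i * s i) + (\<Sum>i=1..n. c i * y i)"
    unfolding objective_def sum.distrib[symmetric]
    by (rule sum.cong) (use py(2) in \<open>auto simp: distrib_left\<close>)
  then have obj: "objective n c x = optV"
    using py(1) *(1) by (simp add: residual_def s_def)
  have "is_arg_max (objective n c) (feasible n R) x"
    using feas feasible_objective_le_optV obj by (auto simp: is_arg_max_def not_less)
  moreover have "dp_returns n c R W optV x"
    using optV assms by (simp add: dp_returns_def scanned_eq)
  ultimately show ?thesis using obj by simp
qed

text \<open>The final state \<open>(n, residual)\<close> thus lies in the table. The residual is the
  sum of the rounding errors of the centre weighted by \<open>c\<close>, and so is already within
  \<open>l1\<close>.\<close>

lemma residual_le: "\<bar>residual n c V\<bar> \<le> W * l1"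
proof -
  have "(\<Sum>i=1..n. c i * proj V i) = (\<Sum>i=1..n. V / nrm * real_of_int ((c i)\<^sup>2))"
    by (rule sum.cong) (simp_all add: power2_eq_square)
  also have "\<dots> = V / nrm * real_of_int nrm"
    unfolding sum_distrib_left[symmetric] of_int_sum[symmetric] nrm_def ..
  finally have "V = (\<Sum>i=1..n. c i * proj V i)"
    using nrm_pos by simp
  then have "real_of_int (residual n c V) = (\<Sum>i=1..n. c i * (proj V i - centre n c V i))"
    by (simp add: residual_def right_diff_distrib sum_subtractf)
  also have "\<bar>\<dots>\<bar> \<le> (\<Sum>i=1..n. \<bar>c i * (proj V i - centre n c V i)\<bar>)" by (rule sum_abs)
  also have "\<dots> \<le> (\<Sum>i=1..n. real_of_int (c i) * 1)"
  proof (rule sum_mono)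
    fix i assume "i \<in> {1..n}"
    then have "0 < c i" by (rule c_pos)
    moreover have "\<bar>proj V i - centre n c V i\<bar> \<le> 1"
      using of_int_round_abs_le[of "proj V i"] unfolding centre_eq by linarith
    ultimately show "\<bar>c i * (proj V i - centre n c V i)\<bar> \<le> real_of_int (c i) * 1"
      unfolding abs_mult by (intro mult_mono) auto
  qed
  finally have "real_of_int \<bar>residual n c V\<bar> \<le> real_of_int l1" by (simp add: l1_def)
  then have "\<bar>residual n c V\<bar> \<le> l1" by (simp only: of_int_le_iff)
  also have "1 * l1 \<le> W * l1" using W_ge n_le_l1 by (intro mult_right_mono) auto
  finally show ?thesis by simp
qed

end

section \<open>The program before the main loop\<close>

text \<open>Prefix sums with an integer bound, as loop counters are integers; on entry with counter
  \<open>j\<close> an accumulator holds the sum up to \<open>j - 1\<close>.\<close>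

definition psum :: "(nat \<Rightarrow> int) \<Rightarrow> int \<Rightarrow> int" where
  "psum g j = (\<Sum>i=1..nat j. g i)"

lemma psum_0 [simp]: "psum g 0 = 0"
  by (simp add: psum_def)

lemma psum_int [simp]: "psum g (int k) = (\<Sum>i=1..k. g i)"
  by (simp add: psum_def)

lemma psum_step: "1 \<le> j \<Longrightarrow> psum g j = psum g (j - 1) + g (nat j)"
proof -
  assume "1 \<le> j"
  then have "nat j = Suc (nat (j - 1))" by simp
  then show ?thesis by (simp add: psum_def)
qed

lemma psum_bounds:
  assumes "\<And>i. i \<in> {1..n} \<Longrightarrow> 0 \<le> g i" and "j \<le> int n"
  shows "0 \<le> psum g j" "psum g j \<le> (\<Sum>i=1..n. g i)"
  unfolding psum_def using assms by (auto intro!: sum_nonneg sum_mono2)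

text \<open>The ceiling exceeds the floor exactly when the radicand is no perfect square, which the
  program tests by \<open>a * a < s\<close>.\<close>

lemma floor_sqrt_eq:
  assumes "0 \<le> a" "a * a \<le> s" "s < (a + 1) * (a + 1)"
  shows "\<lfloor>sqrt (real_of_int s)\<rfloor> = a"
    and "\<lceil>sqrt (real_of_int s)\<rceil> = (if a * a < s then a + 1 else a)"
proof -
  have lo: "real_of_int a \<le> sqrt (real_of_int s)"
  proof (rule real_le_rsqrt)
    have "real_of_int (a * a) \<le> real_of_int s" using assms(2) by (simp only: of_int_le_iff)
    then show "(real_of_int a)\<^sup>2 \<le> real_of_int s" by (simp add: power2_eq_square)
  qed
  have hi: "sqrt (real_of_int s) < real_of_int (a + 1)"
  proof (rule real_less_lsqrt)
    have "real_of_int s < real_of_int ((a + 1) * (a + 1))" using assms(3) by (simp only: of_int_less_iff)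
    then show "real_of_int s < (real_of_int (a + 1))\<^sup>2" by (simp add: power2_eq_square)
  qed (use assms in auto)
  show "\<lfloor>sqrt (real_of_int s)\<rfloor> = a" using lo hi by (intro floor_unique) auto
  show "\<lceil>sqrt (real_of_int s)\<rceil> = (if a * a < s then a + 1 else a)"
  proof (cases "a * a < s")
    case True
    have "real_of_int a < sqrt (real_of_int s)"
    proof (rule real_less_rsqrt)
      have "real_of_int (a * a) < real_of_int s" using True by (simp only: of_int_less_iff)
      then show "(real_of_int a)\<^sup>2 < real_of_int s" by (simp add: power2_eq_square)
    qed
    then show ?thesis using True hi by (intro ceiling_unique) auto
  next
    case False
    then have "s = a * a" using assms by simp
    then show ?thesis using assms by simp
  qed
qed

section \<open>Magnitudes of the stored numbers as powers of \<open>G\<close>\<close>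

context dp_instance
begin

definition M :: int where "M = W * l1"

text \<open>All numbers stored by the program are at most \<open>Z\<close>; the exponent is chosen generously.\<close>

definition G :: int where "G = int n + l1 + nrm + R"
definition Z :: int where "Z = G ^ 10"

lemma G_ge: "int n \<le> G" "l1 \<le> G" "nrm \<le> G" "R \<le> G" "7 \<le> G" "l1 + 1 \<le> G" "nrm + 1 \<le> G" "R + 1 \<le> G" "int n + 1 \<le> G"
  using n_ge n_le_l1 nrm_ge R_pos by (auto simp: G_def)

lemma G_power_mono: "i \<le> j \<Longrightarrow> G ^ i \<le> G ^ j"
  using G_ge by (intro power_increasing) auto

lemma G_power_le_Z: "i \<le> 10 \<Longrightarrow> G ^ i \<le> Z"
  unfolding Z_def by (rule G_power_mono)

lemma le_Z: "a \<le> G ^ i \<Longrightarrow> i \<le> 10 \<Longrightarrow> a \<le> Z"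
  using G_power_le_Z order_trans by blast

lemma G_le_Z: "G \<le> Z"
  using G_power_le_Z[of 1] by simp

lemma G_mult: "\<lbrakk>0 \<le> a; a \<le> G ^ i; 0 \<le> b; b \<le> G ^ j\<rbrakk> \<Longrightarrow> a * b \<le> G ^ (i + j)"
  unfolding power_add by (intro mult_mono) auto

text \<open>A sum costs one exponent because \<open>2 <= G\<close>, as a product costs the sum of
  exponents in \<open>G_mult\<close>. Magnitudes are then compared by exponents alone.\<close>

lemma G_add: "\<lbrakk>a \<le> G ^ i; b \<le> G ^ i; Suc i = j\<rbrakk> \<Longrightarrow> a + b \<le> G ^ j"
proof -
  assume *: "a \<le> G ^ i" "b \<le> G ^ i" "Suc i = j"
  have "2 * G ^ i \<le> G * G ^ i" using G_ge by (intro mult_right_mono) auto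
  then show ?thesis using * by auto
qed

lemma c_bounds:
  assumes "i \<in> {1..n}"
  shows "1 \<le> c i" "c i \<le> G"
  using c_pos[OF assms] c_le_l1[OF assms] G_ge by auto

lemma W_le_G: "W + 1 \<le> G"
proof -
  have "sqrt (real_of_int sq4) \<le> 2 * real_of_int nrm"
  proof (rule real_le_lsqrt)
    have "sq4 \<le> 2 * nrm * 1" using sq4_bounds by simp
    also have "\<dots> \<le> 2 * nrm * (2 * nrm)" using nrm_pos by (intro mult_left_mono) auto
    finally have "real_of_int sq4 \<le> real_of_int (2 * nrm * (2 * nrm))" by (simp only: of_int_le_iff)
    then show "real_of_int sq4 \<le> (2 * real_of_int nrm)\<^sup>2" by (simp add: power2_eq_square)
  qed (use nrm_pos in simp)
  then have "\<lceil>sqrt (real_of_int sq4) / 2\<rceil> \<le> nrm" by (simp add: ceiling_le_iff)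
  then show ?thesis using n_ge n_le_l1 R_pos by (simp add: W_def G_def)
qed

lemma M_bounds: "l1 \<le> M" "M \<le> G ^ 2"
proof -
  have "1 * l1 \<le> W * l1" using W_ge n_le_l1 by (intro mult_right_mono) auto
  then show "l1 \<le> M" by (simp add: M_def)
  have "W * l1 \<le> G ^ (1 + 1)" using W_ge W_le_G G_ge n_le_l1 by (intro G_mult) auto
  then show "M \<le> G ^ 2" by (simp add: M_def power2_eq_square)
qed

lemma M_pos: "0 < M"
  using M_bounds n_le_l1 n_ge by simp

lemma R_nrm_le: "0 < R * nrm" "R * nrm + 1 \<le> G ^ 3"
proof -
  show "0 < R * nrm" using R_pos nrm_pos by simp
  have "R * nrm \<le> G ^ (1 + 1)" using R_pos nrm_pos G_ge by (intro G_mult) auto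
  then have "R * nrm \<le> G ^ 2" by (simp add: power2_eq_square)
  moreover have "1 \<le> G ^ 2" using G_ge by (intro one_le_power) auto
  ultimately show "R * nrm + 1 \<le> G ^ 3" by (intro G_add) auto
qed

lemma hiV_le: "hiV \<le> G ^ 2"
proof -
  have "R * nrm \<le> G ^ (1 + 1)" using R_pos nrm_pos G_ge by (intro G_mult) auto
  also have "\<dots> \<le> G ^ 2 * G ^ 2" using G_power_mono[of "1 + 1" 4] by (simp flip: power_add)
  finally have "real_of_int (R * nrm) \<le> real_of_int (G ^ 2 * G ^ 2)" by (simp only: of_int_le_iff)
  then have "real_of_int (R * nrm) \<le> (real_of_int (G ^ 2))\<^sup>2"
    unfolding power2_eq_square[of "real_of_int _"] by simp
  then have "sqrt (real_of_int (R * nrm)) \<le> real_of_int (G ^ 2)" by (rule real_le_lsqrt[rotated]) simp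
  then show ?thesis unfolding hiV_def by linarith
qed

lemma level_le_Z: "V \<le> hiV \<Longrightarrow> V \<le> Z"
  using hiV_le le_Z[of V 2] by simp

lemma hiV_nonneg: "0 \<le> hiV"
  using R_pos nrm_pos by (simp add: hiV_def)

section \<open>Norms, window size, levels and rounded centre as computed by the program\<close>

definition holds_input :: "dp_var store \<Rightarrow> bool" where
  "holds_input \<tau> \<longleftrightarrow> \<tau> vn 0 = int n \<and> \<tau> vR 0 = R \<and> (\<forall>j. 1 \<le> j \<and> j \<le> int n \<longrightarrow> \<tau> vc j = c (nat j))"

lemma holds_input_dp_input: "holds_input (dp_input n c R)"
  by (simp add: holds_input_def dp_input_def)

text \<open>This and the following step counts are left in the shape of the program text;
  \<open>steps_le\<close> evaluates them once, in natural numbers.\<close>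

lemma run_prog_norms:
  assumes inp: "holds_input \<sigma>"
  shows "run Z prog_norms \<sigma> (3 + (2 + nat (int n + 1 - 1) * (5 + 2)))
    (\<lambda>\<tau>. \<tau> vnorm 0 = nrm \<and> \<tau> vl1 0 = l1 \<and> \<tau> vmin 0 = cmin)"
  unfolding prog_norms_def
proof (rule run_Seq[where R = "\<lambda>\<tau>. \<tau> vnorm 0 = 0 \<and> \<tau> vl1 0 = 0 \<and> \<tau> vmin 0 = c 1"], goal_cases init loop)
  case init
  have "\<bar>c 1\<bar> \<le> Z" "0 \<le> Z" using c_bounds[of 1] G_le_Z n_ge by auto
  then show ?case using inp n_ge by (intro run_wp) (auto simp: holds_input_def)
next
  case (loop \<tau>)
  have inp': "\<upsilon> vn 0 = int n" "1 \<le> j \<Longrightarrow> j \<le> int n \<Longrightarrow> \<upsilon> vc j = c (nat j)"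
    if "\<upsilon> vn = \<sigma> vn" "\<upsilon> vc = \<sigma> vc" for \<upsilon> j
    using that inp by (auto simp: holds_input_def)
  let ?sq = "\<lambda>i. (c i)\<^sup>2"
  show ?case
  \<comment> \<open>The minimum is described as an entry of \<open>c\<close> that bounds the visited
    ones. On entry nothing has been visited, so \<open>Min\<close> over the visited entries would
    say nothing.\<close>
  proof (rule run_For[where lo = 1 and hi = "int n" and
        I = "\<lambda>j \<tau>. \<tau> vnorm 0 = psum ?sq (j - 1) \<and> \<tau> vl1 0 = psum c (j - 1) \<and>
          (\<exists>i\<in>{1..n}. \<tau> vmin 0 = c i) \<and> (\<forall>i\<in>{1..nat (j - 1)}. \<tau> vmin 0 \<le> c i)"],
        goal_cases lo le b1 b2 x hi indep init step exit)
    case init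
    then show ?case using loop n_ge by auto
  next
    case (step j \<upsilon>)
    have vals: "\<upsilon> vc j = c (nat j)" by (rule inp') (use step loop in auto)
    have j: "nat j \<in> {1..n}" using step by auto
    have nrm: "psum ?sq (j - 1) + c (nat j) * c (nat j) = psum ?sq j"
      "psum c (j - 1) + c (nat j) = psum c j"
      using step psum_step[of j] by (simp_all add: power2_eq_square)
    have b: "\<bar>psum ?sq j\<bar> \<le> Z" "\<bar>psum c j\<bar> \<le> Z" "\<bar>c (nat j)\<bar> \<le> Z"
    proof -
      have "0 \<le> psum ?sq j" "psum ?sq j \<le> nrm"
        unfolding nrm_def by (rule psum_bounds; use step in simp)+
      moreover have "0 \<le> psum c j" "psum c j \<le> l1"
        unfolding l1_def by (rule psum_bounds; use step c_pos in \<open>simp add: less_imp_le\<close>)+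
      ultimately show "\<bar>psum ?sq j\<bar> \<le> Z" "\<bar>psum c j\<bar> \<le> Z" "\<bar>c (nat j)\<bar> \<le> Z"
        using c_bounds[OF j] G_le_Z G_ge by linarith+
    qed
    have split: "{1..nat j} = insert (nat j) {1..nat (j - 1)}"
      using step by auto
    from step have ex: "\<exists>i\<in>{1..n}. \<upsilon> vmin 0 = c i" "\<exists>i\<in>{1..n}. c (nat j) = c i"
      and le: "\<forall>i\<in>{1..nat (j - 1)}. \<upsilon> vmin 0 \<le> c i" using j by blast+
    have min: "\<forall>i\<in>{1..nat j}. c (nat j) \<le> c i" if "c (nat j) < \<upsilon> vmin 0"
      unfolding split using le that by force
    have min': "\<forall>i\<in>{1..nat j}. \<upsilon> vmin 0 \<le> c i" if "\<not> c (nat j) < \<upsilon> vmin 0"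
      unfolding split using le that by force
    have eqs: "\<upsilon> vi 0 = j" "\<upsilon> vnorm 0 = psum ?sq (j - 1)" "\<upsilon> vl1 0 = psum c (j - 1)"
      using step by auto
    show ?case
    proof (rule run_wp, goal_cases)
      case 1
      show ?case
        using ex min min' b by (simp add: eqs vals nrm)
    qed simp
  next
    case (exit \<upsilon>)
    then have le: "\<forall>i\<in>{1..n}. \<upsilon> vmin 0 \<le> c i" and "\<exists>i\<in>{1..n}. \<upsilon> vmin 0 = c i" by auto
    then have "cmin = \<upsilon> vmin 0" unfolding cmin_def by (intro Min_eqI) auto
    then show ?case using exit by (simp add: nrm_def l1_def)
  qed (use loop inp' G_le_Z G_ge in \<open>auto\<close>)
qed

text \<open>An integer lies below the ceiling \<open>W - 1\<close> iff it lies below the real number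
  itself; squaring turns this into the integer guard of the search loop.\<close>

lemma window_iff: "0 \<le> w \<Longrightarrow> 4 * (w * w) < sq4 \<longleftrightarrow> w < W - 1"
proof -
  assume w: "0 \<le> w"
  have "w < W - 1 \<longleftrightarrow> real_of_int (2 * w) < sqrt (real_of_int sq4)"
    by (simp add: W_def less_ceiling_iff field_simps)
  also have "\<dots> \<longleftrightarrow> sqrt ((real_of_int (2 * w))\<^sup>2) < sqrt (real_of_int sq4)"
    unfolding real_sqrt_abs using w by simp
  also have "\<dots> \<longleftrightarrow> real_of_int (4 * (w * w)) < real_of_int sq4"
    unfolding real_sqrt_less_iff by (simp add: power2_eq_square)
  finally show ?thesis by (simp only: of_int_less_iff)
qed

text \<open>A linear search for \<open>W\<close> is affordable, since the final bound contains
  \<open>W^2\<close> anyway. For the root in \<open>prog_levels\<close> it is not, as that root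
  grows with the radius.\<close>

lemma run_prog_window:
  assumes "holds_input \<sigma>" "\<sigma> vnorm 0 = nrm" "\<sigma> vl1 0 = l1" "\<sigma> vmin 0 = cmin"
  shows "run Z prog_window \<sigma> (2 + (1 + nat (W - 1) * (1 + 1)) + 1 + 1) (\<lambda>\<tau>. \<tau> vW 0 = W \<and> \<tau> vM 0 = M)"
  unfolding prog_window_def
proof (rule run_Seq[where R = "\<lambda>\<tau>. \<tau> vW 0 = W"],
    rule run_Seq[where R = "\<lambda>\<tau>. \<tau> vW 0 = W - 1"],
    rule run_Seq[where R = "\<lambda>\<tau>. \<tau> vW 0 = 0 \<and> \<tau> vsq 0 = sq4"], goal_cases init loop incr prod)
  case init
  have "\<bar>sq4\<bar> \<le> Z" "0 \<le> Z"
    using sq4_bounds nrm_pos G_ge G_le_Z le_Z[OF G_add[of nrm 1 nrm], of 2] by auto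
  then show ?case
    using assms by (intro run_wp) (auto simp: holds_input_def sq4_def power2_eq_square)
next
  case (loop \<tau>)
  show ?case
  proof (rule run_While[where I = "\<lambda>k \<tau>. \<tau> vW 0 = W - 1 - int k \<and> int k \<le> W - 1"],
      goal_cases init stop step exit)
    case init
    then show ?case using loop W_ge by auto
  next
    case (stop \<upsilon>)
    then show ?case using loop window_iff[of "W - 1"] W_ge by (auto simp: mult.assoc)
  next
    case (step k \<upsilon>)
    then show ?case using W_le_G G_le_Z by (intro run_wp) auto
  next
    case (exit k \<upsilon>)
    then show ?case using loop window_iff[of "W - 1 - int k"] by (auto simp: mult.assoc)
  qed
next
  case (incr \<tau>)
  then show ?case using W_ge W_le_G G_le_Z by (intro run_wp) auto
next
  case (prod \<tau>)
  then show ?case using assms M_bounds M_pos le_Z[of M 2] by (intro run_wp) (auto simp: M_def)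
qed

lemma run_prog_levels:
  assumes "holds_input \<sigma>" "\<sigma> vnorm 0 = nrm" "\<sigma> vl1 0 = l1"
  shows "run Z prog_levels \<sigma> (3 + (1 + bit_len Z * (4 + 1)) + 1 + 1 + 3 + 3)
    (\<lambda>\<tau>. \<tau> vV 0 = hiV \<and> \<tau> vlo 0 = loV)"
  unfolding prog_levels_def
proof (rule run_Seq[where R = "\<lambda>\<tau>. \<tau> vV 0 = hiV \<and> \<tau> vlo 0 = \<lceil>sqrt (real_of_int (R * nrm))\<rceil> - l1"],
    rule run_Seq[where R = "\<lambda>\<tau>. \<tau> vV 0 = hiV \<and> \<tau> va 0 = hiV \<and> \<tau> vlo 0 = hiV - l1 \<and> \<tau> vsq 0 = R * nrm"],
    rule run_Seq[where R = "\<lambda>\<tau>. \<tau> va 0 = hiV \<and> \<tau> vV 0 = hiV \<and> \<tau> vsq 0 = R * nrm"],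
    rule run_Seq[where R = "\<lambda>\<tau>. \<tau> va 0 = hiV \<and> \<tau> vsq 0 = R * nrm"],
    rule run_Seq[where R = "\<lambda>\<tau>. \<tau> vsq 0 = R * nrm \<and> \<tau> va 0 = 0 \<and> \<tau> vb 0 = R * nrm + 1"],
    goal_cases init loop va vlo ceil pos)
  case init
  have "R * nrm + 1 \<le> Z" "0 \<le> R * nrm" using R_nrm_le le_Z by auto
  then show ?case
    using assms by (intro run_wp) (auto simp: holds_input_def)
next
  case (loop \<tau>)
  have Z: "R * nrm + 1 \<le> Z" using R_nrm_le le_Z by auto
  \<comment> \<open>The root stays in the interval from \<open>va\<close> up to, but excluding,
    \<open>vb\<close>, whose width halves. At width 1 the guard fails, and the initial width fits
    into \<open>2 ^ bit_len Z\<close>.\<close>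
  let ?I = "\<lambda>k \<tau>. 0 \<le> \<tau> va 0 \<and> \<tau> va 0 * \<tau> va 0 \<le> R * nrm \<and> R * nrm < \<tau> vb 0 * \<tau> vb 0 \<and>
      \<tau> va 0 < \<tau> vb 0 \<and> \<tau> vb 0 \<le> R * nrm + 1 \<and> \<tau> vb 0 - \<tau> va 0 \<le> 2 ^ k"
  show ?case
  proof (rule run_While[where I = ?I], goal_cases init stop step exit)
    case init
    have "R * nrm + 1 < 2 ^ (bit_len Z - 1)" using abs_less_bit_len[of Z] Z by linarith
    also have "(2::int) ^ (bit_len Z - 1) \<le> 2 ^ bit_len Z" by (intro power_increasing) auto
    finally have "R * nrm + 1 \<le> 2 ^ bit_len Z" by simp
    moreover have "q < (q + 1) * (q + 1)" if "0 < q" for q :: int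
    proof -
      have "0 < q * q" using that by simp
      then show ?thesis using that unfolding distrib_left distrib_right by linarith
    qed
    ultimately show ?case using loop R_nrm_le by simp
  next
    case (stop \<upsilon>)
    then show ?case by simp
  next
    case (step k \<upsilon>)
    define a b where "a = \<upsilon> va 0" and "b = \<upsilon> vb 0"
    have I: "0 \<le> a" "a * a \<le> R * nrm" "R * nrm < b * b" "b \<le> R * nrm + 1" "b - a \<le> 2 * 2 ^ k"
      and ab: "a + 1 < b" and sq: "\<upsilon> vsq 0 = R * nrm"
      using step loop by (auto simp: a_def b_def)
    define m where "m = (a + b) div 2"
    have m: "a < m" "m < b" "m - a \<le> 2 ^ k" "b - m \<le> 2 ^ k" using I ab by (auto simp: m_def)
    show ?case
    proof (rule run_wp, goal_cases)
      case 1
      show ?case using I m Z sq by (simp add: m_def[symmetric] a_def[symmetric] b_def[symmetric])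
    qed simp
  next
    case (exit k \<upsilon>)
    then have "\<upsilon> vb 0 = \<upsilon> va 0 + 1" by auto
    moreover have "\<upsilon> vsq 0 = R * nrm" using exit(3) loop(1) by simp
    ultimately show ?case using exit(1) floor_sqrt_eq(1)[of "\<upsilon> va 0" "R * nrm"] by (simp add: hiV_def)
  qed
next
  case (va \<tau>)
  show ?case using va(1) hiV_nonneg level_le_Z[of hiV] by (intro run_wp) auto
next
  case (vlo \<tau>)
  have "0 \<le> hiV" "hiV \<le> Z" using hiV_nonneg level_le_Z by auto
  moreover have "\<sigma> vl1 0 = \<tau> vl1 0" "0 \<le> l1" "l1 \<le> Z"
    using vlo n_le_l1 G_ge G_le_Z by auto
  ultimately show ?case using vlo(1) assms(3) by (intro run_wp) auto
next
  case (ceil \<tau>)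
  have f: "0 \<le> hiV" "hiV * hiV \<le> R * nrm" "R * nrm < (hiV + 1) * (hiV + 1)"
  proof -
    let ?s = "sqrt (real_of_int (R * nrm))"
    have s: "0 \<le> ?s" "?s * ?s = real_of_int (R * nrm)" using R_pos nrm_pos by (auto simp: abs_mult)
    show hiV: "0 \<le> hiV" by (rule hiV_nonneg)
    have "real_of_int hiV \<le> ?s" "?s < real_of_int (hiV + 1)" unfolding hiV_def by linarith+
    then have "real_of_int hiV * real_of_int hiV \<le> ?s * ?s" "?s * ?s < real_of_int (hiV + 1) * real_of_int (hiV + 1)"
      using hiV s by (intro mult_mono mult_strict_mono; simp)+
    then show "hiV * hiV \<le> R * nrm" "R * nrm < (hiV + 1) * (hiV + 1)"
      unfolding s by (simp_all only: of_int_mult[symmetric] of_int_le_iff of_int_less_iff)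
  qed
  have "hiV + 1 \<le> Z"
  proof (rule le_Z)
    show "hiV + 1 \<le> G ^ 3" using hiV_le one_le_power[of G 2] G_ge by (intro G_add[of hiV 2]) auto
  qed simp
  moreover have "0 \<le> l1" "l1 \<le> Z"
    using n_le_l1 G_ge G_le_Z by auto
  ultimately show ?case
    using ceil(1) f floor_sqrt_eq(2)[OF f] by (intro run_wp) auto
next
  case (pos \<tau>)
  have "0 \<le> Z" using G_ge G_le_Z by linarith
  then show ?case using pos(1) by (intro run_wp) (auto simp: loV_def bounded_storeD)
qed

text \<open>From \<open>c i <= (c i)^2 <= nrm\<close> the projection has entries between 0 and
  \<open>V\<close>, and rounding is monotone and fixes both ends.\<close>

lemma centre_bounds:
  assumes "i \<in> {1..n}" "0 \<le> V"
  shows "0 \<le> centre n c V i" "centre n c V i \<le> V"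
proof -
  have c: "1 \<le> c i" "c i \<le> nrm"
  proof -
    show 1: "1 \<le> c i" using c_pos[OF assms(1)] by simp
    then have "c i * 1 \<le> c i * c i" by (intro mult_left_mono) auto
    then show "c i \<le> nrm" using c_sq_le_nrm[OF assms(1)] by (simp add: power2_eq_square)
  qed
  have "0 \<le> proj V i" using assms c nrm_pos by simp
  then have "round (0::real) \<le> round (proj V i)" by (rule round_mono)
  then show "0 \<le> centre n c V i" by (simp add: centre_eq)
  have "real_of_int V * c i \<le> real_of_int V * nrm" using assms c by (intro mult_left_mono) auto
  then have "proj V i \<le> real_of_int V" using nrm_pos by (simp add: divide_le_eq)
  then have "round (proj V i) \<le> round (real_of_int V)" by (rule round_mono)
  then show "centre n c V i \<le> V" by (simp add: centre_eq)
qed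

lemma centre_div: "centre n c V i = (2 * (V * c i) + nrm) div (2 * nrm)"
proof -
  have "proj V i + 1 / 2 = real_of_int (2 * (V * c i) + nrm) / real_of_int (2 * nrm)"
    using nrm_pos by (simp add: field_simps)
  then show ?thesis by (simp only: centre_eq round_def floor_divide_of_int_eq)
qed

lemma run_prog_centre:
  assumes inp: "holds_input \<sigma>" "\<sigma> vnorm 0 = nrm" and V: "\<sigma> vV 0 = V" "0 \<le> V" "V \<le> hiV"
  shows "run Z prog_centre \<sigma> (1 + (2 + nat (int n + 1 - 1) * (2 + 2)))
    (\<lambda>\<tau>. (\<forall>j. 1 \<le> j \<and> j \<le> int n \<longrightarrow> \<tau> vs j = centre n c V (nat j)) \<and> \<tau> vrho 0 = residual n c V)"
  unfolding prog_centre_def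
proof (rule run_Seq[where R = "\<lambda>\<tau>. \<tau> vrho 0 = V"], goal_cases init loop)
  case init
  show ?case by (rule run_wp) (use V level_le_Z in auto)
next
  case (loop \<tau>)
  let ?g = "\<lambda>i. c i * centre n c V i"
  have inp': "\<upsilon> vn 0 = int n" "1 \<le> j \<Longrightarrow> j \<le> int n \<Longrightarrow> \<upsilon> vc j = c (nat j)"
    if "\<upsilon> vn = \<sigma> vn" "\<upsilon> vc = \<sigma> vc" for \<upsilon> j
    using that inp by (auto simp: holds_input_def)
  show ?case
  proof (rule run_For[where lo = 1 and hi = "int n" and
        I = "\<lambda>j \<tau>. (\<forall>i. 1 \<le> i \<and> i < j \<longrightarrow> \<tau> vs i = centre n c V (nat i)) \<and> \<tau> vrho 0 = V - psum ?g (j - 1)"],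
        goal_cases lo le b1 b2 x hi indep init step exit)
    case init
    then show ?case using loop by auto
  next
    case (step j \<upsilon>)
    have j: "nat j \<in> {1..n}" using step by auto
    have vals: "\<upsilon> vc j = c (nat j)" "\<upsilon> vnorm 0 = nrm" "\<upsilon> vV 0 = V" "\<upsilon> vi 0 = j"
      "\<upsilon> vrho 0 = V - psum ?g (j - 1)"
      using inp'(2)[of \<upsilon> j] step loop inp V by auto
    have eq: "V - psum ?g (j - 1) - c (nat j) * centre n c V (nat j) = V - psum ?g j"
      using step psum_step[of j ?g] by simp
    have g: "0 \<le> ?g i" "?g i \<le> c i * V" if "i \<in> {1..n}" for i
      using c_bounds[OF that] centre_bounds[OF that V(2)]
      by (auto intro!: mult_nonneg_nonneg mult_left_mono)
    \<comment> \<open>The partial residuals are not small like the final one. They only satisfy the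
      crude bound by \<open>l1 * V\<close>, which suffices for \<open>Z\<close>.\<close>
    have "0 \<le> psum ?g j" "psum ?g j \<le> (\<Sum>i=1..n. ?g i)"
      by (rule psum_bounds; use step g in simp)+
    moreover have "(\<Sum>i=1..n. ?g i) \<le> (\<Sum>i=1..n. c i * V)"
      by (rule sum_mono) (use g in simp)
    moreover have "(\<Sum>i=1..n. c i * V) = l1 * V" by (simp add: l1_def sum_distrib_right)
    moreover have "l1 * V \<le> G ^ (1 + 2)"
      using V hiV_le n_le_l1 G_ge by (intro G_mult) auto
    moreover have "V \<le> Z" using level_le_Z V by blast
    moreover have "G ^ (1 + 2) \<le> Z" by (rule G_power_le_Z) simp
    ultimately have b: "\<bar>V - psum ?g j\<bar> \<le> Z" using V by linarith
    have b': "\<bar>centre n c V (nat j)\<bar> \<le> Z" using centre_bounds[OF j V(2)] \<open>V \<le> Z\<close> by simp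
    show ?case
    proof (rule run_wp, goal_cases)
      case 1
      show ?case using step(1,2,4) b b' by (auto simp: vals eq centre_div[symmetric])
    qed simp
  next
    case (exit \<upsilon>)
    then show ?case by (auto simp: residual_def)
  qed (use loop inp' G_le_Z G_ge in \<open>auto\<close>)
qed

end

section \<open>Table and backtracking\<close>

definition cell_of :: "enat \<Rightarrow> int" where
  "cell_of e = (case e of enat k \<Rightarrow> int k | \<infinity> \<Rightarrow> -1)"

lemma cell_of_simps [simp]: "cell_of (enat k) = int k" "cell_of \<infinity> = -1"
  by (simp_all add: cell_of_def)

text \<open>State of the minimization before \<open>y\<close> is considered. As long as no finite
  value has appeared, \<open>y0\<close> is unconstrained: \<open>vbesty\<close> is not reset and may
  stem from an earlier state.\<close>

definition best_upto :: "int \<Rightarrow> (int \<Rightarrow> enat) \<Rightarrow> int \<Rightarrow> int \<Rightarrow> int \<Rightarrow> bool" where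
  "best_upto W g y b y0 \<longleftrightarrow>
    (if b < 0 then b = -1 \<and> (\<forall>z. - W \<le> z \<and> z < y \<longrightarrow> g z = \<infinity>)
     else - W \<le> y0 \<and> y0 < y \<and> g y0 = enat (nat b) \<and> (\<forall>z. - W \<le> z \<and> z < y \<longrightarrow> enat (nat b) \<le> g z))"

lemma best_upto_init: "best_upto W g (- W) (-1) y0"
  by (auto simp: best_upto_def)

lemma best_upto_skip:
  assumes "best_upto W g y b y0" "g y = \<infinity>"
  shows "best_upto W g (y + 1) b y0"
proof -
  have "z < y + 1 \<longleftrightarrow> z < y \<or> z = y" for z :: int by auto
  then show ?thesis using assms by (auto simp: best_upto_def)
qed

lemma best_upto_keep:
  assumes "best_upto W g y b y0" "g y = enat k" "\<not> (b < 0 \<or> int k < b)"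
  shows "best_upto W g (y + 1) b y0"
proof -
  have "z < y + 1 \<longleftrightarrow> z < y \<or> z = y" for z :: int by auto
  then show ?thesis using assms by (auto simp: best_upto_def)
qed

lemma best_upto_improve:
  assumes "best_upto W g y b y0" "g y = enat k" "b < 0 \<or> int k < b" "- W \<le> y"
  shows "best_upto W g (y + 1) (int k) y"
proof -
  have "enat k \<le> g z" if "- W \<le> z" "z < y + 1" for z
  proof (cases "z = y")
    case True
    then show ?thesis using assms(2) by simp
  next
    case False
    then have z: "- W \<le> z \<and> z < y" using that by simp
    show ?thesis
    proof (cases "b < 0")
      case True
      then have "g z = \<infinity>" using assms(1) z unfolding best_upto_def by presburger
      then show ?thesis by simp
    next
      case False
      then have "enat (nat b) \<le> g z" using assms(1) z unfolding best_upto_def by presburger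
      moreover have "enat k \<le> enat (nat b)" using False assms(3) by simp
      ultimately show ?thesis by (rule order_trans[rotated])
    qed
  qed
  then show ?thesis using assms(2,4) by (simp add: best_upto_def)
qed

lemma best_upto_final:
  assumes "best_upto W g (W + 1) b y0"
  shows "b = cell_of (INF y\<in>{- W..W}. g y)"
    and "(INF y\<in>{- W..W}. g y) \<noteq> \<infinity> \<Longrightarrow> - W \<le> y0 \<and> y0 \<le> W \<and> (INF y\<in>{- W..W}. g y) = g y0"
proof -
  have "b = cell_of (INF y\<in>{- W..W}. g y) \<and>
    ((INF y\<in>{- W..W}. g y) \<noteq> \<infinity> \<longrightarrow> - W \<le> y0 \<and> y0 \<le> W \<and> (INF y\<in>{- W..W}. g y) = g y0)"
  proof (cases "b < 0")
    case True
    then have "\<infinity> \<le> (INF y\<in>{- W..W}. g y)"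
      using assms by (intro INF_greatest) (auto simp: best_upto_def)
    then have "(INF y\<in>{- W..W}. g y) = \<infinity>" by simp
    then show ?thesis using True assms by (simp add: best_upto_def)
  next
    case False
    then have b: "g y0 = enat (nat b)" "- W \<le> y0" "y0 \<le> W"
      "\<And>z. - W \<le> z \<Longrightarrow> z \<le> W \<Longrightarrow> g y0 \<le> g z"
      using assms by (auto simp: best_upto_def)
    have "(INF y\<in>{- W..W}. g y) = g y0"
    proof (rule antisym)
      show "(INF y\<in>{- W..W}. g y) \<le> g y0" by (rule INF_lower) (use b in simp)
      show "g y0 \<le> (INF y\<in>{- W..W}. g y)" by (rule INF_greatest) (use b(4) in simp)
    qed
    then show ?thesis using b False by simp
  qed
  then show "b = cell_of (INF y\<in>{- W..W}. g y)"
    "(INF y\<in>{- W..W}. g y) \<noteq> \<infinity> \<Longrightarrow> - W \<le> y0 \<and> y0 \<le> W \<and> (INF y\<in>{- W..W}. g y) = g y0"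
    by auto
qed

section \<open>Layout, contents and construction of the table\<close>

context dp_instance
begin

definition ad :: "int \<Rightarrow> int \<Rightarrow> int" where
  "ad i p = i * (2 * M + 1) + (p + M)"

lemma aval_addr: "\<tau> vM 0 = M \<Longrightarrow> aval (addr a b) \<tau> = ad (aval a \<tau>) (aval b \<tau>)"
  by (simp add: addr_def ad_def)

text \<open>Division with remainder by \<open>2 * M + 1\<close>: the row is the quotient, and
  \<open>p + M\<close> is a legal remainder.\<close>

lemma ad_inject:
  assumes "- M \<le> p" "p \<le> M" "- M \<le> q" "q \<le> M"
  shows "ad i p = ad j q \<longleftrightarrow> i = j \<and> p = q"
proof
  assume eq: "ad i p = ad j q"
  have "ad i p div (2 * M + 1) = i" "ad j q div (2 * M + 1) = j"
    using assms by (simp_all add: ad_def)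
  then have "i = j" using eq by metis
  then show "i = j \<and> p = q" using eq by (simp add: ad_def)
qed simp

abbreviation F :: "int \<Rightarrow> nat \<Rightarrow> int \<Rightarrow> enat" where
  "F V \<equiv> dp_f c (centre n c V) W"

text \<open>Justifies the range test in the program: a predecessor that falls outside the table can
  be skipped like an infinite entry.\<close>

lemma F_outside:
  assumes "i \<le> n" "\<not> (- M \<le> p \<and> p \<le> M)"
  shows "F V i p = \<infinity>"
proof (rule ccontr)
  assume "F V i p \<noteq> \<infinity>"
  then obtain y where y: "\<And>j. j \<in> {1..i} \<Longrightarrow> - W \<le> y j \<and> y j \<le> W" "(\<Sum>j=1..i. c j * y j) = p"
    by (rule dp_f_attained) blast
  have "\<bar>p\<bar> \<le> (\<Sum>j=1..i. \<bar>c j * y j\<bar>)" unfolding y(2)[symmetric] by (rule sum_abs)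
  also have "\<dots> \<le> (\<Sum>j=1..i. c j * W)"
  proof (rule sum_mono)
    fix j assume j: "j \<in> {1..i}"
    then have "0 < c j" using c_pos assms(1) by simp
    moreover have "\<bar>y j\<bar> \<le> W" using y(1)[OF j] by auto
    ultimately show "\<bar>c j * y j\<bar> \<le> c j * W" unfolding abs_mult by (intro mult_mono) auto
  qed
  also have "\<dots> \<le> (\<Sum>j=1..n. c j * W)"
    using assms(1) c_pos W_ge by (intro sum_mono2) (auto simp: less_imp_le)
  also have "\<dots> = M" by (simp add: M_def l1_def sum_distrib_left mult.commute)
  finally show False using assms(2) by auto
qed

lemma point_sq_le:
  assumes "0 \<le> V" "V \<le> hiV" "j \<in> {1..n}" "- W \<le> y" "y \<le> W"
  shows "(centre n c V j + y)\<^sup>2 \<le> G ^ 6"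
proof -
  have "\<bar>centre n c V j + y\<bar> \<le> V + W"
    using centre_bounds[OF assms(3,1)] assms by auto
  also have "V + W \<le> G ^ 3"
    using assms hiV_le W_le_G G_power_mono[of 1 2] by (intro G_add[of _ 2]) auto
  finally have "\<bar>centre n c V j + y\<bar>\<^sup>2 \<le> (G ^ 3)\<^sup>2" by (intro power_mono) auto
  then show ?thesis by (simp flip: power_mult)
qed

lemma F_le:
  assumes "0 \<le> V" "V \<le> hiV" "i \<le> n" "F V i p = enat k"
  shows "int k \<le> G ^ 7"
proof -
  have "F V i p \<noteq> \<infinity>" using assms by simp
  then obtain y where y: "\<And>j. j \<in> {1..i} \<Longrightarrow> - W \<le> y j \<and> y j \<le> W"
    "F V i p = enat (nat (\<Sum>j=1..i. (centre n c V j + y j)\<^sup>2))"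
    by (rule dp_f_attained) blast
  then have "int k = (\<Sum>j=1..i. (centre n c V j + y j)\<^sup>2)" using assms by (simp add: sum_nonneg)
  also have "\<dots> \<le> (\<Sum>j=1..i. G ^ 6)"
    using y(1) assms by (intro sum_mono point_sq_le) auto
  also have "\<dots> \<le> G ^ 1 * G ^ 6" using assms(3) G_ge by (auto intro!: mult_right_mono)
  also have "\<dots> = G ^ 7" unfolding power_add[symmetric] by simp
  finally show ?thesis .
qed

definition choice_ok :: "int \<Rightarrow> nat \<Rightarrow> int \<Rightarrow> int \<Rightarrow> bool" where
  "choice_ok V i p y \<longleftrightarrow> - W \<le> y \<and> y \<le> W \<and>
    F V i p = F V (i - 1) (p - c i * y) + enat (nat ((centre n c V i + y)\<^sup>2))"

text \<open>Silent about all other cells, since the arrays are reused for every level and contain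
  stale data there. Choices matter only at finite states above row 0, the only ones that
  backtracking reads.\<close>

definition tabulated :: "int \<Rightarrow> int \<Rightarrow> int \<Rightarrow> dp_var store \<Rightarrow> bool" where
  "tabulated V i p \<tau> \<longleftrightarrow> (\<forall>j q. 0 \<le> j \<and> - M \<le> q \<and> q \<le> M \<and> (j < i \<or> j = i \<and> q < p) \<longrightarrow>
    \<tau> vf (ad j q) = cell_of (F V (nat j) q) \<and>
    (1 \<le> j \<and> F V (nat j) q \<noteq> \<infinity> \<longrightarrow> choice_ok V (nat j) q (\<tau> vchoice (ad j q))))"

lemma tabulated_upd:
  assumes "tabulated V i p \<tau>" "0 \<le> i" "- M \<le> p" "p \<le> M"
    and "\<upsilon> vf = (\<tau> vf)(ad i p := cell_of (F V (nat i) p))" "\<upsilon> vchoice = (\<tau> vchoice)(ad i p := y)"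
    and "F V (nat i) p \<noteq> \<infinity> \<Longrightarrow> choice_ok V (nat i) p y"
  shows "tabulated V i (p + 1) \<upsilon>"
  unfolding tabulated_def
proof (intro allI impI, elim conjE)
  fix j q assume jq: "0 \<le> j" "- M \<le> q" "q \<le> M" "j < i \<or> j = i \<and> q < p + 1"
  show "\<upsilon> vf (ad j q) = cell_of (F V (nat j) q) \<and>
    (1 \<le> j \<and> F V (nat j) q \<noteq> \<infinity> \<longrightarrow> choice_ok V (nat j) q (\<upsilon> vchoice (ad j q)))"
  proof (cases "j = i \<and> q = p")
    case True
    then show ?thesis using assms(5-7) by simp
  next
    case False
    then have "ad j q \<noteq> ad i p" "j < i \<or> j = i \<and> q < p" using ad_inject jq assms(3,4) by auto
    then show ?thesis using assms(1) jq unfolding tabulated_def assms(5,6) by simp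
  qed
qed

text \<open>A complete row is the same as an empty part of the next one, because columns start at
  \<open>- M\<close>.\<close>

lemma tabulated_next_row: "tabulated V i (M + 1) \<tau> \<Longrightarrow> tabulated V (i + 1) (- M) \<tau>"
proof -
  assume *: "tabulated V i (M + 1) \<tau>"
  have "j < i \<or> j = i \<and> q < M + 1" if "q \<le> M" "j < i + 1 \<or> j = i + 1 \<and> q < - M" "- M \<le> q" for j q
    using that by linarith
  then show ?thesis using * unfolding tabulated_def by blast
qed

lemma tabulated_other:
  "v \<noteq> vf \<Longrightarrow> v \<noteq> vchoice \<Longrightarrow> tabulated V i p (\<tau>(v := g)) \<longleftrightarrow> tabulated V i p \<tau>"
  unfolding tabulated_def by simp

definition holds_level :: "int \<Rightarrow> dp_var store \<Rightarrow> bool" where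
  "holds_level V \<tau> \<longleftrightarrow> holds_input \<tau> \<and> \<tau> vW 0 = W \<and> \<tau> vM 0 = M \<and>
    (\<forall>j. 1 \<le> j \<and> j \<le> int n \<longrightarrow> \<tau> vs j = centre n c V (nat j))"

lemma holds_levelD:
  assumes "holds_level V \<tau>"
  shows "\<tau> vn 0 = int n" "\<tau> vW 0 = W" "\<tau> vM 0 = M"
    "\<lbrakk>1 \<le> j; j \<le> int n\<rbrakk> \<Longrightarrow> \<tau> vc j = c (nat j)"
    "\<lbrakk>1 \<le> j; j \<le> int n\<rbrakk> \<Longrightarrow> \<tau> vs j = centre n c V (nat j)"
  using assms by (auto simp: holds_level_def holds_input_def)

lemma holds_level_frame:
  "holds_level V \<sigma> \<Longrightarrow> \<forall>v. v \<notin> X \<longrightarrow> \<tau> v = \<sigma> v \<Longrightarrow> X \<inter> {vn, vR, vc, vW, vM, vs} = {} \<Longrightarrow>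
    holds_level V \<tau>"
  unfolding holds_level_def holds_input_def by (metis disjoint_iff insertCI)

definition value_of_step :: "int \<Rightarrow> int \<Rightarrow> int \<Rightarrow> int \<Rightarrow> enat" where
  "value_of_step V i p y = F V (nat (i - 1)) (p - c (nat i) * y) + enat (nat ((centre n c V (nat i) + y)\<^sup>2))"

lemma F_step: "1 \<le> i \<Longrightarrow> F V (nat i) p = (INF y\<in>{- W..W}. value_of_step V i p y)"
proof -
  assume "1 \<le> i"
  then have "nat i = Suc (nat (i - 1))" by simp
  then show ?thesis using dp_f_Suc[of c "centre n c V" W "nat (i - 1)" p]
    by (simp add: value_of_step_def)
qed

text \<open>The branches of the code match the possible values of a step: a predecessor outside the
  table and an infinite one both leave the best candidate alone, and a finite one improves it or
  not.\<close>

lemma wp_transition: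
  assumes V: "0 \<le> V" "V \<le> hiV" and lev: "holds_level V \<tau>" and i: "1 \<le> i" "i \<le> int n"
    and p: "- M \<le> p" "p \<le> M" and y: "- W \<le> y" "y \<le> W"
    and vars: "\<tau> vi 0 = i" "\<tau> vp 0 = p" "\<tau> vy 0 = y"
    and tab: "\<And>q. - M \<le> q \<Longrightarrow> q \<le> M \<Longrightarrow> \<tau> vf (ad (i - 1) q) = cell_of (F V (nat (i - 1)) q)"
    and best: "best_upto W (value_of_step V i p) y (\<tau> vbest 0) (\<tau> vbesty 0)"
    and count: "0 \<le> \<tau> vcount 0" "\<tau> vcount 0 + 1 \<le> Z"
  shows "wp Z prog_transition (\<lambda>\<upsilon>. \<upsilon> vcount 0 = \<tau> vcount 0 + 1 \<and>
    best_upto W (value_of_step V i p) (y + 1) (\<upsilon> vbest 0) (\<upsilon> vbesty 0)) \<tau>"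
proof -
  have ni: "nat i \<in> {1..n}" using i by auto
  note vals = holds_levelD(2,3)[OF lev] holds_levelD(4,5)[OF lev i] vars
  define q where "q = p - c (nat i) * y"
  define s where "s = centre n c V (nat i)"
  have step: "value_of_step V i p y = F V (nat (i - 1)) q + enat (nat ((s + y)\<^sup>2))"
    by (simp add: value_of_step_def q_def s_def)
  have qZ: "\<bar>q\<bar> \<le> Z"
  proof -
    have "\<bar>c (nat i) * y\<bar> \<le> G ^ (1 + 1)"
      unfolding abs_mult using c_bounds[OF ni] y W_le_G by (intro G_mult) auto
    moreover have "\<bar>q\<bar> \<le> \<bar>p\<bar> + \<bar>c (nat i) * y\<bar>" unfolding q_def by linarith
    moreover have "\<bar>p\<bar> \<le> G ^ 2" using p M_bounds by linarith
    ultimately have "\<bar>q\<bar> \<le> G ^ 2 + G ^ 2" by (simp add: power2_eq_square)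
    then show ?thesis using G_add[of "G ^ 2" 2 "G ^ 2" 3] le_Z[of "\<bar>q\<bar>" 3] by simp
  qed
  have cZ: "\<bar>\<tau> vcount 0 + 1\<bar> \<le> Z" using count by simp
  have yZ: "\<bar>y\<bar> \<le> Z" using y W_le_G G_le_Z by linarith
  note simps = prog_transition_def vals aval_addr q_def[symmetric] s_def[symmetric] qZ cZ yZ
  show ?thesis
  proof (cases "- M \<le> q \<and> q \<le> M")
    case False
    then have "value_of_step V i p y = \<infinity>" using F_outside[of "nat (i - 1)" q V] i by (simp add: step)
    then have "best_upto W (value_of_step V i p) (y + 1) (\<tau> vbest 0) (\<tau> vbesty 0)"
      using best best_upto_skip by blast
    then show ?thesis using False by (auto simp: simps)
  next
    case q: True
    then have f: "\<tau> vf (ad (i - 1) q) = cell_of (F V (nat (i - 1)) q)" using tab by blast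
    show ?thesis
    proof (cases "F V (nat (i - 1)) q")
      case infinity
      then have "value_of_step V i p y = \<infinity>" by (simp add: step)
      then have "best_upto W (value_of_step V i p) (y + 1) (\<tau> vbest 0) (\<tau> vbesty 0)"
        using best best_upto_skip by blast
      \<comment> \<open>The code for infinity, -1, is copied into \<open>vg\<close> and has to
        respect the bound.\<close>
      moreover have "1 \<le> Z" using G_ge G_le_Z by linarith
      ultimately show ?thesis using q by (simp add: simps f infinity)
    next
      case (enat k)
      define l where "l = k + nat ((s + y)\<^sup>2)"
      have g: "value_of_step V i p y = enat l" by (simp add: step enat l_def)
      have k: "int k \<le> G ^ 7" using F_le[OF V _ enat] i by simp
      have l: "int k + (s + y) * (s + y) = int l" by (simp add: l_def power2_eq_square)
      have "(s + y)\<^sup>2 \<le> G ^ 6" unfolding s_def by (rule point_sq_le[OF V ni y])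
      also have "G ^ 6 \<le> G ^ 7" by (rule G_power_mono) simp
      finally have "int l \<le> G ^ 8" unfolding l_def using k by (simp add: G_add)
      then have Z: "int l \<le> Z" "int k \<le> Z" using k le_Z by auto
      show ?thesis
      proof (cases "\<tau> vbest 0 < 0 \<or> int l < \<tau> vbest 0")
        case True
        from best_upto_improve[OF best g True y(1)] show ?thesis
          using q Z True by (simp add: simps f enat l)
      next
        case False
        from best_upto_keep[OF best g False] show ?thesis
          using q Z False by (simp add: simps f enat l)
      qed
    qed
  qed
qed

text \<open>The transition counter accompanies all three loops: its final value is claimed, and as a
  stored number it must stay below \<open>Z\<close> in each single step, hence the last
  premise.\<close>

lemma run_prog_table:
  assumes V: "0 \<le> V" "V \<le> hiV" and lev: "holds_level V \<sigma>"
    and count: "\<sigma> vcount 0 = C" "0 \<le> C" "C + int n * ((2 * M + 1) * (2 * W + 1)) \<le> Z"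
  shows "run Z prog_table \<sigma>
    ((2 + nat (M + 1 - (- M)) * (1 + 2)) + 1 +
     (2 + nat (int n + 1 - 1) * ((2 + nat (M + 1 - (- M)) *
       ((1 + (2 + nat (W + 1 - (- W)) * (12 + 2)) + 1 + 1) + 2)) + 2)))
    (\<lambda>\<tau>. tabulated V (int n + 1) (- M) \<tau> \<and> \<tau> vcount 0 = C + int n * ((2 * M + 1) * (2 * W + 1)))"
  unfolding prog_table_def
proof (rule run_Seq[where R = "\<lambda>\<tau>. tabulated V 1 (- M) \<tau>"],
    rule run_Seq[where R = "\<lambda>\<tau>. \<forall>q. - M \<le> q \<and> q \<le> M \<longrightarrow> \<tau> vf (ad 0 q) = -1"],
    goal_cases first origin rows)
  have MZ: "M + 1 \<le> Z"
    using M_bounds G_power_mono[of 0 2] by (intro le_Z[of _ 3] G_add[of _ 2]) auto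
  have WZ: "W + 1 \<le> Z" using W_le_G G_le_Z by linarith
  have Z1: "1 \<le> Z" using G_ge G_le_Z by linarith
  {
    case first
    show ?case
    proof (rule run_For[where lo = "- M" and hi = M and
          I = "\<lambda>p \<tau>. \<forall>q. - M \<le> q \<and> q < p \<longrightarrow> \<tau> vf (ad 0 q) = -1"],
          goal_cases lo le b1 b2 x hi indep init step exit)
      case (step p \<upsilon>)
      have M: "\<upsilon> vM 0 = M" using step(5) holds_levelD(3)[OF lev] by simp
      have upd: "((\<upsilon> vf)(ad 0 p := -1)) (ad 0 q) = -1" if "- M \<le> q" "q < p + 1" for q
        by (cases "q = p") (use step(4) that in auto)
      show ?case
      proof (rule run_wp, goal_cases)
        case 1
        show ?case using step(3) upd Z1 by (simp add: aval_addr M del: fun_upd_apply) simp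
      qed simp
    qed (use MZ M_pos holds_levelD[OF lev] in auto)
  next
    case (origin \<tau>)
    have M: "\<tau> vM 0 = M" using origin(2) holds_levelD(3)[OF lev] by (simp add: For_def)
    have *: "tabulated V 1 (- M) (\<tau>(vf := (\<tau> vf)(ad 0 0 := 0)))"
      unfolding tabulated_def
    proof (intro allI impI, elim conjE)
      fix j q :: int assume jq: "0 \<le> j" "- M \<le> q" "q \<le> M" "j < 1 \<or> j = 1 \<and> q < - M"
      then have "j = 0" by auto
      moreover have "ad 0 q = ad 0 0 \<longleftrightarrow> q = 0" using ad_inject jq M_pos by auto
      ultimately show "(\<tau>(vf := (\<tau> vf)(ad 0 0 := 0))) vf (ad j q) = cell_of (F V (nat j) q) \<and>
        (1 \<le> j \<and> F V (nat j) q \<noteq> \<infinity> \<longrightarrow>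
          choice_ok V (nat j) q ((\<tau>(vf := (\<tau> vf)(ad 0 0 := 0))) vchoice (ad j q)))"
        using origin(1) jq by (simp add: dp_f_0 zero_enat_def)
    qed
    show ?case
    proof (rule run_wp, goal_cases)
      case 1
      show ?case using * Z1 by (simp add: aval_addr M)
    qed simp
  next
    case (rows \<tau>)
    have lev1: "holds_level V \<tau>"
      by (rule holds_level_frame[OF lev rows(2)]) (simp add: For_def)
    have count1: "\<tau> vcount 0 = C" using rows(2) count(1) by (simp add: For_def)
    \<comment> \<open>\<open>D\<close> transitions per state and \<open>E\<close> per row; the
      counter is read off the three loop positions like a number in a mixed radix system.\<close>
    define D where "D = 2 * W + 1"
    define E where "E = (2 * M + 1) * D"
    have DE: "0 \<le> D" "0 \<le> E" "0 \<le> M" using W_ge M_pos by (auto simp: D_def E_def)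
    show ?case
      unfolding D_def[symmetric] E_def[symmetric]
    proof (rule run_For[where lo = 1 and hi = "int n" and
          I = "\<lambda>i \<tau>. tabulated V i (- M) \<tau> \<and> \<tau> vcount 0 = C + (i - 1) * E"],
          goal_cases lo le b1 b2 x hi indep init step exit)
      case x
      show ?case by (simp add: For_def prog_transition_def)
    next
      case (hi \<upsilon>)
      then show ?case using holds_levelD(1)[OF lev1] by (simp add: For_def prog_transition_def)
    next
      case init
      show ?case using rows(1) count1 by simp
    next
      case (step i \<upsilon>)
      have lev2: "holds_level V \<upsilon>"
        by (rule holds_level_frame[OF lev1 step(5)]) (simp add: For_def prog_transition_def)
      show ?case
      proof (rule run_For[where lo = "- M" and hi = M and
            I = "\<lambda>p \<tau>. tabulated V i p \<tau> \<and> \<tau> vcount 0 = C + (i - 1) * E + (p + M) * D"],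
            goal_cases lo le b1 b2 x hi indep init step' exit)
        case x
        show ?case by (simp add: For_def prog_transition_def)
      next
        case (hi \<upsilon>')
        then show ?case using holds_levelD(3)[OF lev2] by (simp add: For_def prog_transition_def)
      next
        case (indep p \<tau>' g)
        then show ?case by (simp add: tabulated_other)
      next
        case init
        show ?case using step(4) by simp
      next
        case (exit \<upsilon>')
        have "C + (i - 1) * E + (M + 1 + M) * D = C + (i + 1 - 1) * E"
          by (simp add: E_def algebra_simps)
        then show ?case using exit(2) tabulated_next_row by auto
      next
        case (step' p \<upsilon>')
        have lev3: "holds_level V \<upsilon>'"
          by (rule holds_level_frame[OF lev2 step'(5)]) (simp add: For_def prog_transition_def)
        have vi3: "\<upsilon>' vi 0 = i" using step'(5) step(3) by (simp add: For_def prog_transition_def)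
        define C' where "C' = C + (i - 1) * E + (p + M) * D"
        have C': "0 \<le> C'" "C' + D \<le> Z"
        proof -
          have "0 \<le> (i - 1) * E" "0 \<le> (p + M) * D"
            using step(1) step'(1) DE by auto
          then show "0 \<le> C'" using count(2) by (simp add: C'_def)
          \<comment> \<open>The extreme case is the last state of the last row: \<open>n - 1\<close>
            full rows, \<open>2 * M\<close> full states and one more.\<close>
          have "(i - 1) * E \<le> (int n - 1) * E" using step(2) DE by (intro mult_right_mono) auto
          moreover have "(p + M) * D \<le> 2 * M * D" using step'(2) DE by (intro mult_right_mono) auto
          moreover have "(int n - 1) * E + 2 * M * D + D = int n * E"
            by (simp add: E_def algebra_simps)
          ultimately show "C' + D \<le> Z"
            using count(3) unfolding C'_def D_def[symmetric] E_def[symmetric] by linarith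
        qed
        let ?done = "\<lambda>\<rho>. (F V (nat i) p \<noteq> \<infinity> \<longrightarrow> choice_ok V (nat i) p (\<rho> vbesty 0)) \<and>
          \<rho> vcount 0 = C' + D"
        show ?case
        proof (rule run_Seq[where R = "\<lambda>\<rho>. \<rho> vf = (\<upsilon>' vf)(ad i p := cell_of (F V (nat i) p)) \<and> ?done \<rho>"],
            rule run_Seq[where R = "\<lambda>\<rho>. \<rho> vbest 0 = cell_of (F V (nat i) p) \<and> ?done \<rho>"],
            rule run_Seq[where R = "\<lambda>\<rho>. \<rho> vbest 0 = -1"], goal_cases best loop store choose)
          case best
          show ?case using Z1 by (intro run_wp) auto
        next
          case (loop \<rho>)
          have lev4: "holds_level V \<rho>"
            by (rule holds_level_frame[OF lev3 loop(2)]) simp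
          have vals: "\<rho> vi 0 = i" "\<rho> vp 0 = p" "\<rho> vcount 0 = C'" "\<rho> vf = \<upsilon>' vf"
            using loop(2) vi3 step'(3,4) by (simp_all add: C'_def)
          show ?case
          proof (rule run_For[where lo = "- W" and hi = W and
                I = "\<lambda>y \<tau>. best_upto W (value_of_step V i p) y (\<tau> vbest 0) (\<tau> vbesty 0) \<and>
                  \<tau> vcount 0 = C' + (y + W)"],
                goal_cases lo le b1 b2 x hi indep init step'' exit)
            case x
            show ?case by (simp add: prog_transition_def)
          next
            case (hi \<rho>')
            then show ?case using holds_levelD(2)[OF lev4] by (simp add: prog_transition_def)
          next
            case init
            show ?case using loop(1) vals by (simp add: best_upto_init)
          next
            case (step'' y \<rho>')
            have lev5: "holds_level V \<rho>'"
              by (rule holds_level_frame[OF lev4 step''(5)]) (simp add: prog_transition_def)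
            have vals': "\<rho>' vi 0 = i" "\<rho>' vp 0 = p" "\<rho>' vf = \<upsilon>' vf"
              using step''(5) vals by (simp_all add: prog_transition_def)
            have tab: "\<rho>' vf (ad (i - 1) q) = cell_of (F V (nat (i - 1)) q)" if "- M \<le> q" "q \<le> M" for q
              using step'(4) that step(1) unfolding vals' tabulated_def by simp
            have cnt: "\<rho>' vcount 0 = C' + (y + W)" using step''(4) by simp
            have cnt': "0 \<le> \<rho>' vcount 0" "\<rho>' vcount 0 + 1 \<le> Z"
              using cnt C' step''(1,2) by (auto simp: D_def)
            show ?case
            proof (rule run_wp)
              show "straight_steps prog_transition \<le> 12" by (simp add: prog_transition_def)
              show "wp Z prog_transition (\<lambda>\<tau>. best_upto W (value_of_step V i p) (y + 1) (\<tau> vbest 0) (\<tau> vbesty 0) \<and>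
                  \<tau> vcount 0 = C' + (y + 1 + W)) \<rho>'"
                using wp_transition[OF V lev5 step(1,2) step'(1,2) step''(1,2) vals'(1,2) step''(3) tab
                    conjunct1[OF step''(4)] cnt']
                by (simp add: cnt conj_commute ac_simps)
            qed
          next
            case (exit \<rho>')
            have *: "best_upto W (value_of_step V i p) (W + 1) (\<rho>' vbest 0) (\<rho>' vbesty 0)"
              "\<rho>' vcount 0 = C' + D"
              using exit(2) by (auto simp: D_def)
            have "choice_ok V (nat i) p (\<rho>' vbesty 0)" if "F V (nat i) p \<noteq> \<infinity>"
              using best_upto_final(2)[OF *(1)] that step(1)
              unfolding F_step[OF step(1), symmetric] choice_ok_def
              by (simp add: value_of_step_def nat_diff_distrib)
            then show ?case
              using *(2) best_upto_final(1)[OF *(1)] unfolding F_step[OF step(1), symmetric] by blast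
          qed (use WZ W_ge holds_levelD(2)[OF lev4] in auto)
        next
          case (store \<rho>)
          have vals: "\<rho> vM 0 = M" "\<rho> vi 0 = i" "\<rho> vp 0 = p" "\<rho> vf = \<upsilon>' vf"
            using store(2) vi3 step'(3) holds_levelD(3)[OF lev3]
            by (simp_all add: For_def prog_transition_def)
          show ?case
          proof (rule run_wp, goal_cases)
            case 1
            show ?case using store(1) bounded_storeD[OF store(3), of vbest 0]
              by (simp add: aval_addr vals)
          qed simp
        next
          case (choose \<rho>)
          have vals: "\<rho> vM 0 = M" "\<rho> vi 0 = i" "\<rho> vp 0 = p" "\<rho> vchoice = \<upsilon>' vchoice"
            using choose(2) vi3 step'(3) holds_levelD(3)[OF lev3]
            by (simp_all add: For_def prog_transition_def)
          have cnt: "C + (i - 1) * E + (p + 1 + M) * D = C' + D"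
            by (simp add: C'_def algebra_simps)
          have tab: "tabulated V i (p + 1) (\<rho>(vchoice := (\<rho> vchoice)(ad i p := \<rho> vbesty 0)))"
            by (rule tabulated_upd[OF conjunct1[OF step'(4)], where y = "\<rho> vbesty 0"])
              (use step(1) step'(1,2) choose(1) vals in auto)
          show ?case
          proof (rule run_wp, goal_cases)
            case 1
            \<comment> \<open>For an infinite state \<open>vbesty\<close> is stale, so its magnitude
              is known only from the bound on the whole store.\<close>
            show ?case using choose(1) tab bounded_storeD[OF choose(3), of vbesty 0]
              by (simp add: aval_addr vals cnt)
          qed simp
        qed
      qed (use MZ M_pos holds_levelD(3)[OF lev2] in auto)
    next
      case (indep i \<tau>' g)
      then show ?case by (simp add: tabulated_other)
    next
      case (exit \<upsilon>)
      then show ?case by simp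
    qed (use G_ge G_le_Z in auto)
  }
qed

text \<open>Finiteness drives the descent: a finite value with a valid choice has a finite
  predecessor, which by \<open>F_outside\<close> is again in the table and so has a valid choice of
  its own.\<close>

lemma run_prog_backtrack:
  assumes lev: "holds_level V \<sigma>" and tab: "tabulated V (int n + 1) (- M) \<sigma>"
    and rho: "\<sigma> vrho 0 = residual n c V" and fin: "F V n (residual n c V) \<noteq> \<infinity>"
    and V: "0 \<le> V" "V \<le> hiV"
  shows "run Z prog_backtrack \<sigma> (2 + (1 + n * (4 + 1)))
    (\<lambda>\<tau>. backtracked n c W V (\<lambda>i. \<tau> vx (int i)))"
  unfolding prog_backtrack_def
proof (rule run_Seq[where R = "\<lambda>\<tau>. \<tau> vp 0 = residual n c V \<and> \<tau> vi 0 = int n"], goal_cases init loop)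
  case init
  show ?case
  proof (rule run_bounded, rule run_wp, goal_cases)
    case 1
    show ?case using rho holds_levelD(1)[OF lev] bounded_storeD[OF 1, of vrho 0] G_ge G_le_Z by simp
  qed simp
next
  case (loop \<tau>)
  have lev': "holds_level V \<tau>"
    by (rule holds_level_frame[OF lev loop(2)]) simp
  have choice: "choice_ok V i p (\<tau> vchoice (ad (int i) p))"
    if "i \<in> {1..n}" "F V i p \<noteq> \<infinity>" for i p
  proof -
    have "- M \<le> p \<and> p \<le> M" using F_outside[of i p V] that by auto
    moreover have "\<tau> vchoice = \<sigma> vchoice" using loop(2) by simp
    ultimately show ?thesis using tab[unfolded tabulated_def, rule_format, of "int i" p] that by simp
  qed
  define ok where "ok j p y \<tau> \<longleftrightarrow> - W \<le> y j \<and> y j \<le> W \<and> p (j - 1) = p j - c j * y j \<and>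
    F V j (p j) = F V (j - 1) (p (j - 1)) + enat (nat ((centre n c V j + y j)\<^sup>2)) \<and>
    \<tau> vx (int j) = centre n c V j + y j"
    for j :: nat and p y :: "nat \<Rightarrow> int" and \<tau> :: "dp_var store"
  let ?I = "\<lambda>k \<tau>. \<tau> vi 0 = int k \<and> k \<le> n \<and> (\<exists>p y. p n = residual n c V \<and> \<tau> vp 0 = p k \<and>
    F V k (p k) \<noteq> \<infinity> \<and> (\<forall>j\<in>{k<..n}. ok j p y \<tau>))"
  show ?case
  proof (rule run_While[where I = ?I], goal_cases init stop step exit)
    case init
    show ?case using loop(1) fin by auto
  next
    case (stop \<upsilon>)
    then show ?case by simp
  next
    case (step k \<upsilon>)
    then obtain p y where py: "p n = residual n c V" "\<upsilon> vp 0 = p (Suc k)"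
      "F V (Suc k) (p (Suc k)) \<noteq> \<infinity>" "\<forall>j\<in>{Suc k<..n}. ok j p y \<upsilon>" by blast
    have k: "Suc k \<in> {1..n}" using step(1) by simp
    have lev2: "holds_level V \<upsilon>"
      by (rule holds_level_frame[OF lev' step(3)]) simp
    have vi: "\<upsilon> vi 0 = int (Suc k)" using step(1) by simp
    have ch: "\<upsilon> vchoice = \<tau> vchoice" using step(3) by simp
    define z where "z = \<upsilon> vchoice (ad (int (Suc k)) (p (Suc k)))"
    define s where "s = centre n c V (Suc k)"
    have z: "choice_ok V (Suc k) (p (Suc k)) z"
      using choice[OF k py(3)] by (simp add: z_def ch)
    have vals: "\<upsilon> vc (int (Suc k)) = c (Suc k)" "\<upsilon> vs (int (Suc k)) = s" "\<upsilon> vM 0 = M"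
      using holds_levelD(3)[OF lev2] holds_levelD(4,5)[OF lev2, of "int (Suc k)"] k
      by (auto simp: s_def simp del: of_nat_Suc)
    \<comment> \<open>Extends the trace downwards. The conditions for larger indices involve neither
      \<open>p k\<close> nor \<open>y (Suc k)\<close>, so they survive.\<close>
    define p' where "p' = p(k := p (Suc k) - c (Suc k) * z)"
    define y' where "y' = y(Suc k := z)"
    have F: "F V (Suc k) (p (Suc k)) = F V k (p' k) + enat (nat ((s + z)\<^sup>2))"
      using z by (simp add: choice_ok_def p'_def s_def)
    then have fin': "F V k (p' k) \<noteq> \<infinity>" using py(3) by (metis plus_enat_simps(2))
    have "- M \<le> p' k \<and> p' k \<le> M" using F_outside[of k "p' k" V] fin' k by auto
    then have pZ: "\<bar>p' k\<bar> \<le> Z" using M_bounds le_Z[of M 2] by auto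
    have zW: "- W \<le> z" "z \<le> W" using z by (auto simp: choice_ok_def)
    then have zZ: "\<bar>z\<bar> \<le> Z" using W_le_G G_le_Z by linarith
    have "\<bar>s + z\<bar> \<le> G ^ 3"
    proof -
      have "\<bar>s + z\<bar> \<le> V + W" unfolding s_def using centre_bounds[OF k V(1)] zW by auto
      also have "V + W \<le> G ^ 3"
        using V hiV_le W_le_G G_power_mono[of 1 2] by (intro G_add[of _ 2]) auto
      finally show ?thesis .
    qed
    then have szZ: "\<bar>s + z\<bar> \<le> Z" by (rule le_Z) simp
    have kZ: "int k \<le> Z" using k G_ge G_le_Z by simp
    let ?\<rho> = "\<upsilon>(vy := (\<upsilon> vy)(0 := z), vx := (\<upsilon> vx)(int (Suc k) := s + z),
      vp := (\<upsilon> vp)(0 := p' k), vi := (\<upsilon> vi)(0 := int k))"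
    have ok: "ok j p' y' ?\<rho>" if j: "j \<in> {k<..n}" for j
    proof (cases "j = Suc k")
      case True
      then show ?thesis using zW F by (simp add: ok_def p'_def y'_def s_def)
    next
      case False
      then have "ok j p y \<upsilon>" "j - 1 \<noteq> k" "j \<noteq> k" using py(4) j by auto
      then show ?thesis using False by (simp add: ok_def p'_def y'_def)
    qed
    have "p' n = residual n c V" using py(1) k by (simp add: p'_def)
    then have "\<exists>p y. p n = residual n c V \<and> ?\<rho> vp 0 = p k \<and> F V k (p k) \<noteq> \<infinity> \<and>
        (\<forall>j\<in>{k<..n}. ok j p y ?\<rho>)"
      using fin' ok by (intro exI[of _ p'] exI[of _ y']) simp
    then have I: "?I k ?\<rho>" using k by simp
    show ?case
    proof (rule run_wp, goal_cases)
      case 1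
      have "p (Suc k) - c (Suc k) * z = p' k" by (simp add: p'_def)
      then have "wp Z (vy ::= vchoice\<lblot>addr \<acute>vi \<acute>vp\<rblot>;; vx\<lblot>\<acute>vi\<rblot> ::= vs\<lblot>\<acute>vi\<rblot> \<oplus> \<acute>vy;;
          vp ::= \<acute>vp \<ominus> vc\<lblot>\<acute>vi\<rblot> \<otimes> \<acute>vy;; vi ::= \<acute>vi \<ominus> N 1) Q \<upsilon> \<longleftrightarrow> Q ?\<rho>" for Q
        using zZ szZ pZ kZ vals py(2)
        by (simp add: vi aval_addr z_def[symmetric] del: of_nat_Suc) simp
      then show ?case using I by blast
    qed simp
  next
    case (exit k \<upsilon>)
    then have k: "k = 0" by simp
    from exit(1)[unfolded k] obtain p y where py: "p n = residual n c V" "\<forall>j\<in>{0<..n}. ok j p y \<upsilon>"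
      by blast
    show ?case
      unfolding backtracked_def Let_def
      by (intro exI[of _ p] exI[of _ y] conjI py(1)) (use py(2) in \<open>auto simp: ok_def\<close>)
  qed
qed

end

section \<open>The main loop and the bounds\<close>

text \<open>\<open>X\<close> is the scale of one level, which costs at most \<open>180 * X\<close>
  steps. There are at most \<open>2 * l\<close> levels, giving \<open>360\<close> times the product
  \<open>Q\<close>; the remainder of 400 absorbs the preprocessing, and the factor \<open>B\<close>
  comes from the bisection.\<close>

lemma steps_le:
  fixes n w l B m :: nat
  assumes "2 \<le> n" "2 \<le> w" "2 \<le> l" "1 \<le> B" "m \<le> l + 1"
  shows "(3 + (2 + n * (5 + 2))) + (2 + (1 + (w - 1) * (1 + 1)) + 1 + 1) +
      (3 + (1 + B * (4 + 1)) + 1 + 1 + 3 + 3) + 1 + 1 +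
      (1 + m * ((1 + (2 + n * (2 + 2))) +
        ((2 + (2 * (w * l) + 1) * (1 + 2)) + 1 +
          (2 + n * ((2 + (2 * (w * l) + 1) * ((1 + (2 + (2 * w + 1) * (12 + 2)) + 1 + 1) + 2)) + 2))) +
        1 + ((1 + (2 + (1 + n * (4 + 1)))) + 1) + 1)) \<le> 400 * (n * w\<^sup>2 * l\<^sup>2) * B"
proof -
  define X where "X = n * w\<^sup>2 * l"
  have wl: "1 \<le> w * l" using assms by (simp add: Suc_le_eq)
  have w1: "1 \<le> w\<^sup>2 * l" using assms by (simp add: Suc_le_eq)
  have X1: "n \<le> X" "w * l \<le> X" "w\<^sup>2 * l \<le> X" "w \<le> X" "1 \<le> X"
  proof -
    have "n * 1 \<le> n * (w\<^sup>2 * l)" by (rule mult_le_mono2[OF w1])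
    then show n: "n \<le> X" by (simp add: X_def mult.assoc)
    have "1 * (w\<^sup>2 * l) \<le> n * (w\<^sup>2 * l)" using assms by (intro mult_le_mono1) simp
    then show 1: "w\<^sup>2 * l \<le> X" by (simp add: X_def mult.assoc)
    have "w * 1 \<le> w * w" using assms by (intro mult_le_mono2) simp
    then have "w * l \<le> w\<^sup>2 * l" by (intro mult_le_mono1) (simp add: power2_eq_square)
    then show 2: "w * l \<le> X" using 1 by (rule order_trans)
    have "w * 1 \<le> w * l" using assms by (intro mult_le_mono2) simp
    then show "w \<le> X" using 2 by linarith
    show "1 \<le> X" using n assms by simp
  qed
  have "(2 * (w * l) + 1) * ((1 + (2 + (2 * w + 1) * (12 + 2)) + 1 + 1) + 2) \<le> (3 * (w * l)) * (46 * w)"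
    using assms wl by (intro mult_le_mono) auto
  also have "\<dots> = 138 * (w\<^sup>2 * l)" by (simp add: power2_eq_square)
  finally have "n * ((2 + (2 * (w * l) + 1) * ((1 + (2 + (2 * w + 1) * (12 + 2)) + 1 + 1) + 2)) + 2)
      \<le> n * (142 * (w\<^sup>2 * l))"
    using w1 by (intro mult_le_mono2) linarith
  also have "\<dots> = 142 * X" by (simp add: X_def)
  finally have rows: "n * ((2 + (2 * (w * l) + 1) * ((1 + (2 + (2 * w + 1) * (12 + 2)) + 1 + 1) + 2)) + 2)
      \<le> 142 * X" .
  have "P \<le> 142 * X \<Longrightarrow> (1 + (2 + n * (2 + 2))) + ((2 + (2 * (w * l) + 1) * (1 + 2)) + 1 + (2 + P)) +
        1 + ((1 + (2 + (1 + n * (4 + 1)))) + 1) + 1 \<le> 180 * X" for P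
    using X1 by (simp add: mult.commute[of l w])
  from this[OF rows] have body: "(1 + (2 + n * (2 + 2))) +
        ((2 + (2 * (w * l) + 1) * (1 + 2)) + 1 +
          (2 + n * ((2 + (2 * (w * l) + 1) * ((1 + (2 + (2 * w + 1) * (12 + 2)) + 1 + 1) + 2)) + 2))) +
        1 + ((1 + (2 + (1 + n * (4 + 1)))) + 1) + 1 \<le> 180 * X" (is "?body \<le> _") .
  have "m * ?body \<le> (2 * l) * (180 * X)"
    using assms by (intro mult_le_mono[OF _ body]) simp
  also have "\<dots> = 360 * (n * w\<^sup>2 * l\<^sup>2)" by (simp add: X_def power2_eq_square)
  finally have main: "m * ?body \<le> 360 * (n * w\<^sup>2 * l\<^sup>2)" .
  define Q where "Q = n * w\<^sup>2 * l\<^sup>2"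
  have "X * 2 \<le> X * l" using assms by (intro mult_le_mono2)
  then have QX: "2 * X \<le> Q" by (simp add: X_def Q_def power2_eq_square mult.assoc)
  \<comment> \<open>This is \<open>(Q - 1) * (B - 1) >= 0\<close>; it lets the bisection term, added
    to the scan, be absorbed in the product \<open>Q * B\<close>.\<close>
  have "4 * Q + 4 * B \<le> 4 * (Q * B) + 4"
  proof -
    obtain q b where "Q = Suc q" "B = Suc b"
      using assms QX X1 by (cases Q; cases B) auto
    then show ?thesis by simp
  qed
  moreover have "Q * 1 \<le> Q * B" using assms by (intro mult_le_mono2)
  moreover have "w * 4 \<le> Q" "n * 4 \<le> Q" "16 \<le> Q"
  proof -
    have "2 * 2 * 2 \<le> w * w * l" using assms by (intro mult_le_mono)
    then have "n * 8 \<le> n * (w * w * l)" by (intro mult_le_mono2) simp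
    then have n8: "n * 8 \<le> X" by (simp add: X_def power2_eq_square mult.assoc)
    then show "n * 4 \<le> Q" "16 \<le> Q" using QX assms by linarith+
    have "w * (2 * 2 * 2) \<le> w * (n * w * l)" using assms by (intro mult_le_mono2 mult_le_mono)
    also have "\<dots> = X" by (simp add: X_def power2_eq_square)
    finally have "w * 8 \<le> X" by simp
    then show "w * 4 \<le> Q" using QX by linarith
  qed
  ultimately have total: "25 + 7 * n + 2 * w + 5 * B + 360 * Q \<le> 400 * (Q * B)" by linarith
  have "P \<le> 360 * Q \<Longrightarrow> (3 + (2 + n * (5 + 2))) + (2 + (1 + (w - 1) * (1 + 1)) + 1 + 1) +
      (3 + (1 + B * (4 + 1)) + 1 + 1 + 3 + 3) + 1 + 1 + (1 + P) \<le> 25 + 7 * n + 2 * w + 5 * B + 360 * Q" for P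
    by simp
  from this[OF main[folded Q_def]] show ?thesis
    using total unfolding Q_def[symmetric] mult.assoc[of 400] by (rule order_trans)
qed

section \<open>The scan through the levels\<close>

context dp_instance
begin

definition per_level :: int where "per_level = int n * ((2 * M + 1) * (2 * W + 1))"

lemma per_level_nonneg: "0 \<le> per_level"
  using M_pos W_ge by (simp add: per_level_def)

text \<open>Both ends of the range are roundings of the same root, which cancels in the difference.
  Here the radius drops out of the number of levels.\<close>

lemma level_count: "hiV - optV + 1 \<le> l1 + 1"
proof -
  have "hiV \<le> \<lceil>sqrt (real_of_int (R * nrm))\<rceil>" unfolding hiV_def by linarith
  then show ?thesis using optV(1) by (simp add: loV_def)
qed

lemma transition_total_le_Z: "(l1 + 1) * per_level \<le> Z"
proof -
  have "2 * M + 1 \<le> G ^ 4"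
  proof -
    have 1: "1 \<le> G ^ 2" using G_ge by (intro one_le_power) auto
    then have "M + 1 \<le> G ^ 3" using M_bounds 1 by (intro G_add[of _ 2]) auto
    moreover have "M \<le> G ^ 3" using calculation by simp
    ultimately have "M + (M + 1) \<le> G ^ 4" by (intro G_add[of M 3 "M + 1" 4]) simp_all
    then show ?thesis by simp
  qed
  moreover have "2 * W + 1 \<le> G ^ 2"
    using G_add[of W 1 "W + 1" 2] W_le_G by simp
  ultimately have "(2 * M + 1) * (2 * W + 1) \<le> G ^ (4 + 2)"
    using M_pos W_ge by (intro G_mult[of _ 4 _ 2]) auto
  then have "per_level \<le> G ^ (1 + (4 + 2))"
    unfolding per_level_def by (rule G_mult[rotated 3]) (use G_ge M_pos W_ge in auto)
  then have "(l1 + 1) * per_level \<le> G ^ (1 + (1 + (4 + 2)))"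
    by (rule G_mult[rotated 3]) (use per_level_nonneg n_le_l1 G_ge in auto)
  then show ?thesis by (rule le_Z) simp
qed

text \<open>The first inequality excludes the code -1 of infinity, which would otherwise pass as a
  small value.\<close>

lemma accepts_iff_cell:
  "accepts n c R W V \<longleftrightarrow> 0 \<le> cell_of (F V n (residual n c V)) \<and> cell_of (F V n (residual n c V)) \<le> R"
  unfolding accepts_def by (cases "F V n (residual n c V)") (use R_pos in auto)

lemma accepts_imp_optV: "\<lbrakk>accepts n c R W V; optV \<le> V; V \<le> hiV\<rbrakk> \<Longrightarrow> V = optV"
  using optV(3)[of V] optV(1) by auto

abbreviation solved :: "dp_var store \<Rightarrow> bool" where
  "solved \<tau> \<equiv> \<tau> vV 0 = optV \<and> \<tau> vcount 0 = (hiV - optV + 1) * per_level \<and>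
    backtracked n c W optV (\<lambda>i. \<tau> vx (int i))"

definition level_body :: "dp_var com" where
  "level_body =
    (prog_centre;; prog_table;;
     vg ::= vf\<lblot>addr \<acute>vn \<acute>vrho\<rblot>;;
     IF And (N 0 \<preceq> \<acute>vg) (\<acute>vg \<preceq> \<acute>vR) THEN (vstop ::= N 1;; prog_backtrack)
     ELSE vV ::= \<acute>vV \<ominus> N 1)"

lemma written_level_body:
  "written level_body \<inter> {vn, vR, vc, vW, vM, vnorm, vlo} = {}"
  by (simp add: level_body_def prog_centre_def prog_table_def prog_backtrack_def prog_transition_def For_def)

text \<open>Above \<open>optV\<close> every level is rejected, and \<open>optV\<close> itself is
  accepted. So acceptance identifies \<open>V\<close> as the optimum, and after a rejection the next
  level is still at least \<open>optV\<close>.\<close>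

lemma run_level_body:
  assumes inp: "holds_input \<sigma>" "\<sigma> vnorm 0 = nrm" "\<sigma> vW 0 = W" "\<sigma> vM 0 = M" "\<sigma> vstop 0 = 0"
    and V: "\<sigma> vV 0 = V" "optV \<le> V" "V \<le> hiV" and count: "\<sigma> vcount 0 = (hiV - V) * per_level"
  shows "run Z level_body \<sigma>
     ((1 + (2 + nat (int n + 1 - 1) * (2 + 2))) +
     ((2 + nat (M + 1 - (- M)) * (1 + 2)) + 1 +
     (2 + nat (int n + 1 - 1) * ((2 + nat (M + 1 - (- M)) *
       ((1 + (2 + nat (W + 1 - (- W)) * (12 + 2)) + 1 + 1) + 2)) + 2))) +
     1 + ((1 + (2 + (1 + n * (4 + 1)))) + 1))
    (\<lambda>\<tau>. \<tau> vstop 0 = 0 \<and> optV \<le> V - 1 \<and> \<tau> vV 0 = V - 1 \<and> \<tau> vcount 0 = (hiV - (V - 1)) * per_level \<or>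
      \<tau> vstop 0 = 1 \<and> V = optV \<and> solved \<tau>)"
  unfolding level_body_def
proof (rule run_Seq[where R = "\<lambda>\<tau>. tabulated V (int n + 1) (- M) \<tau> \<and> holds_level V \<tau> \<and>
      \<tau> vrho 0 = residual n c V \<and> \<tau> vV 0 = V \<and> \<tau> vstop 0 = 0 \<and>
      \<tau> vcount 0 = (hiV - (V - 1)) * per_level \<and> \<tau> vg 0 = cell_of (F V n (residual n c V))"],
    rule run_Seq[where R = "\<lambda>\<tau>. tabulated V (int n + 1) (- M) \<tau> \<and> \<tau> vV 0 = V \<and>
      \<tau> vrho 0 = residual n c V \<and> \<tau> vstop 0 = 0 \<and> holds_level V \<tau> \<and>
      \<tau> vcount 0 = (hiV - (V - 1)) * per_level"],
    rule run_Seq[where R = "\<lambda>\<tau>. (\<forall>j. 1 \<le> j \<and> j \<le> int n \<longrightarrow> \<tau> vs j = centre n c V (nat j)) \<and>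
      \<tau> vrho 0 = residual n c V"], goal_cases centre table read decide)
  have V0: "0 \<le> V" using V(2) optV(1) loV_nonneg by simp
  {
    case centre
    show ?case by (rule run_prog_centre[OF inp(1,2) V(1) V0 V(3)])
  next
    case (table \<tau>)
    have fr: "\<tau> v = \<sigma> v" if "v \<notin> {vrho, vi, vs}" for v
      using table(2) that by (simp add: prog_centre_def For_def)
    have lev: "holds_level V \<tau>"
      using inp table(1) by (simp add: holds_level_def holds_input_def fr)
    have cnt: "\<tau> vcount 0 = (hiV - V) * per_level" "0 \<le> (hiV - V) * per_level"
      using count V per_level_nonneg by (simp_all add: fr)
    have "(hiV - V) * per_level + per_level = (hiV - V + 1) * per_level" by (simp add: algebra_simps)
    also have "\<dots> \<le> (l1 + 1) * per_level"
      using level_count V per_level_nonneg by (intro mult_right_mono) auto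
    also have "\<dots> \<le> Z" by (rule transition_total_le_Z)
    finally have le: "(hiV - V) * per_level + per_level \<le> Z" .
    have vals: "\<tau> vV 0 = V" "\<tau> vstop 0 = 0" "\<tau> vrho 0 = residual n c V"
      using V(1) inp(5) table(1) by (simp_all add: fr)
    show ?case
    proof (rule run_mono[OF run_prog_table[OF V0 V(3) lev cnt, folded per_level_def, OF le] order_refl],
        goal_cases)
      case (1 \<upsilon>)
      have fr': "\<upsilon> v = \<tau> v" if "v \<notin> {vcount, vq, vg, vbest, vbesty, vf, vchoice, vi, vp, vy}" for v
        using 1(2) that by (simp add: prog_table_def prog_transition_def For_def)
      have "holds_level V \<upsilon>"
        using lev by (simp add: holds_level_def holds_input_def fr')
      moreover have "(hiV - V) * per_level + per_level = (hiV - (V - 1)) * per_level"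
        by (simp add: algebra_simps)
      ultimately show ?case using 1(1) vals by (simp add: fr')
    qed
  next
    case (read \<tau>)
    have vals: "\<tau> vn 0 = int n" "\<tau> vM 0 = M" "\<tau> vrho 0 = residual n c V"
      using read(1) holds_levelD(1,3) by blast+
    have "- M \<le> residual n c V \<and> residual n c V \<le> M" using residual_le[of V] by (auto simp: M_def abs_le_iff)
    then have f: "\<tau> vf (ad (int n) (residual n c V)) = cell_of (F V n (residual n c V))"
      using conjunct1[OF read(1), unfolded tabulated_def, rule_format, of "int n" "residual n c V"]
      by simp
    have lev: "holds_level V (\<tau>(vg := g))" for g
      using read(1) by (simp add: holds_level_def holds_input_def)
    show ?case
    proof (rule run_wp, goal_cases)
      case 1
      show ?case
        using read(1) bounded_storeD[OF read(3), of vf "ad (int n) (residual n c V)"] lev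
        by (simp add: aval_addr vals f tabulated_other)
    qed simp
  next
    case (decide \<tau>)
    have lev: "holds_level V \<tau>" and tab: "tabulated V (int n + 1) (- M) \<tau>" using decide(1) by blast+
    have vals: "\<tau> vR 0 = R" "\<tau> vg 0 = cell_of (F V n (residual n c V))" "\<tau> vrho 0 = residual n c V"
      "\<tau> vV 0 = V" "\<tau> vstop 0 = 0" "\<tau> vcount 0 = (hiV - (V - 1)) * per_level"
      using decide(1) by (auto simp: holds_level_def holds_input_def)
    have Z1: "1 \<le> Z" using G_ge G_le_Z by linarith
    show ?case
    proof (rule run_If, goal_cases accept reject)
      case accept
      then have acc: "accepts n c R W V" by (simp add: accepts_iff_cell vals)
      then have opt: "V = optV" using accepts_imp_optV V by blast
      have fin: "F V n (residual n c V) \<noteq> \<infinity>"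
      proof
        assume "F V n (residual n c V) = \<infinity>"
        then show False using acc by (simp add: accepts_def)
      qed
      show ?case
      proof (rule run_Seq[where R = "\<lambda>\<upsilon>. \<upsilon> = \<tau>(vstop := (\<tau> vstop)(0 := 1))"], goal_cases stop trace)
        case stop
        show ?case using Z1 by (intro run_wp) auto
      next
        case (trace \<upsilon>)
        have lev': "holds_level V \<upsilon>" using lev trace(1) by (simp add: holds_level_def holds_input_def)
        have tab': "tabulated V (int n + 1) (- M) \<upsilon>" using tab trace(1) by (simp add: tabulated_other)
        have rho: "\<upsilon> vrho 0 = residual n c V" using trace(1) vals by simp
        show ?case
        proof (rule run_mono[OF run_prog_backtrack[OF lev' tab' rho fin V0 V(3)] order_refl], goal_cases)
          case (1 \<rho>)
          have "\<rho> vV = \<upsilon> vV" "\<rho> vcount = \<upsilon> vcount" "\<rho> vstop = \<upsilon> vstop"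
            using 1(2) by (simp_all add: prog_backtrack_def)
          then show ?case using 1(1) opt vals trace(1) by simp
        qed
      qed
    next
      case reject
      then have "\<not> accepts n c R W V" by (simp add: accepts_iff_cell vals)
      then have "optV < V" using optV(2) V by (cases "V = optV") auto
      moreover have "\<bar>V - 1\<bar> \<le> Z" using V0 Z1 level_le_Z[OF V(3)] by linarith
      ultimately show ?case by (intro run_wp) (simp_all add: vals)
    qed
  }
qed

lemma run_dp_prog:
  "run Z dp_prog (dp_input n c R) (400 * (n * (nat W)\<^sup>2 * (nat l1)\<^sup>2) * bit_len Z) solved"
proof -
  define Tb where "Tb = ((1 + (2 + nat (int n + 1 - 1) * (2 + 2))) +
     ((2 + nat (M + 1 - (- M)) * (1 + 2)) + 1 +
     (2 + nat (int n + 1 - 1) * ((2 + nat (M + 1 - (- M)) *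
       ((1 + (2 + nat (W + 1 - (- W)) * (12 + 2)) + 1 + 1) + 2)) + 2))) +
     1 + ((1 + (2 + (1 + n * (4 + 1)))) + 1))"
  define Tn where "Tn = 3 + (2 + nat (int n + 1 - 1) * (5 + 2))"
  define Tw where "Tw = 2 + (1 + nat (W - 1) * (1 + 1)) + 1 + 1"
  define Tl where "Tl = 3 + (1 + bit_len Z * (4 + 1)) + 1 + 1 + 3 + 3"
  define m where "m = nat (hiV - optV + 1)"
  have Z0: "1 \<le> Z" using G_ge G_le_Z by linarith
  let ?const = "\<lambda>\<tau>. holds_input \<tau> \<and> \<tau> vnorm 0 = nrm \<and> \<tau> vW 0 = W \<and> \<tau> vM 0 = M"
  let ?levels = "\<lambda>\<tau>. ?const \<tau> \<and> \<tau> vV 0 = hiV \<and> \<tau> vlo 0 = loV"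
  have "run Z dp_prog (dp_input n c R) (Tn + Tw + Tl + 1 + 1 + (1 + m * (Tb + 1))) solved"
    unfolding dp_prog_def level_body_def[symmetric]
  proof (rule run_Seq[where R = "\<lambda>\<tau>. ?levels \<tau> \<and> \<tau> vcount 0 = 0 \<and> \<tau> vstop 0 = 0"],
      rule run_Seq[where R = "\<lambda>\<tau>. ?levels \<tau> \<and> \<tau> vcount 0 = 0"],
      rule run_Seq[where R = ?levels], rule run_Seq[where R = "\<lambda>\<tau>. ?const \<tau> \<and> \<tau> vl1 0 = l1"],
      rule run_Seq[where R = "\<lambda>\<tau>. \<tau> vnorm 0 = nrm \<and> \<tau> vl1 0 = l1 \<and> \<tau> vmin 0 = cmin"],
      goal_cases norms window levels count stop loop)
    case norms
    show ?case unfolding Tn_def by (rule run_prog_norms[OF holds_input_dp_input])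
  next
    case (window \<tau>)
    have inp: "holds_input \<tau>"
      using holds_input_dp_input window(2) by (simp add: holds_input_def prog_norms_def For_def)
    show ?case unfolding Tw_def
    proof (rule run_mono[OF run_prog_window[OF inp] order_refl], goal_cases)
      case (4 \<upsilon>)
      have fr: "\<upsilon> v = \<tau> v" if "v \<notin> {vsq, vW, vM}" for v
        using 4(2) that by (simp add: prog_window_def)
      show ?case using 4(1) inp window(1) by (simp add: holds_input_def fr)
    qed (use window(1) in auto)
  next
    case (levels \<tau>)
    then have pre: "holds_input \<tau>" "\<tau> vnorm 0 = nrm" "\<tau> vl1 0 = l1" by auto
    show ?case unfolding Tl_def
    proof (rule run_mono[OF run_prog_levels[OF pre] order_refl], goal_cases)
      case (1 \<upsilon>)
      have fr: "\<upsilon> v = \<tau> v" if "v \<notin> {vsq, va, vb, vmid, vV, vlo}" for v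
        using 1(2) that by (simp add: prog_levels_def)
      show ?case using 1(1) levels(1) by (simp add: holds_input_def fr)
    qed
  next
    case (count \<tau>)
    then show ?case using Z0 by (intro run_wp) (auto simp: holds_input_def)
  next
    case (stop \<tau>)
    then show ?case using Z0 by (intro run_wp) (auto simp: holds_input_def)
  next
    case (loop \<tau>)
    \<comment> \<open>While scanning, \<open>k\<close> counts the levels down to and including
      \<open>optV\<close>, so it is at least 1. An exhausted allowance thus forces the stopped case,
      in which \<open>k\<close> is arbitrary.\<close>
    let ?I = "\<lambda>k \<tau>. \<tau> vstop 0 = 0 \<and> int k = \<tau> vV 0 - optV + 1 \<and> optV \<le> \<tau> vV 0 \<and> \<tau> vV 0 \<le> hiV \<and>
        \<tau> vcount 0 = (hiV - \<tau> vV 0) * per_level \<or> \<tau> vstop 0 = 1 \<and> solved \<tau>"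
    have fr: "\<upsilon> v = \<tau> v"
      if "\<forall>v. v \<notin> written level_body \<longrightarrow> \<upsilon> v = \<tau> v" "v \<in> {vn, vR, vc, vW, vM, vnorm, vlo}" for \<upsilon> v
      using that written_level_body by blast
    show ?case
    proof (rule run_While[where I = ?I], goal_cases init stop step exit)
      case init
      show ?case using loop(1) optV(1) by (simp add: m_def)
    next
      case (stop \<upsilon>)
      then show ?case by auto
    next
      case (step k \<upsilon>)
      then have I: "\<upsilon> vstop 0 = 0" "int k = \<upsilon> vV 0 - optV" "optV \<le> \<upsilon> vV 0" "\<upsilon> vV 0 \<le> hiV"
        "\<upsilon> vcount 0 = (hiV - \<upsilon> vV 0) * per_level"
        by auto
      have const: "holds_input \<upsilon>" "\<upsilon> vnorm 0 = nrm" "\<upsilon> vW 0 = W" "\<upsilon> vM 0 = M"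
        using loop(1) fr[OF step(3)] by (simp_all add: holds_input_def)
      show ?case unfolding Tb_def
        by (rule run_mono[OF run_level_body[OF const I(1) refl I(3-5)] order_refl]) (use I in auto)
    next
      case (exit k \<upsilon>)
      \<comment> \<open>The loop cannot run out of levels: while scanning,
        \<open>loV <= optV <= vV\<close>, so only the flag can end it.\<close>
      have "\<upsilon> vlo 0 = loV" using loop(1) fr[OF exit(3)] by simp
      then show ?case using exit(1,2) optV(1) by auto
    qed
  qed
  moreover have "Tn + Tw + Tl + 1 + 1 + (1 + m * (Tb + 1)) \<le> 400 * (n * (nat W)\<^sup>2 * (nat l1)\<^sup>2) * bit_len Z"
  proof -
    have nats: "nat (int n + 1 - 1) = n" "nat (W - 1) = nat W - 1"
      "nat (W + 1 - (- W)) = 2 * nat W + 1" "nat (M + 1 - (- M)) = 2 * (nat W * nat l1) + 1"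
      using W_ge n_le_l1 M_pos by (simp_all add: M_def nat_mult_distrib[symmetric] nat_diff_distrib)
    show ?thesis
      unfolding Tn_def Tw_def Tl_def Tb_def nats
      by (rule steps_le) (use n_ge W_ge n_le_l1 bit_len_pos[of Z] level_count in \<open>auto simp: m_def\<close>)
  qed
  ultimately show ?thesis by (rule run_mono)
qed

end

section \<open>Bounds in terms of the input\<close>

context dp_instance
begin

lemma bounded_dp_input: "bounded_store Z (dp_input n c R)"
proof -
  have "\<bar>c (nat k)\<bar> \<le> Z" if "1 \<le> k" "k \<le> int n" for k
    using c_bounds[of "nat k"] that G_le_Z by force
  then show ?thesis
    using G_ge G_le_Z R_pos by (auto simp: bounded_store_def dp_input_def)
qed

text \<open>Here 52 is \<open>10 * 5 + 2\<close>: the exponent of \<open>Z\<close>, the lengths 1,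
  1, 2, 1 (in units of the input length) of \<open>n\<close>, \<open>l1\<close>, \<open>nrm\<close>,
  \<open>R\<close> in \<open>G\<close>, and the constant of \<open>bit_len_power\<close>. They rest
  on \<open>n <= l1\<close> and \<open>nrm <= l1^2\<close>.\<close>

lemma bit_len_Z_le: "bit_len Z \<le> 52 * input_len n c R"
proof -
  define L where "L = input_len n c R"
  have l1: "bit_len l1 \<le> L"
    using bit_len_sum[of "{1..n}" c] bit_len_pos[of R] by (simp add: l1_def L_def input_len_def)
  have n: "bit_len (int n) \<le> L"
    using bit_len_mono[of "int n" l1] n_le_l1 l1 by simp
  have "nrm \<le> (\<Sum>i=1..n. c i * l1)"
    unfolding nrm_def power2_eq_square
    by (intro sum_mono mult_left_mono c_le_l1) (use c_pos in \<open>auto simp: less_imp_le\<close>)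
  also have "\<dots> = l1 * l1" unfolding sum_distrib_right[symmetric] l1_def ..
  finally have "bit_len nrm \<le> bit_len (l1 * l1)"
    using nrm_pos by (intro bit_len_mono) auto
  also have "\<dots> \<le> 2 * L" using bit_len_mult[of l1 l1] l1 by simp
  finally have nrm: "bit_len nrm \<le> 2 * L" .
  have R: "bit_len R \<le> L" by (simp add: L_def input_len_def)
  have "bit_len G \<le> 5 * L"
    using bit_len_add[of "int n + l1 + nrm" R] bit_len_add[of "int n + l1" nrm]
      bit_len_add[of "int n" l1] n l1 nrm R unfolding G_def by linarith
  moreover have "bit_len Z \<le> 10 * bit_len G + 2" unfolding Z_def by (rule bit_len_power)
  moreover have "1 \<le> L" using R bit_len_pos[of R] by simp
  ultimately show ?thesis unfolding L_def by linarith
qed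

lemma card_transitions: "int (card (transitions n c R W)) = (hiV - optV + 1) * per_level"
  using optV(1) M_pos W_ge n_le_l1
  by (simp add: transitions_def scanned_eq card_cartesian_product norm1_eq M_def per_level_def
      algebra_simps)

abbreviation Q :: real where
  "Q \<equiv> real n * (real_of_int W)\<^sup>2 * (real_of_int (norm1 n c))\<^sup>2"

text \<open>The cube consists of the quadratic price of a step and the factor from the
  bisection.\<close>

lemma dp_prog_correct:
  obtains t \<sigma> where "(dp_prog, dp_input n c R) \<Rightarrow> t \<Down> \<sigma>"
    "real t \<le> 400 * 52 ^ 3 * real (cweight dp_prog) * Q * real (input_len n c R) ^ 3"
    "let V = \<sigma> vV 0; x = (\<lambda>i. \<sigma> vx (int i)) in
      dp_returns n c R W V x \<and>
      is_arg_max (objective n c) (feasible n R) x \<and> V = objective n c x"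
    "\<sigma> vcount 0 = int (card (transitions n c R W))"
proof -
  define q where "q = n * (nat W)\<^sup>2 * (nat l1)\<^sup>2"
  obtain t \<sigma> where run: "(dp_prog, dp_input n c R) \<Rightarrow> t \<Down> \<sigma>"
    and t: "t \<le> (400 * q * bit_len Z) * (cweight dp_prog * (bit_len Z)\<^sup>2)" and sol: "solved \<sigma>"
    using run_dp_prog bounded_dp_input unfolding run_def q_def by blast
  have "t \<le> 400 * q * cweight dp_prog * (bit_len Z) ^ 3"
    using t by (simp add: power2_eq_square power3_eq_cube algebra_simps)
  also have "\<dots> \<le> 400 * q * cweight dp_prog * (52 * input_len n c R) ^ 3"
    by (intro mult_le_mono2 power_mono bit_len_Z_le) simp
  finally have "real t \<le> real (400 * q * cweight dp_prog * (52 * input_len n c R) ^ 3)"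
    by (simp only: of_nat_le_iff)
  also have "\<dots> = 400 * 52 ^ 3 * real (cweight dp_prog) * real q * real (input_len n c R) ^ 3"
    by (simp add: power_mult_distrib algebra_simps)
  also have "real q = Q"
    using W_ge n_le_l1 by (simp add: q_def norm1_eq)
  finally have time: "real t \<le> 400 * 52 ^ 3 * real (cweight dp_prog) * Q * real (input_len n c R) ^ 3" .
  have "\<sigma> vcount 0 = int (card (transitions n c R W))" using sol by (simp only: card_transitions)
  moreover have "let V = \<sigma> vV 0; x = (\<lambda>i. \<sigma> vx (int i)) in dp_returns n c R W V x \<and>
      is_arg_max (objective n c) (feasible n R) x \<and> V = objective n c x"
    using backtracked_optimal sol unfolding Let_def by simp
  ultimately show ?thesis using that[OF run time] by blast
qed

text \<open>From \<open>W <= d + 2\<close> and \<open>(d + 2)^2 <= 2 * d^2 + 8\<close>; the constant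
  is absorbed because \<open>2 <= sq4\<close>.\<close>

lemma W_square_le: "(real_of_int W)\<^sup>2 \<le> 5 * real_of_int sq4"
proof -
  define d where "d = sqrt (real_of_int sq4) / 2"
  have "real_of_int W \<le> d + 2" unfolding W_def d_def by linarith
  then have "(real_of_int W)\<^sup>2 \<le> (d + 2)\<^sup>2" using W_ge by (intro power_mono) auto
  also have "\<dots> \<le> 2 * d\<^sup>2 + 8"
    using zero_le_power2[of "d - 2"] by (simp add: power2_eq_square algebra_simps)
  also have "d\<^sup>2 = real_of_int sq4 / 4"
    using sq4_bounds nrm_pos by (simp add: d_def power_divide)
  also have "2 * (real_of_int sq4 / 4) + 8 \<le> 5 * real_of_int sq4"
  proof -
    have "2 \<le> sq4" using sq4_bounds nrm_ge n_ge by simp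
    then have "2 \<le> real_of_int sq4" by simp
    then show ?thesis by simp
  qed
  finally show ?thesis .
qed

lemma c_le_cmax: "i \<in> {1..n} \<Longrightarrow> c i \<le> cmax n c"
proof -
  assume "i \<in> {1..n}"
  then have "\<bar>c i\<bar> \<le> cmax n c" unfolding cmax_def by (intro Max_ge) auto
  then show ?thesis by simp
qed

text \<open>The 10 comes from \<open>W^2 <= 5 * sq4 <= 10 * nrm\<close>; then \<open>nrm\<close> and
  \<open>l1^2\<close> contribute \<open>n\<close> and \<open>n^2\<close> times the square of the
  largest entry.\<close>

lemma Q_le: "Q \<le> 10 * (real n ^ 4 * real_of_int (cmax n c) ^ 4)"
proof -
  define x where "x = real_of_int (cmax n c)"
  have cm: "0 < cmax n c" using c_le_cmax[of 1] c_pos[of 1] n_ge by simp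
  have "l1 \<le> (\<Sum>i=1..n. cmax n c)" unfolding l1_def by (intro sum_mono c_le_cmax)
  then have "real_of_int l1 \<le> real_of_int (int n * cmax n c)" by (simp only: of_int_le_iff) simp
  then have l1: "(real_of_int l1)\<^sup>2 \<le> (real n * x)\<^sup>2"
    using n_le_l1 by (intro power_mono) (auto simp: x_def)
  have "nrm \<le> (\<Sum>i=1..n. (cmax n c)\<^sup>2)"
    unfolding nrm_def by (intro sum_mono power_mono c_le_cmax) (use c_pos in \<open>auto simp: less_imp_le\<close>)
  then have "real_of_int sq4 \<le> real_of_int (2 * (int n * (cmax n c)\<^sup>2))"
    using sq4_bounds by (simp only: of_int_le_iff) simp
  then have "(real_of_int W)\<^sup>2 \<le> 10 * (real n * x\<^sup>2)"
    using W_square_le by (simp add: x_def)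
  then have "Q \<le> real n * (10 * (real n * x\<^sup>2)) * (real n * x)\<^sup>2"
    unfolding norm1_eq using l1 by (intro mult_mono mult_left_mono) auto
  also have "\<dots> = 10 * (real n ^ 4 * x ^ 4)"
    by (simp add: power_mult_distrib power2_eq_square power4_eq_xxxx)
  finally show ?thesis by (simp add: x_def)
qed

text \<open>The factors \<open>l1 + 1\<close>, \<open>2 * M + 1\<close>, \<open>2 * W + 1\<close>
  are at most \<open>2 * l1\<close>, \<open>3 * M\<close>, \<open>3 * W\<close>, which gives 18;
  \<open>W_square_le\<close> contributes 5.\<close>

lemma card_transitions_le:
  assumes "c h = cmin"
  shows "real (card (transitions n c R W))
    \<le> 90 * (real n * (real_of_int (norm1 n c))\<^sup>2
        * (1 + (norm2 n c)\<^sup>2 + (real n - 2) * (real_of_int (c h))\<^sup>2))"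
proof -
  have "(hiV - optV + 1) * per_level \<le> (2 * l1) * (int n * ((3 * M) * (3 * W)))"
    unfolding per_level_def
    using level_count n_le_l1 n_ge M_pos W_ge optV(1)
    by (intro mult_mono mult_nonneg_nonneg) auto
  also have "\<dots> = 18 * (int n * W\<^sup>2 * l1\<^sup>2)"
    by (simp add: M_def power2_eq_square)
  finally have "real_of_int (int (card (transitions n c R W))) \<le> real_of_int (18 * (int n * W\<^sup>2 * l1\<^sup>2))"
    by (simp only: card_transitions of_int_le_iff)
  then have "real (card (transitions n c R W)) \<le> 18 * (real n * (real_of_int l1)\<^sup>2 * (real_of_int W)\<^sup>2)"
    by (simp add: algebra_simps)
  also have "\<dots> \<le> 18 * (real n * (real_of_int l1)\<^sup>2 * (5 * (1 + real_of_int sq4)))"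
    using W_square_le by (intro mult_left_mono) auto
  also have "real_of_int sq4 = (norm2 n c)\<^sup>2 + (real n - 2) * (real_of_int (c h))\<^sup>2"
    by (simp add: sq4_def norm2_sq assms)
  finally show ?thesis by (simp add: norm1_eq algebra_simps)
qed

end

theorem theorem4p5:
  "\<exists>(C::real) (k::nat).
    (\<forall>(n::nat) (c::nat \<Rightarrow> int) (R::int) (h::nat) (W::int).
      2 \<le> n \<longrightarrow> (\<forall>i\<in>{1..n}. 0 < c i) \<longrightarrow> primitive n c \<longrightarrow> 0 < R \<longrightarrow>
      h \<in> {1..n} \<longrightarrow> c h = Min (c ` {1..n}) \<longrightarrow> W = \<lceil>covering_bound n c h\<rceil> + 1 \<longrightarrow>
      (\<exists>t \<sigma>. (dp_prog, dp_input n c R) \<Rightarrow> t \<Down> \<sigma> \<and>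
         (let V = \<sigma> vV 0; x = (\<lambda>i. \<sigma> vx (int i)) in
            dp_returns n c R W V x \<and>
            is_arg_max (objective n c) (feasible n R) x \<and> V = objective n c x) \<and>
         \<sigma> vcount 0 = int (card (transitions n c R W)) \<and>
         real t \<le> C * (real n * (real_of_int W)\<^sup>2 * (real_of_int (norm1 n c))\<^sup>2)
                    * real (input_len n c R) ^ k \<and>
         real t \<le> C * (real n ^ 4 * real_of_int (cmax n c) ^ 4) * real (input_len n c R) ^ k) \<and>
      real n * (real_of_int W)\<^sup>2 * (real_of_int (norm1 n c))\<^sup>2
        \<le> C * (real n ^ 4 * real_of_int (cmax n c) ^ 4) \<and>
      real (card (transitions n c R W))
        \<le> C * (real n * (real_of_int (norm1 n c))\<^sup>2
                 * (1 + (norm2 n c)\<^sup>2 + (real n - 2) * (real_of_int (c h))\<^sup>2))) \<and>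
    (\<forall>(n::nat) (c::nat \<Rightarrow> int).
      2 \<le> n \<longrightarrow> (\<forall>i\<in>{1..n}. 0 < c i) \<longrightarrow> primitive n c \<longrightarrow>
      (\<exists>C'::real. \<forall>R>0. \<exists>t \<sigma>. (dp_prog, dp_input n c R) \<Rightarrow> t \<Down> \<sigma> \<and>
         real t \<le> C' * real (bit_len R) ^ k))"
proof -
  define K where "K = 400 * 52 ^ 3 * real (cweight dp_prog)"
  have K: "0 \<le> K" by (simp add: K_def)
  \<comment> \<open>One constant for all claims: \<open>10 * K\<close> for the time in terms of the
    largest entry, 90 for the transitions and, a fortiori, for the 10 of
    \<open>Q_le\<close>.\<close>
  define C where "C = 10 * K + 90"
  show ?thesis
  proof (rule exI[of _ C], rule exI[of _ 3], intro conjI allI impI, goal_cases run Q card radius)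
    case (run n c R h W)
    interpret dp_instance n c R by unfold_locales (use run in auto)
    have W: "W = dp_instance.W n c"
      using run covering_bound_eq[of h] by (simp add: W_def cmin_def)
    obtain t \<sigma> where *: "(dp_prog, dp_input n c R) \<Rightarrow> t \<Down> \<sigma>"
      "real t \<le> K * Q * real (input_len n c R) ^ 3"
      "let V = \<sigma> vV 0; x = (\<lambda>i. \<sigma> vx (int i)) in
        dp_returns n c R W V x \<and> is_arg_max (objective n c) (feasible n R) x \<and> V = objective n c x"
      "\<sigma> vcount 0 = int (card (transitions n c R W))"
      unfolding K_def W by (rule dp_prog_correct)
    have "K * Q \<le> C * Q" using K by (intro mult_right_mono) (auto simp: C_def)
    then have 1: "real t \<le> C * Q * real (input_len n c R) ^ 3"
      by (rule order_trans[OF *(2) mult_right_mono]) simp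
    have "K * Q \<le> K * (10 * (real n ^ 4 * real_of_int (cmax n c) ^ 4))"
      using Q_le K by (rule mult_left_mono)
    also have "\<dots> = (10 * K) * (real n ^ 4 * real_of_int (cmax n c) ^ 4)" by simp
    also have "\<dots> \<le> C * (real n ^ 4 * real_of_int (cmax n c) ^ 4)"
      by (intro mult_right_mono) (auto simp: C_def)
    finally have 2: "real t \<le> C * (real n ^ 4 * real_of_int (cmax n c) ^ 4) * real (input_len n c R) ^ 3"
      by (rule order_trans[OF *(2) mult_right_mono]) simp
    show ?case using * 1 2 unfolding W by blast
  next
    case (Q n c R h W)
    interpret dp_instance n c R by unfold_locales (use Q in auto)
    have W: "W = dp_instance.W n c"
      using Q covering_bound_eq[of h] by (simp add: W_def cmin_def)
    have "10 * (real n ^ 4 * real_of_int (cmax n c) ^ 4) \<le> C * (real n ^ 4 * real_of_int (cmax n c) ^ 4)"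
      using K by (intro mult_right_mono) (auto simp: C_def)
    then show ?case using Q_le unfolding W by linarith
  next
    case (card n c R h W)
    interpret dp_instance n c R by unfold_locales (use card in auto)
    have W: "W = dp_instance.W n c"
      using card covering_bound_eq[of h] by (simp add: W_def cmin_def)
    have "c h = cmin" using card by (simp add: cmin_def)
    note card_transitions_le[OF this]
    also have "90 * (real n * (real_of_int (norm1 n c))\<^sup>2
          * (1 + (norm2 n c)\<^sup>2 + (real n - 2) * (real_of_int (c h))\<^sup>2)) \<le> C * (real n * (real_of_int (norm1 n c))\<^sup>2
          * (1 + (norm2 n c)\<^sup>2 + (real n - 2) * (real_of_int (c h))\<^sup>2))"
      using K card by (intro mult_right_mono mult_nonneg_nonneg add_nonneg_nonneg) (auto simp: C_def)
    finally show ?case unfolding W .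
  next
    case (radius n c)
    define A where "A = (\<Sum>i=1..n. bit_len (c i))"
    \<comment> \<open>\<open>W\<close> depends on \<open>n\<close> and \<open>c\<close> alone, so
      this factor can be fixed before \<open>R\<close> is chosen.\<close>
    define q where "q = real n * (real_of_int (dp_instance.W n c))\<^sup>2 * (real_of_int (norm1 n c))\<^sup>2"
    have "\<exists>t \<sigma>. (dp_prog, dp_input n c R) \<Rightarrow> t \<Down> \<sigma> \<and>
        real t \<le> (K * q * real (A + 1) ^ 3) * real (bit_len R) ^ 3" if "0 < R" for R
    proof -
      interpret dp_instance n c R by unfold_locales (use radius that in auto)
      obtain t \<sigma> where run: "(dp_prog, dp_input n c R) \<Rightarrow> t \<Down> \<sigma>"
        and t: "real t \<le> K * q * real (input_len n c R) ^ 3"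
        unfolding K_def q_def by (rule dp_prog_correct)
      \<comment> \<open>As \<open>bit_len R\<close> is at least 1, the sum
        \<open>A + bit_len R\<close> is bounded by a product, which separates \<open>c\<close> from
        the radius.\<close>
      have "A * 1 \<le> A * bit_len R" using bit_len_pos[of R] by (intro mult_le_mono2) simp
      then have "input_len n c R \<le> (A + 1) * bit_len R" by (simp add: input_len_def A_def)
      then have "real (input_len n c R) \<le> real ((A + 1) * bit_len R)" by (simp only: of_nat_le_iff)
      then have "real (input_len n c R) ^ 3 \<le> real ((A + 1) * bit_len R) ^ 3" by (intro power_mono) auto
      also have "\<dots> = real (A + 1) ^ 3 * real (bit_len R) ^ 3" by (simp only: of_nat_mult power_mult_distrib)
      finally have "K * q * real (input_len n c R) ^ 3 \<le> K * q * (real (A + 1) ^ 3 * real (bit_len R) ^ 3)"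
        using K by (intro mult_left_mono) (auto simp: q_def)
      with t have "real t \<le> (K * q * real (A + 1) ^ 3) * real (bit_len R) ^ 3"
        unfolding mult.assoc by (rule order_trans)
      with run show ?thesis by blast
    qed
    then show ?case by blast
  qed
qed

end
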